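(* Let $f(z)=\sum_{k\ge0}\frac{\xi_k}{\sqrt{k!}}z^k$ be the standard planar Gaussian analytic function, with zero process $\mathcal{Z}$, and let $a_k$ $(k\ge 0)$ and $\chi$ be the random variables defined in the context. Consider the random analytic function $g(z)=\sum_{k=0}^{\infty}\chi a_k z^k$, which is measurable with respect to the zeroes $\mathcal{Z}$ of $f$. There is a random variable $\zeta$, uniformly distributed on the unit circle $\mathbb{S}^1$ and independent of $\mathcal{Z}$, such that almost surely $f(z)=\zeta g(z)$.
   Context: $(\xi_k)_{k\ge 0}$ are i.i.d. standard complex Gaussians. Let $f_n(z)=\sum_{k=0}^n\frac{\xi_k}{\sqrt{k!}}z^k$, let $\mathcal{Z}_n$ be the zero set of $f_n$, and for $k\ge1$ set $\alpha_k(n)=\sum_{z\in\mathcal{Z}_n}\frac1{z^k}$. For each $k\ge1$ the random variables $\alpha_k(n)$ converge in probability as $n\to\infty$; denote the limit by $\alpha_k$. $P_k$ is the $k$-th Newton polynomial: the polynomial (with coefficients depending only on $k$) expressing elementary symmetric functions through power sums, i.e. $e_k(z_1,\dots,z_N)=P_k(\beta_1,\dots,\beta_k)$ where $e_k$ is the elementary symmetric polynomial of order $k$ and $\beta_i=\sum_{j=1}^N z_j^i$; $P_0=1$. Define $a_k=(-1)^kP_k(\alpha_1,\dots,\alpha_k)$ (so $a_0=1$) and $$\chi=\lim_{k\to\infty}k^{1/2}\Big(\sum_{j=0}^{k-1}j!\,|a_j|^2\Big)^{-1/2},$$ where the limit exists almost surely. *)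

theory Defs
  imports "HOL-Probability.Probability"
begin

text \<open>The coefficients are i.i.d. standard complex Gaussians: density \<open>exp (- |z|\<^sup>2) / pi\<close> with
  respect to Lebesgue measure on the plane, so that \<open>E |\<xi> k|\<^sup>2 = 1\<close>.\<close>

definition iid_std_complex_gaussian :: "'a measure \<Rightarrow> (nat \<Rightarrow> 'a \<Rightarrow> complex) \<Rightarrow> bool" where
  "iid_std_complex_gaussian M \<xi> \<longleftrightarrow>
     prob_space.indep_vars M (\<lambda>_. borel) \<xi> UNIV \<and>
     (\<forall>k. distributed M lborel (\<xi> k) (\<lambda>z. ennreal (exp (- (cmod z)\<^sup>2) / pi)))"

definition gaf :: "(nat \<Rightarrow> 'a \<Rightarrow> complex) \<Rightarrow> 'a \<Rightarrow> complex \<Rightarrow> complex" where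
  "gaf \<xi> \<omega> z = (\<Sum>k. \<xi> k \<omega> / complex_of_real (sqrt (fact k)) * z ^ k)"

definition gaf_poly :: "(nat \<Rightarrow> 'a \<Rightarrow> complex) \<Rightarrow> nat \<Rightarrow> 'a \<Rightarrow> complex \<Rightarrow> complex" where
  "gaf_poly \<xi> n \<omega> z = (\<Sum>k\<le>n. \<xi> k \<omega> / complex_of_real (sqrt (fact k)) * z ^ k)"

text \<open>The zeros of \<open>gaf\<close> form a random set. On the null event where the series fails to
  converge everywhere, \<open>gaf\<close> is meaningless and the empty configuration is used instead.\<close>

definition zero_process :: "(nat \<Rightarrow> 'a \<Rightarrow> complex) \<Rightarrow> 'a \<Rightarrow> complex set" where
  "zero_process \<xi> \<omega> =
     (if \<forall>z. summable (\<lambda>k. \<xi> k \<omega> / complex_of_real (sqrt (fact k)) * z ^ k)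
      then {z. gaf \<xi> \<omega> z = 0} else {})"

text \<open>Point configurations in the plane carry the \<open>\<sigma>\<close>-algebra generated by the numbers of
  points in bounded Borel sets.\<close>

definition configs :: "complex set measure" where
  "configs = sigma UNIV
     {{S. finite (S \<inter> B) \<and> card (S \<inter> B) = m} | B m. B \<in> sets borel \<and> bounded B}"

text \<open>The \<open>\<sigma>\<close>-algebra generated by the zero process, augmented by the null events: the
  random variables measurable with respect to the zeros below are limits in probability, and
  hence are determined only up to null events.\<close>

definition zero_sigma_algebra :: "'a measure \<Rightarrow> (nat \<Rightarrow> 'a \<Rightarrow> complex) \<Rightarrow> 'a measure" where
  "zero_sigma_algebra M \<xi> =
     sigma (space M)
       (sets (vimage_algebra (space M) (zero_process \<xi>) configs) \<union> null_sets M)"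

text \<open>The completion of \<open>M\<close> appears only so that the \<open>X n\<close> may be random variables up to null
  events; when they are \<open>M\<close>-measurable, this is the usual convergence in probability.\<close>

definition tendsto_in_prob :: "'a measure \<Rightarrow> (nat \<Rightarrow> 'a \<Rightarrow> complex) \<Rightarrow> ('a \<Rightarrow> complex) \<Rightarrow> bool" where
  "tendsto_in_prob M X Y \<longleftrightarrow>
     (\<forall>n. X n \<in> borel_measurable (completion M)) \<and> Y \<in> borel_measurable M \<and>
     (\<forall>\<epsilon>>0. (\<lambda>n. measure (completion M) {\<omega> \<in> space M. dist (X n \<omega>) (Y \<omega>) > \<epsilon>})
              \<longlonglongrightarrow> 0)"

text \<open>The sum runs over the zero set, which almost surely is finite and omits \<open>0\<close>.\<close>

definition alpha_n :: "(nat \<Rightarrow> 'a \<Rightarrow> complex) \<Rightarrow> nat \<Rightarrow> nat \<Rightarrow> 'a \<Rightarrow> complex" where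
  "alpha_n \<xi> k n \<omega> = (\<Sum>z\<in>{z. gaf_poly \<xi> n \<omega> z = 0}. 1 / z ^ k)"

text \<open>The limit in probability is unique up to null events; an arbitrary version is chosen.\<close>

definition alpha :: "'a measure \<Rightarrow> (nat \<Rightarrow> 'a \<Rightarrow> complex) \<Rightarrow> nat \<Rightarrow> 'a \<Rightarrow> complex" where
  "alpha M \<xi> k = (SOME Y. tendsto_in_prob M (alpha_n \<xi> k) Y)"

definition elem_sym :: "nat \<Rightarrow> nat \<Rightarrow> (nat \<Rightarrow> complex) \<Rightarrow> complex" where
  "elem_sym k N z = (\<Sum>S | S \<subseteq> {1..N} \<and> card S = k. \<Prod>j\<in>S. z j)"

definition power_sum :: "nat \<Rightarrow> (nat \<Rightarrow> complex) \<Rightarrow> nat \<Rightarrow> complex" where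
  "power_sum N z i = (\<Sum>j=1..N. z j ^ i)"

text \<open>Polynomial functions of the coordinates \<open>b 1, \<dots>, b k\<close> of \<open>b\<close>.\<close>

inductive_set poly_funs :: "nat \<Rightarrow> ((nat \<Rightarrow> complex) \<Rightarrow> complex) set" for k :: nat where
  const: "(\<lambda>b. c) \<in> poly_funs k"
| coord: "1 \<le> i \<Longrightarrow> i \<le> k \<Longrightarrow> (\<lambda>b. b i) \<in> poly_funs k"
| add: "P \<in> poly_funs k \<Longrightarrow> Q \<in> poly_funs k \<Longrightarrow> (\<lambda>b. P b + Q b) \<in> poly_funs k"
| mult: "P \<in> poly_funs k \<Longrightarrow> Q \<in> poly_funs k \<Longrightarrow> (\<lambda>b. P b * Q b) \<in> poly_funs k"

text \<open>Such a polynomial function exists by Newton's identities. It is unique because the power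
  sums of orders \<open>1, \<dots>, k\<close> of \<open>k\<close> complex numbers take all values in \<open>k\<close>-dimensional complex
  space.\<close>

definition newton_poly :: "nat \<Rightarrow> (nat \<Rightarrow> complex) \<Rightarrow> complex" where
  "newton_poly k =
     (THE P. P \<in> poly_funs k \<and> (\<forall>N z. elem_sym k N z = P (power_sum N z)))"

definition a_coeff :: "'a measure \<Rightarrow> (nat \<Rightarrow> 'a \<Rightarrow> complex) \<Rightarrow> nat \<Rightarrow> 'a \<Rightarrow> complex" where
  "a_coeff M \<xi> k \<omega> = (-1) ^ k * newton_poly k (\<lambda>i. alpha M \<xi> i \<omega>)"

definition chi :: "'a measure \<Rightarrow> (nat \<Rightarrow> 'a \<Rightarrow> complex) \<Rightarrow> 'a \<Rightarrow> real" where
  "chi M \<xi> \<omega> =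
     lim (\<lambda>k. sqrt (real k) / sqrt (\<Sum>j<k. fact j * (cmod (a_coeff M \<xi> j \<omega>))\<^sup>2))"

definition g_fun :: "'a measure \<Rightarrow> (nat \<Rightarrow> 'a \<Rightarrow> complex) \<Rightarrow> 'a \<Rightarrow> complex \<Rightarrow> complex" where
  "g_fun M \<xi> \<omega> z = (\<Sum>k. complex_of_real (chi M \<xi> \<omega>) * a_coeff M \<xi> k \<omega> * z ^ k)"

text \<open>The library's \<open>indep_var\<close> requires both random variables to take values in the same type.
  This is its unfolding without that restriction.\<close>

definition indep_rv ::
  "'a measure \<Rightarrow> 'b measure \<Rightarrow> ('a \<Rightarrow> 'b) \<Rightarrow> 'c measure \<Rightarrow> ('a \<Rightarrow> 'c) \<Rightarrow> bool" where
  "indep_rv M S X T Y \<longleftrightarrow>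
     X \<in> measurable M S \<and> Y \<in> measurable M T \<and>
     prob_space.indep_set M
       (sets (vimage_algebra (space M) X S)) (sets (vimage_algebra (space M) Y T))"

definition uniform_circle :: "complex measure" where
  "uniform_circle = distr (uniform_measure lborel {0..2 * pi}) borel cis"

end

theory Submission
  imports Defs "HOL-Complex_Analysis.Complex_Analysis" "HOL-Computational_Algebra.Fundamental_Theorem_Algebra"
begin

text \<open>Since the zeros of \<open>f\<^sub>n\<close> are almost surely simple, \<open>\<alpha>\<^sub>k(n)\<close> is minus the coefficient of \<open>z\<^sup>k\<^sup>-\<^sup>1\<close> in the
  logarithmic derivative of \<open>f\<^sub>n\<close>, which only depends on \<open>\<xi>\<^sub>0, \<dots>, \<xi>\<^sub>k\<close> once \<open>n \<ge> k\<close>; hence \<open>\<alpha>\<^sub>k\<close> is the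
  corresponding coefficient for \<open>f\<close>. Newton's identities turn this into
  \<open>a\<^sub>k = \<xi>\<^sub>k / (\<xi>\<^sub>0 \<surd>k!)\<close>, the strong law of large numbers for \<open>\<bar>\<xi>\<^sub>j\<bar>\<^sup>2\<close> gives \<open>\<chi> = \<bar>\<xi>\<^sub>0\<bar>\<close>, and so
  \<open>f = \<zeta> g\<close> with \<open>\<zeta> = \<xi>\<^sub>0 / \<bar>\<xi>\<^sub>0\<bar>\<close>. Rotating all coefficients by a common phase preserves their law
  and the zeros but rotates \<open>\<zeta>\<close>; averaging over the phase shows that \<open>\<zeta>\<close> is uniform and independent
  of the zeros.

  It remains to see that the zeros of \<open>f\<close> determine \<open>\<alpha>\<^sub>k\<close>. The Fourier coefficient of order \<open>k\<close> in
  Jensen's formula on the circle of radius \<open>R\<close> expresses \<open>\<alpha>\<^sub>k\<close>, up to a term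
  \<open>O(R\<^sup>-\<^sup>k)\<close> times the mean of the modulus of \<open>log \<bar>f\<bar> - R\<^sup>2 / 2\<close> over the circle, as the sum
  of \<open>z\<^sup>-\<^sup>k - (cnj z / R\<^sup>2)\<^sup>k\<close> over the zeros \<open>\<bar>z\<bar> < R\<close>. Crude first moment bounds (a single dominant
  coefficient from below, the triangle inequality from above) show that the expectation of that mean is
  \<open>O(log R)\<close>, so the error vanishes almost surely along \<open>R = 2\<^sup>n\<close>.\<close>

section \<open>Newton polynomials\<close>

text \<open>All the algebra runs through one formal differential equation F' = -B F, where B has
  coefficients b (i + 1). Its solution with F(0) = 1 has coefficients \<open>newton_coeff b\<close>,
  so power sums, elementary symmetric functions and the coefficients of f / f(0) obey the same
  recursion, for finite products and entire functions alike. The obstacle is that alpha_k comes from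
  the polynomials f_n, whose zeros are not those of f, while \<open>zero_sigma_algebra\<close> sees
  only the zeros of f. Jensen's formula of order k bridges this with nothing more than a first
  moment bound: along R = 2^n the bounds divided by R are summable, and one null event serves every
  k. On the probabilistic side \<open>resample\<close> does two jobs. Resampling
  \<open>\<xi> 0\<close> adds a constant to f, so double zeros and zeros on a given circle are
  excluded by showing that the offending constants form a negligible set. Resampling a dominant
  coefficient gives the lower bound for log |f(z)|, because the density of \<open>gauss\<close> is
  bounded.\<close>

fun newton_coeff :: "(nat \<Rightarrow> complex) \<Rightarrow> nat \<Rightarrow> complex" where
  "newton_coeff b 0 = 1"
| "newton_coeff b (Suc n) = - (\<Sum>i\<le>n. b (Suc i) * newton_coeff b (n - i)) / of_nat (Suc n)"

definition shift_fps :: "(nat \<Rightarrow> complex) \<Rightarrow> complex fps" where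
  "shift_fps b = Abs_fps (\<lambda>n. b (Suc n))"

lemma newton_coeff_unique:
  fixes F :: "complex fps"
  assumes "fps_nth F 0 = 1"
    and "\<And>n. n < k \<Longrightarrow> fps_nth (fps_deriv F) n = - fps_nth (shift_fps b * F) n"
    and "m \<le> k"
  shows "fps_nth F m = newton_coeff b m"
  using \<open>m \<le> k\<close>
proof (induction m rule: less_induct)
  case (less m)
  show ?case
  proof (cases m)
    case 0
    then show ?thesis using assms(1) by simp
  next
    case (Suc n)
    have "of_nat (Suc n) * fps_nth F (Suc n) = - (\<Sum>i\<le>n. b (Suc i) * fps_nth F (n - i))"
      using assms(2)[of n] less.prems Suc
      by (simp add: fps_mult_nth shift_fps_def atLeast0AtMost)
    also have "(\<Sum>i\<le>n. b (Suc i) * fps_nth F (n - i)) =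
        (\<Sum>i\<le>n. b (Suc i) * newton_coeff b (n - i))"
      using less Suc by (intro sum.cong refl) auto
    finally show ?thesis
      using Suc by (simp add: field_simps del: of_nat_Suc)
  qed
qed

lemma fps_eq_newton_coeff:
  fixes F :: "complex fps"
  assumes "fps_nth F 0 = 1" "fps_deriv F = - shift_fps b * F"
  shows "fps_nth F m = newton_coeff b m"
  by (rule newton_coeff_unique[of F m]) (use assms in auto)

text \<open>The recursion is triangular: \<open>b (Suc n)\<close> enters coefficient
  \<open>Suc n\<close> with factor \<open>newton_coeff b 0\<close> = 1, next to earlier values only.
  This carries equality of coefficients back to equality of power sums.\<close>

lemma newton_coeff_inverse:
  assumes "\<And>m. m \<le> k \<Longrightarrow> newton_coeff b m = newton_coeff b' m" "1 \<le> i" "i \<le> k"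
  shows "b i = b' i"
  using assms(2,3)
proof (induction i rule: less_induct)
  case (less i)
  then obtain n where i: "i = Suc n" by (cases i) auto
  have eq: "(\<Sum>j\<le>n. b (Suc j) * newton_coeff b (n - j)) = (\<Sum>j\<le>n. b' (Suc j) * newton_coeff b' (n - j))"
    using assms(1)[of i] less.prems i by (simp add: divide_cancel_right del: of_nat_Suc)
  have "(\<Sum>j<n. b (Suc j) * newton_coeff b (n - j)) = (\<Sum>j<n. b' (Suc j) * newton_coeff b' (n - j))"
    using less i assms(1) by (intro sum.cong refl) auto
  with eq show ?case
    using i by (simp flip: lessThan_Suc_atMost)
qed

section \<open>Finite products of linear factors and uniqueness of the Newton polynomials\<close>

definition root_prod :: "nat \<Rightarrow> (nat \<Rightarrow> complex) \<Rightarrow> complex fps" where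
  "root_prod N z = (\<Prod>j=1..N. 1 - fps_const (z j) * fps_X)"

lemma prod_fps_const: "(\<Prod>j\<in>B. fps_const (f j)) = fps_const (\<Prod>j\<in>B. f j :: complex)"
  by (induction B rule: infinite_finite_induct) auto

text \<open>Expand the product over subsets: a subset of size k contributes to X^k with sign
  (-1)^k.\<close>

lemma root_prod_nth: "fps_nth (root_prod N z) k = (-1) ^ k * elem_sym k N z"
proof -
  have "root_prod N z = (\<Prod>j=1..N. fps_const (- z j) * fps_X + 1)"
    unfolding root_prod_def by (intro prod.cong refl) (simp flip: fps_const_neg)
  also have "\<dots> = (\<Sum>B\<in>Pow {1..N}. (\<Prod>j\<in>B. fps_const (- z j) * fps_X) * (\<Prod>j\<in>{1..N} - B. 1))"
    by (rule prod_add) simp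
  also have "\<dots> = (\<Sum>B\<in>Pow {1..N}. fps_const (\<Prod>j\<in>B. - z j) * fps_X ^ card B)"
    by (intro sum.cong refl) (simp add: prod.distrib prod_fps_const)
  finally have "fps_nth (root_prod N z) k =
      (\<Sum>B\<in>Pow {1..N}. if k = card B then (\<Prod>j\<in>B. - z j) else 0)"
    by (simp add: fps_sum_nth if_distrib cong: if_cong)
  also have "\<dots> = (\<Sum>B | B \<subseteq> {1..N} \<and> card B = k. (\<Prod>j\<in>B. - z j))"
    by (subst sum.inter_filter[symmetric]) (auto intro!: sum.cong)
  also have "\<dots> = (\<Sum>B | B \<subseteq> {1..N} \<and> card B = k. (-1) ^ k * (\<Prod>j\<in>B. z j))"
  proof (rule sum.cong[OF refl])
    fix B assume "B \<in> {B. B \<subseteq> {1..N} \<and> card B = k}"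
    then show "(\<Prod>j\<in>B. - z j) = (-1) ^ k * (\<Prod>j\<in>B. z j)"
      using prod.distrib[of "\<lambda>_. -1" z B] by simp
  qed
  finally show ?thesis
    by (simp add: elem_sym_def sum_distrib_left)
qed

text \<open>This is the geometric series for -a / (1 - a X), with the denominator cleared.\<close>

lemma fps_deriv_linear_factor:
  "fps_deriv (1 - fps_const a * fps_X) = - shift_fps (\<lambda>i. a ^ i) * (1 - fps_const (a::complex) * fps_X)"
proof (rule fps_ext)
  fix n
  show "fps_nth (fps_deriv (1 - fps_const a * fps_X)) n =
      fps_nth (- shift_fps (\<lambda>i. a ^ i) * (1 - fps_const a * fps_X)) n"
    by (cases n) (auto simp: shift_fps_def algebra_simps)
qed

lemma shift_fps_add: "shift_fps (\<lambda>i. b i + b' i) = shift_fps b + shift_fps b'"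
  by (rule fps_ext) (simp add: shift_fps_def)

lemma fps_deriv_root_prod: "fps_deriv (root_prod N z) = - shift_fps (power_sum N z) * root_prod N z"
proof (induction N)
  case 0
  have "shift_fps (power_sum 0 z) = 0"
    by (rule fps_ext) (simp add: shift_fps_def power_sum_def)
  then show ?case by (simp add: root_prod_def)
next
  case (Suc N)
  have *: "power_sum (Suc N) z = (\<lambda>i. power_sum N z i + z (Suc N) ^ i)"
    by (rule ext) (simp add: power_sum_def)
  have "root_prod (Suc N) z = root_prod N z * (1 - fps_const (z (Suc N)) * fps_X)"
    by (simp add: root_prod_def)
  then show ?case
    by (simp only: fps_deriv_mult Suc fps_deriv_linear_factor * shift_fps_add) (simp add: algebra_simps)
qed

lemma newton_coeff_power_sum: "newton_coeff (power_sum N z) k = (-1) ^ k * elem_sym k N z"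
proof -
  have "fps_nth (root_prod N z) 0 = 1"
    by (induction N) (auto simp: root_prod_def)
  then show ?thesis
    using fps_eq_newton_coeff[OF _ fps_deriv_root_prod] root_prod_nth by metis
qed

lemma newton_coeff_in_poly_funs: "m \<le> k \<Longrightarrow> (\<lambda>b. newton_coeff b m) \<in> poly_funs k"
proof (induction m rule: less_induct)
  case (less m)
  show ?case
  proof (cases m)
    case 0
    then show ?thesis by (simp add: poly_funs.const)
  next
    case (Suc n)
    have sum: "(\<lambda>b. \<Sum>i\<in>I. f i b) \<in> poly_funs k"
      if "finite I" "\<And>i. i \<in> I \<Longrightarrow> f i \<in> poly_funs k" for I :: "nat set" and f
      using that by (induction I rule: finite_induct) (auto intro: poly_funs.const poly_funs.add)
    have "(\<lambda>b. \<Sum>i\<le>n. b (Suc i) * newton_coeff b (n - i)) \<in> poly_funs k"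
      using less Suc by (intro sum poly_funs.mult poly_funs.coord) auto
    from poly_funs.mult[OF poly_funs.const[of "- 1 / of_nat (Suc n)"] this]
    show ?thesis using Suc by (simp del: of_nat_Suc)
  qed
qed

lemma poly_funs_cong:
  assumes "P \<in> poly_funs k" "\<And>i. 1 \<le> i \<Longrightarrow> i \<le> k \<Longrightarrow> b i = b' i"
  shows "P b = P b'"
  using assms by (induction P rule: poly_funs.induct) auto

text \<open>A complex polynomial with constant term 1 and prescribed further coefficients splits
  into factors 1 - z_j X, the z_j being the roots of its reversal. Prescribing the Newton
  coefficients of b then prescribes the power sums.\<close>

lemma power_sums_surj:
  obtains z where "\<And>i. 1 \<le> i \<Longrightarrow> i \<le> k \<Longrightarrow> power_sum k z i = b i"
proof -
  define p where "p = Poly (map (newton_coeff b) [0..<Suc k])"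
  have coeff_p: "coeff p m = (if m \<le> k then newton_coeff b m else 0)" for m
    unfolding p_def coeff_Poly_eq nth_default_def by (simp del: upt_Suc)
  have p0: "coeff p 0 \<noteq> 0" by (simp add: coeff_p)
  \<comment> \<open>p may have degree below k; the monomial pads its reversal to degree k, with the
    missing z_j equal to 0.\<close>
  define q where "q = monom 1 (k - degree p) * reflect_poly p"
  have "degree p \<le> k"
    by (rule degree_le) (simp add: coeff_p)
  have q: "reflect_poly q = p"
    using p0 by (simp add: q_def reflect_poly_mult monom_altdef reflect_poly_power reflect_poly_pCons' pCons_one)
  have lq: "lead_coeff q = 1"
    using p0 coeff_p[of 0]
    by (simp add: q_def lead_coeff_mult coeff_reflect_poly degree_monom_eq)
  have dq: "degree q = k"
    using \<open>degree p \<le> k\<close> p0 degree_mult_eq[of "monom 1 (k - degree p)" "reflect_poly p"]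
      degree_monom_eq[of "1::complex" "k - degree p"]
    by (cases "p = 0") (auto simp: q_def)
  obtain root where "smult (lead_coeff q) (\<Prod>i<degree q. [:- root i, 1:]) = q"
    using complex_poly_decompose' by blast
  then have q_prod: "q = (\<Prod>i<k. [:- root i, 1:])"
    using dq lq by simp
  define z where "z j = root (j - 1)" for j
  have "p = (\<Prod>i<k. reflect_poly [:- root i, 1:])"
    using q q_prod reflect_poly_prod by metis
  also have "\<dots> = (\<Prod>i<k. [:1, - root i:])"
    by (intro prod.cong refl) (auto simp: reflect_poly_def)
  also have "\<dots> = (\<Prod>j=1..k. [:1, - z j:])"
    by (rule prod.reindex_bij_witness[of _ "\<lambda>j. j - 1" Suc]) (auto simp: z_def)
  finally have "fps_of_poly p = root_prod k z"
    by (simp add: root_prod_def fps_of_poly_prod fps_of_poly_pCons mult.commute flip: fps_const_neg)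
  then have "newton_coeff (power_sum k z) m = newton_coeff b m" if "m \<le> k" for m
    using that coeff_p[of m] newton_coeff_power_sum[of k z m] root_prod_nth[of k z m] by (metis fps_of_poly_nth)
  then show ?thesis
    using that newton_coeff_inverse by blast
qed

theorem newton_poly_eq: "newton_poly k = (\<lambda>b. (-1) ^ k * newton_coeff b k)"
  unfolding newton_poly_def
proof (rule the_equality)
  have "(\<lambda>b. (-1) ^ k * newton_coeff b k) \<in> poly_funs k"
    by (intro poly_funs.mult[OF poly_funs.const] newton_coeff_in_poly_funs order_refl)
  then show "(\<lambda>b. (-1) ^ k * newton_coeff b k) \<in> poly_funs k \<and>
      (\<forall>N z. elem_sym k N z = (-1) ^ k * newton_coeff (power_sum N z) k)"
    by (simp add: newton_coeff_power_sum)
next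
  fix P assume P: "P \<in> poly_funs k \<and> (\<forall>N z. elem_sym k N z = P (power_sum N z))"
  show "P = (\<lambda>b. (-1) ^ k * newton_coeff b k)"
  proof
    fix b
    obtain z where z: "\<And>i. 1 \<le> i \<Longrightarrow> i \<le> k \<Longrightarrow> power_sum k z i = b i"
      using power_sums_surj by blast
    have "P b = elem_sym k k z"
      using P poly_funs_cong[of P k "power_sum k z" b, OF _ z] by simp
    also have "\<dots> = (-1) ^ k * newton_coeff (power_sum k z) k"
      by (simp add: newton_coeff_power_sum)
    also have "newton_coeff (power_sum k z) k = newton_coeff b k"
      by (rule poly_funs_cong[OF newton_coeff_in_poly_funs[OF order_refl] z])
    finally show "P b = (-1) ^ k * newton_coeff b k" .
  qed
qed

section \<open>Logarithmic derivatives and the Jensen formula for power sums\<close>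

definition log_deriv :: "complex fps \<Rightarrow> complex fps" where
  "log_deriv F = fps_deriv F * inverse F"

lemma log_deriv_unique:
  assumes "fps_nth F 0 \<noteq> 0" "fps_deriv F = G * F"
  shows "log_deriv F = G"
  using assms inverse_mult_eq_1[of F] by (simp add: log_deriv_def mult.assoc mult.commute[of F])

lemma fps_deriv_eq_log_deriv: "fps_nth F 0 \<noteq> 0 \<Longrightarrow> fps_deriv F = log_deriv F * F"
  using inverse_mult_eq_1[of F] by (simp add: log_deriv_def mult.assoc)

lemma log_deriv_mult:
  assumes "fps_nth F 0 \<noteq> 0" "fps_nth G 0 \<noteq> 0"
  shows "log_deriv (F * G) = log_deriv F + log_deriv G"
  by (rule log_deriv_unique)
    (use assms in \<open>simp_all add: fps_deriv_eq_log_deriv algebra_simps\<close>)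

lemma log_deriv_prod:
  assumes "finite A" "\<And>a. a \<in> A \<Longrightarrow> fps_nth (F a) 0 \<noteq> 0"
  shows "fps_nth (\<Prod>a\<in>A. F a) 0 \<noteq> 0 \<and> log_deriv (\<Prod>a\<in>A. F a) = (\<Sum>a\<in>A. log_deriv (F a))"
  using assms
proof (induction A rule: finite_induct)
  case empty
  have "log_deriv 1 = 0" by (rule log_deriv_unique) auto
  then show ?case by simp
qed (auto simp: log_deriv_mult)

lemma log_deriv_linear_factor:
  assumes "c \<noteq> 0"
  shows "log_deriv (fps_const c * (1 - fps_const a * fps_X)) = - shift_fps (\<lambda>i. a ^ i)"
proof (rule log_deriv_unique)
  show "fps_deriv (fps_const c * (1 - fps_const a * fps_X)) =
      - shift_fps (\<lambda>i. a ^ i) * (fps_const c * (1 - fps_const a * fps_X))"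
    by (simp only: fps_deriv_mult fps_deriv_const fps_deriv_linear_factor) simp
qed (use assms in simp)

lemma log_deriv_X_minus:
  assumes "a \<noteq> 0"
  shows "log_deriv (fps_X - fps_const a) = - shift_fps (\<lambda>i. (1 / a) ^ i)"
proof -
  have eq: "fps_X - fps_const a = fps_const (- a) * (1 - fps_const (1 / a) * fps_X)"
    using assms by (intro fps_ext) (simp add: fps_X_def)
  show ?thesis unfolding eq by (rule log_deriv_linear_factor) (use assms in simp)
qed

text \<open>For \<open>F = c * (\<Prod>j. 1 - z\<^sub>j X)\<close> this is the power sum \<open>\<Sum>j. z\<^sub>j ^ k\<close>.\<close>

definition psum :: "complex fps \<Rightarrow> nat \<Rightarrow> complex" where
  "psum F k = - fps_nth (log_deriv F) (k - 1)"

lemma shift_fps_psum: "shift_fps (psum F) = - log_deriv F"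
  by (rule fps_ext) (simp add: shift_fps_def psum_def)

text \<open>F / F(0) solves the differential equation behind \<open>newton_coeff\<close>. Applied to
  f, this is the source of the formula for a_k.\<close>

lemma newton_coeff_psum:
  assumes "fps_nth F 0 \<noteq> 0"
  shows "newton_coeff (psum F) k = fps_nth F k / fps_nth F 0"
proof -
  define G where "G = fps_const (1 / fps_nth F 0) * F"
  have "fps_deriv G = - shift_fps (psum F) * G"
    by (simp add: G_def shift_fps_psum fps_deriv_eq_log_deriv[OF assms] mult_ac)
  then have "fps_nth G k = newton_coeff (psum F) k"
    by (intro fps_eq_newton_coeff) (use assms in \<open>simp_all add: G_def\<close>)
  then show ?thesis by (simp add: G_def)
qed

text \<open>The normalised coefficients are the Newton coefficients of \<open>psum\<close>, and the
  recursion can be inverted up to order k. Hence the power sums of the truncations f_n no longer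
  change from n = k on.\<close>

lemma psum_cong:
  assumes "fps_nth F 0 \<noteq> 0" "\<And>i. i \<le> k \<Longrightarrow> fps_nth F i = fps_nth G i" "1 \<le> k"
  shows "psum F k = psum G k"
proof (rule newton_coeff_inverse)
  fix m assume "m \<le> k"
  then show "newton_coeff (psum F) m = newton_coeff (psum G) m"
    using assms by (simp add: newton_coeff_psum)
qed (use assms in auto)

section \<open>Jensen's formula of order k on a circle\<close>

lemma factor_zeros:
  assumes "finite S" "f holomorphic_on UNIV" "\<And>a. a \<in> S \<Longrightarrow> f a = 0"
  shows "\<exists>h. h holomorphic_on UNIV \<and> (\<forall>z. f z = (\<Prod>a\<in>S. z - a) * h z)"
  using assms
proof (induction S arbitrary: f rule: finite_induct)
  case empty
  then show ?case by auto
next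
  case (insert a S)
  define f' where "f' = (\<lambda>z. if z = a then deriv f a else (f z - f a) / (z - a))"
  have "f' holomorphic_on UNIV"
    unfolding f'_def by (rule pole_lemma_open) (use insert in auto)
  moreover have f: "f z = (z - a) * f' z" for z
    using insert.prems(2)[of a] by (simp add: f'_def)
  have "f' b = 0" if "b \<in> S" for b
    using insert.prems(2)[of b] f[of b] insert.hyps(2) that by auto
  ultimately obtain h where "h holomorphic_on UNIV" "\<And>z. f' z = (\<Prod>a\<in>S. z - a) * h z"
    using insert.IH[of f'] by auto
  then show ?case
    using f insert.hyps by (intro exI[of _ h]) (simp add: mult.assoc)
qed

text \<open>Write Re H = (H + cnj H) / 2. Cauchy's formula turns the first half into the Taylor
  coefficient. On the circle cnj c = R^2 / c, so the other half is, up to R^(2k), the conjugate of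
  the mean of H c^k, which vanishes by Cauchy's theorem.\<close>

lemma circle_coeff_integral:
  assumes "H holomorphic_on ball 0 R'" "0 < R" "R < R'" "1 \<le> k"
  shows "((\<lambda>t. of_real (Re (H (circlepath 0 R t))) / circlepath 0 R t ^ k)
            has_integral ((deriv ^^ k) H 0 / fact k) / 2) {0..1}"
proof -
  define c where "c = circlepath 0 R"
  have ct: "c t = R * exp (2 * of_real pi * \<i> * t)" for t
    by (simp add: c_def circlepath)
  have norm_c: "cmod (c t) = R" for t
    using \<open>0 < R\<close> by (simp add: ct norm_mult)
  have c0: "c t \<noteq> 0" for t using norm_c[of t] \<open>0 < R\<close> by auto
  have cball: "cball 0 R \<subseteq> ball (0::complex) R'" using assms by auto
  have hol: "H holomorphic_on cball 0 R" using assms(1) cball holomorphic_on_subset by blast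
  have "((\<lambda>u. H u / (u - 0) ^ Suc k) has_contour_integral
          ((2 * pi * \<i>) / fact k * (deriv ^^ k) H 0)) (circlepath 0 R)"
    by (rule Cauchy_has_contour_integral_higher_derivative_circlepath)
      (use hol \<open>0 < R\<close> in \<open>auto intro: holomorphic_on_imp_continuous_on holomorphic_on_subset\<close>)
  then have "((\<lambda>t. H (c t) / c t ^ Suc k * vector_derivative (circlepath 0 R) (at t within {0..1}))
      has_integral ((2 * pi * \<i>) / fact k * (deriv ^^ k) H 0)) {0..1}"
    by (simp add: has_contour_integral_def c_def)
  then have "((\<lambda>t. H (c t) / c t ^ k * (2 * pi * \<i>))
      has_integral ((2 * pi * \<i>) / fact k * (deriv ^^ k) H 0)) {0..1}"
  proof (rule has_integral_eq[rotated])
    fix t :: real assume "t \<in> {0..1}"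
    then have "vector_derivative (circlepath 0 R) (at t within {0..1}) = 2 * pi * \<i> * c t"
      by (simp add: vector_derivative_circlepath01 ct)
    then show "H (c t) / c t ^ Suc k * vector_derivative (circlepath 0 R) (at t within {0..1}) =
        H (c t) / c t ^ k * (2 * pi * \<i>)"
      using c0[of t] by simp
  qed
  from has_integral_divide[OF this, of "2 * pi * \<i>"]
  have 1: "((\<lambda>t. H (c t) / c t ^ k) has_integral ((deriv ^^ k) H 0 / fact k)) {0..1}"
    by (simp add: field_simps)
  have "((\<lambda>u. H u * u ^ (k - 1)) has_contour_integral 0) (circlepath 0 R)"
    by (rule Cauchy_theorem_disc_simple[of _ 0 R'])
      (use assms in \<open>auto intro!: holomorphic_intros\<close>)
  then have "((\<lambda>t. H (c t) * c t ^ (k - 1) * vector_derivative (circlepath 0 R) (at t within {0..1}))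
      has_integral 0) {0..1}"
    by (simp add: has_contour_integral_def c_def)
  then have "((\<lambda>t. H (c t) * c t ^ k * (2 * pi * \<i>)) has_integral 0) {0..1}"
  proof (rule has_integral_eq[rotated])
    fix t :: real assume "t \<in> {0..1}"
    then have "vector_derivative (circlepath 0 R) (at t within {0..1}) = 2 * pi * \<i> * c t"
      by (simp add: vector_derivative_circlepath01 ct)
    moreover have "c t ^ k = c t ^ (k - 1) * c t"
      using \<open>1 \<le> k\<close> by (cases k) auto
    ultimately show "H (c t) * c t ^ (k - 1) * vector_derivative (circlepath 0 R) (at t within {0..1}) =
        H (c t) * c t ^ k * (2 * pi * \<i>)"
      by simp
  qed
  from has_integral_divide[OF this, of "2 * pi * \<i>"]
  have "((\<lambda>t. H (c t) * c t ^ k) has_integral 0) {0..1}" by simp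
  then have "((\<lambda>t. cnj (H (c t) * c t ^ k)) has_integral cnj 0) {0..1}"
    using has_integral_cnj[of "\<lambda>t. H (c t) * c t ^ k" 0 "{0..1}"] by (simp add: comp_def)
  from has_integral_divide[OF this, of "of_real (R ^ (2 * k))"]
  have "((\<lambda>t. cnj (H (c t) * c t ^ k) / of_real (R ^ (2 * k))) has_integral 0) {0..1}" by simp
  moreover have "cnj (H (c t) * c t ^ k) / of_real (R ^ (2 * k)) = cnj (H (c t)) / c t ^ k" for t
  proof -
    have "of_real (R ^ (2 * k)) = (cnj (c t) * c t) ^ k"
      using complex_norm_square[of "c t"] norm_c[of t] unfolding power_mult of_real_power
      by (metis mult.commute)
    then show ?thesis using c0[of t] by (simp add: power_mult_distrib)
  qed
  ultimately have "((\<lambda>t. cnj (H (c t)) / c t ^ k) has_integral 0) {0..1}" by simp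
  from has_integral_divide[OF has_integral_add[OF 1 this], of 2]
  have "((\<lambda>t. (H (c t) / c t ^ k + cnj (H (c t)) / c t ^ k) / 2)
      has_integral ((deriv ^^ k) H 0 / fact k) / 2) {0..1}" by simp
  moreover have "(H (c t) / c t ^ k + cnj (H (c t)) / c t ^ k) / 2 = of_real (Re (H (c t))) / c t ^ k" for t
    by (simp add: complex_add_cnj flip: add_divide_distrib)
  ultimately show ?thesis by (simp add: c_def)
qed

text \<open>Replacing each zero \<open>a\<close> in the disc by its reflection \<open>R\<^sup>2 / cnj a\<close> keeps \<open>cmod f\<close> on the
  circle and gives a function with a holomorphic logarithm on a neighbourhood of the disc.\<close>

lemma jensen_power_sum:
  assumes holf: "f holomorphic_on UNIV" and F: "f has_fps_expansion F"
    and f0: "f 0 \<noteq> 0" and "0 < R" "1 \<le> k"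
    and simple: "\<And>z. f z = 0 \<Longrightarrow> deriv f z \<noteq> 0"
    and circle: "\<And>z. cmod z = R \<Longrightarrow> f z \<noteq> 0"
  shows "finite {z. f z = 0 \<and> cmod z < R}"
    and "((\<lambda>t. of_real (ln (cmod (f (circlepath 0 R t)))) / circlepath 0 R t ^ k) has_integral
      ((\<Sum>z | f z = 0 \<and> cmod z < R. 1 / z ^ k - cnj z ^ k / R ^ (2 * k)) - psum F k) / (2 * of_nat k)) {0..1}" (is "(?F has_integral ?J) _")
proof -
  let ?r = "\<lambda>a. cnj a / of_real (R\<^sup>2) :: complex"
  define S where "S = {z. f z = 0 \<and> cmod z < R}"
  show fin: "finite {z. f z = 0 \<and> cmod z < R}"
  proof (cases "f constant_on UNIV")
    case True
    then have "{z. f z = 0 \<and> cmod z < R} = {}"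
      using f0 by (auto simp: constant_on_def)
    then show ?thesis by (simp only: finite.emptyI)
  next
    case False
    have "finite {z \<in> cball 0 R. f z = 0}"
      by (rule holomorphic_compact_finite_zeros[OF holf]) (use False in auto)
    then show ?thesis by (rule finite_subset[rotated]) auto
  qed
  then have finS: "finite S" by (simp add: S_def)
  have S0: "a \<noteq> 0" if "a \<in> S" for a using that f0 by (auto simp: S_def)
  obtain h where holh: "h holomorphic_on UNIV" and h: "\<And>z. f z = (\<Prod>a\<in>S. z - a) * h z"
    using factor_zeros[OF finS holf] by (auto simp: S_def)
  \<comment> \<open>Simplicity of the zeros enters here: a zero of h in the closed disc would be a
    multiple zero of f.\<close>
  have h_nz: "h z \<noteq> 0" if "cmod z \<le> R" for z
  proof
    assume hz: "h z = 0"
    then have fz: "f z = 0" using h by simp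
    with circle that have zS: "z \<in> S" by (force simp: S_def)
    define p where "p w = (\<Prod>a\<in>S - {z}. w - a) * h w" for w
    have f_eq: "f w = (w - z) * p w" for w
      using h[of w] zS finS by (simp add: p_def prod.remove[of S z] mult.assoc)
    have "p holomorphic_on UNIV"
      unfolding p_def by (intro holomorphic_on_mult holomorphic_on_prod holh holomorphic_intros)
    then have "(p has_field_derivative deriv p z) (at z)"
      by (rule holomorphic_derivI) auto
    moreover have "((\<lambda>w. w - z) has_field_derivative 1) (at z)"
      by (auto intro!: derivative_eq_intros)
    ultimately have "((\<lambda>w. (w - z) * p w) has_field_derivative (1 * p z + deriv p z * (z - z))) (at z)"
      by (intro DERIV_mult)
    moreover have "f = (\<lambda>w. (w - z) * p w)" by (rule ext) (rule f_eq)
    ultimately have "deriv f z = p z" by (simp add: DERIV_imp_deriv)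
    moreover have "p z = 0" by (simp add: p_def hz)
    ultimately show False using simple fz by simp
  qed
  \<comment> \<open>\<open>q a\<close> vanishes at the reflected zero R^2 / cnj a, outside the
    closed disc; the factor R makes |q a z| = |z - a| on the circle.\<close>
  define q where "q a z = of_real R * (1 - cnj a / of_real (R\<^sup>2) * z)" for a z :: complex
  define g where "g z = h z * (\<Prod>a\<in>S. q a z)" for z
  have holg: "g holomorphic_on UNIV"
    unfolding g_def q_def by (intro holomorphic_intros holh)
  have q_nz: "q a z \<noteq> 0" if "a \<in> S" "cmod z \<le> R" for a z
  proof
    assume "q a z = 0"
    then have "cnj a * z = of_real (R\<^sup>2)"
      using \<open>0 < R\<close> by (simp add: q_def field_simps)
    then have "cmod (cnj a * z) = R\<^sup>2" by (simp add: norm_power)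
    moreover have "cmod (cnj a * z) < R\<^sup>2"
    proof -
      have "cmod a * cmod z \<le> cmod a * R" using that by (simp add: mult_left_mono)
      also have "\<dots> < R * R" using that \<open>0 < R\<close> by (simp add: S_def)
      finally show ?thesis by (simp add: norm_mult power2_eq_square)
    qed
    ultimately show False by simp
  qed
  have g_nz: "g z \<noteq> 0" if "cmod z \<le> R" for z
    using that h_nz q_nz finS by (auto simp: g_def)
  \<comment> \<open>A logarithm is needed on an open disc containing the circle. Compactness
    provides a margin \<open>\<epsilon>\<close>, and points beyond radius R are compared with their
    radial projection w.\<close>
  have "open {z. g z \<noteq> 0}"
    using holg by (intro open_Collect_neq holomorphic_on_imp_continuous_on) auto
  moreover have "cball 0 R \<subseteq> {z. g z \<noteq> 0}" using g_nz by auto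
  ultimately obtain \<epsilon> where \<epsilon>: "\<epsilon> > 0" "(\<Union>x\<in>cball 0 R. cball x \<epsilon>) \<subseteq> {z. g z \<noteq> 0}"
    using compact_subset_open_imp_cball_epsilon_subset[OF compact_cball] by metis
  have g_nz': "g z \<noteq> 0" if "z \<in> ball 0 (R + \<epsilon>)" for z
  proof (cases "cmod z \<le> R")
    case False
    define w where "w = of_real (R / cmod z) * z"
    have z0: "cmod z > 0" using False \<open>0 < R\<close> by linarith
    have "cmod w = R" using z0 \<open>0 < R\<close> by (simp add: w_def norm_mult norm_divide)
    have "w - z = of_real (R / cmod z - 1) * z" by (simp add: w_def algebra_simps)
    then have "dist w z = \<bar>R / cmod z - 1\<bar> * cmod z"
      unfolding dist_norm by (simp only: norm_mult norm_of_real)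
    moreover have "\<bar>R / cmod z - 1\<bar> = 1 - R / cmod z" using False z0 by simp
    ultimately have "dist w z = cmod z - R"
      using z0 by (simp add: left_diff_distrib)
    with \<open>cmod w = R\<close> have "w \<in> cball 0 R" "z \<in> cball w \<epsilon>" using that by auto
    then show ?thesis using \<epsilon>(2) by blast
  qed (use g_nz in auto)
  obtain H where holH: "H holomorphic_on ball 0 (R + \<epsilon>)"
    and H: "\<And>z. z \<in> ball 0 (R + \<epsilon>) \<Longrightarrow> exp (H z) = g z"
    using holomorphic_logarithm_exists[of "ball 0 (R + \<epsilon>)" g 0] g_nz' holg \<epsilon>(1) \<open>0 < R\<close>
    by (auto intro: holomorphic_on_subset)
  have Re_H: "Re (H z) = ln (cmod (f z))" if z: "cmod z = R" for z
  proof -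
    have "cmod (q a z) = cmod (z - a)" if "a \<in> S" for a
    proof -
      \<comment> \<open>On the circle R^2 is the product of z and cnj z.\<close>
      have "q a z = z * cnj (z - a) / R"
        using \<open>0 < R\<close> complex_norm_square[of z] z
        by (simp add: q_def field_simps power2_eq_square)
      then show ?thesis using z \<open>0 < R\<close> by (simp add: norm_mult norm_divide del: complex_cnj_diff)
    qed
    then have "cmod (g z) = cmod (f z)"
      by (simp add: g_def h norm_mult prod_norm[symmetric] mult.commute)
    moreover have "cmod (g z) = exp (Re (H z))"
      using H[of z] z \<epsilon>(1) by (simp flip: norm_exp_eq_Re)
    ultimately show ?thesis using ln_exp[of "Re (H z)"] by simp
  qed
  have norm_c: "cmod (circlepath 0 R t) = R" for t
    using \<open>0 < R\<close> by (simp add: circlepath norm_mult)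
  from circle_coeff_integral[OF holH \<open>0 < R\<close> _ \<open>1 \<le> k\<close>] \<epsilon>(1)
  have int: "(?F
      has_integral ((deriv ^^ k) H 0 / fact k) / 2) {0..1}"
    by (simp add: Re_H[OF norm_c])

  \<comment> \<open>f and g share the factor h, so their logarithmic derivatives at 0 differ only by
    those of linear factors. As g = exp H, that of g is H', whose coefficient k - 1 is k times the
    Taylor coefficient in the integral.\<close>
  define Hf where "Hf = fps_expansion h 0"
  define HH where "HH = fps_expansion H 0"
  define G where "G = fps_expansion g 0"
  have Hf: "h has_fps_expansion Hf" unfolding Hf_def using holh by blast
  have HH: "H has_fps_expansion HH"
    unfolding HH_def using holH \<epsilon>(1) \<open>0 < R\<close> by (intro has_fps_expansion_fps_expansion) auto
  have G: "g has_fps_expansion G" unfolding G_def using holg by blast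
  have "f has_fps_expansion (\<Prod>a\<in>S. fps_X - fps_const a) * Hf"
    unfolding h by (intro fps_expansion_intros Hf)
  then have F_eq: "F = (\<Prod>a\<in>S. fps_X - fps_const a) * Hf"
    using F fps_expansion_unique_complex by blast
  have "(\<lambda>z. h z * (\<Prod>a\<in>S. q a z)) has_fps_expansion
      Hf * (\<Prod>a\<in>S. fps_const (of_real R) * (1 - fps_const (?r a) * fps_X))"
    unfolding q_def by (intro fps_expansion_intros Hf)
  then have G_eq: "G = Hf * (\<Prod>a\<in>S. fps_const (of_real R) * (1 - fps_const (?r a) * fps_X))"
    using G fps_expansion_unique_complex unfolding g_def by blast
  have Hf0: "fps_nth Hf 0 \<noteq> 0"
    using fps_nth_fps_expansion[OF Hf, of 0] h_nz[of 0] \<open>0 < R\<close> by simp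
  have G0: "fps_nth G 0 \<noteq> 0"
    using fps_nth_fps_expansion[OF G, of 0] g_nz[of 0] \<open>0 < R\<close> by simp
  have "deriv g has_fps_expansion fps_deriv G"
    by (intro fps_expansion_intros G)
  moreover have "(\<lambda>z. deriv H z * g z) has_fps_expansion fps_deriv HH * G"
    by (intro fps_expansion_intros G HH)
  moreover have ev: "eventually (\<lambda>z. deriv g z = deriv H z * g z) (nhds 0)"
  proof -
    have "deriv g z = deriv H z * g z" if z: "z \<in> ball 0 (R + \<epsilon>)" for z
    proof -
      have "H field_differentiable at z"
        using holH z open_ball holomorphic_on_imp_differentiable_at by blast
      then have "((\<lambda>z. exp (H z)) has_field_derivative exp (H z) * deriv H z) (at z)"
        by (auto intro!: derivative_eq_intros simp: DERIV_deriv_iff_field_differentiable)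
      then have "(g has_field_derivative exp (H z) * deriv H z) (at z)"
        by (rule has_field_derivative_transform_within_open[of _ _ _ "ball 0 (R + \<epsilon>)"]) (use z H in auto)
      then show ?thesis using H[OF z] by (simp add: DERIV_imp_deriv)
    qed
    moreover have "eventually (\<lambda>z. z \<in> ball 0 (R + \<epsilon>)) (nhds 0)"
      using \<epsilon>(1) \<open>0 < R\<close> by (intro eventually_nhds_in_open) auto
    ultimately show ?thesis by (auto elim: eventually_mono)
  qed
  ultimately have "fps_deriv G = fps_deriv HH * G"
    using fps_expansion_unique_complex has_fps_expansion_cong[OF ev refl] by blast
  then have "log_deriv G = fps_deriv HH" by (rule log_deriv_unique[OF G0])
  moreover have "log_deriv G = log_deriv Hf + (\<Sum>a\<in>S. - shift_fps (\<lambda>i. ?r a ^ i))"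
  proof -
    let ?q = "\<lambda>a. fps_const (of_real R) * (1 - fps_const (?r a) * fps_X)"
    have "fps_nth (?q a) 0 \<noteq> 0" for a using \<open>0 < R\<close> by simp
    from log_deriv_prod[OF finS, of ?q, OF this]
    have q: "fps_nth (prod ?q S) 0 \<noteq> 0" "log_deriv (prod ?q S) = (\<Sum>a\<in>S. log_deriv (?q a))"
      by blast+
    have "log_deriv (?q a) = - shift_fps (\<lambda>i. ?r a ^ i)" for a
      by (rule log_deriv_linear_factor) (use \<open>0 < R\<close> in simp)
    with q show ?thesis
      unfolding G_eq log_deriv_mult[OF Hf0 q(1)] by simp
  qed
  moreover have "log_deriv F = (\<Sum>a\<in>S. - shift_fps (\<lambda>i. (1 / a) ^ i)) + log_deriv Hf"
    unfolding F_eq using log_deriv_prod[OF finS, of "\<lambda>a. fps_X - fps_const a"] Hf0 S0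
    by (simp add: log_deriv_mult log_deriv_X_minus)
  ultimately have "fps_deriv HH = log_deriv F + (\<Sum>a\<in>S. shift_fps (\<lambda>i. (1 / a) ^ i))
      - (\<Sum>a\<in>S. shift_fps (\<lambda>i. ?r a ^ i))"
    by (simp add: sum_negf)
  then have "fps_nth (fps_deriv HH) (k - 1) = - psum F k + (\<Sum>a\<in>S. (1 / a) ^ k)
      - (\<Sum>a\<in>S. ?r a ^ k)"
    using \<open>1 \<le> k\<close> by (simp add: psum_def shift_fps_def fps_sum_nth del: power_Suc)
  also have "\<dots> = (\<Sum>a\<in>S. 1 / a ^ k - cnj a ^ k / R ^ (2 * k)) - psum F k"
    by (simp add: sum_subtractf power_divide power_mult)
  finally have "of_nat k * fps_nth HH k = (\<Sum>a\<in>S. 1 / a ^ k - cnj a ^ k / R ^ (2 * k)) - psum F k"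
    using \<open>1 \<le> k\<close> by simp
  then have "((deriv ^^ k) H 0 / fact k) / 2 =
      ((\<Sum>a\<in>S. 1 / a ^ k - cnj a ^ k / R ^ (2 * k)) - psum F k) / (2 * of_nat k)"
    using \<open>1 \<le> k\<close> fps_nth_fps_expansion[OF HH, of k] by (simp add: field_simps)
  with int show "(?F has_integral ?J) {0..1}"
    by (simp only: S_def)
qed

section \<open>Zeros of random power series\<close>

definition coeff_seq :: "(nat \<Rightarrow> complex) \<Rightarrow> nat \<Rightarrow> complex" where
  "coeff_seq x k = x k / complex_of_real (sqrt (fact k))"

definition gfun :: "(nat \<Rightarrow> complex) \<Rightarrow> complex \<Rightarrow> complex" where
  "gfun x z = (\<Sum>k. coeff_seq x k * z ^ k)"

definition entire_seq :: "(nat \<Rightarrow> complex) \<Rightarrow> bool" where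
  "entire_seq x \<longleftrightarrow> (\<forall>z. summable (\<lambda>k. coeff_seq x k * z ^ k))"

definition zeros :: "(nat \<Rightarrow> complex) \<Rightarrow> complex set" where
  "zeros x = (if entire_seq x then {z. gfun x z = 0} else {})"

definition gfps :: "(nat \<Rightarrow> complex) \<Rightarrow> complex fps" where
  "gfps x = Abs_fps (coeff_seq x)"

abbreviation seqs :: "(nat \<Rightarrow> complex) measure" where
  "seqs \<equiv> PiM UNIV (\<lambda>_. borel)"

lemma space_seqs [simp]: "space seqs = UNIV"
  by (simp add: space_PiM)

lemma gaf_eq_gfun: "gaf \<xi> \<omega> = gfun (\<lambda>k. \<xi> k \<omega>)"
  by (rule ext) (simp add: gaf_def gfun_def coeff_seq_def)

lemma zero_process_eq_zeros: "zero_process \<xi> \<omega> = zeros (\<lambda>k. \<xi> k \<omega>)"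
  by (simp add: zero_process_def zeros_def entire_seq_def coeff_seq_def gaf_eq_gfun)

lemma gfun_sums: "entire_seq x \<Longrightarrow> (\<lambda>k. coeff_seq x k * z ^ k) sums gfun x z"
  by (simp add: gfun_def entire_seq_def summable_sums)

lemma gfun_0: "gfun x 0 = x 0"
proof -
  have "(\<lambda>k. coeff_seq x k * 0 ^ k) sums coeff_seq x 0"
    by (rule powser_sums_zero)
  then show ?thesis by (simp add: gfun_def sums_iff coeff_seq_def)
qed

lemma gfun_DERIV:
  assumes "entire_seq x"
  shows "(gfun x has_field_derivative (\<Sum>k. diffs (coeff_seq x) k * z ^ k)) (at z)"
proof -
  have "gfun x = (\<lambda>z. \<Sum>k. coeff_seq x k * z ^ k)" by (rule ext) (simp add: gfun_def)
  then show ?thesis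
    using termdiffs_strong_converges_everywhere[of "coeff_seq x" z] assms by (simp add: entire_seq_def)
qed

lemma gfun_holomorphic: "entire_seq x \<Longrightarrow> gfun x holomorphic_on A"
  using gfun_DERIV[of x] holomorphic_on_open[of UNIV "gfun x"] holomorphic_on_subset by blast

lemma gfun_has_fps_expansion: "entire_seq x \<Longrightarrow> gfun x has_fps_expansion gfps x"
  by (rule has_fps_expansionI) (simp add: gfps_def gfun_sums)

lemma gfun_constant_iff:
  assumes "entire_seq x"
  shows "gfun x constant_on UNIV \<longleftrightarrow> (\<forall>k\<ge>1. x k = 0)"
proof
  assume "gfun x constant_on UNIV"
  then obtain c where "gfun x = (\<lambda>_. c)" by (auto simp: constant_on_def)
  then have "gfps x = fps_const c"
    using gfun_has_fps_expansion[OF assms] has_fps_expansion_const fps_expansion_unique_complex by metis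
  then have "coeff_seq x k = (if k = 0 then c else 0)" for k
    unfolding gfps_def fps_eq_iff by simp
  then have "coeff_seq x k = 0" if "k \<ge> 1" for k using that by simp
  then show "\<forall>k\<ge>1. x k = 0" by (simp add: coeff_seq_def)
next
  assume *: "\<forall>k\<ge>1. x k = 0"
  have "gfun x z = gfun x 0" for z
  proof -
    have "(\<lambda>k. coeff_seq x k * z ^ k) = (\<lambda>k. if k \<in> {0} then coeff_seq x k * z ^ k else 0)"
      using * by (auto simp: coeff_seq_def)
    then have "(\<lambda>k. coeff_seq x k * z ^ k) sums coeff_seq x 0"
      using sums_If_finite_set[of "{0}" "\<lambda>k. coeff_seq x k * z ^ k"] by simp
    then show ?thesis unfolding gfun_0 by (simp add: gfun_def sums_iff coeff_seq_def)
  qed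
  then show "gfun x constant_on UNIV" by (auto simp: constant_on_def)
qed

lemma entire_seq_finite_support: "(\<And>k. k > n \<Longrightarrow> x k = 0) \<Longrightarrow> entire_seq x"
  unfolding entire_seq_def
  by (intro allI summable_finite[of "{..n}"]) (auto simp: coeff_seq_def)

section \<open>Measurability of the zero set as a point configuration\<close>

lemma summable_iff_suminf_ennreal:
  assumes "\<And>k. 0 \<le> f k"
  shows "summable f \<longleftrightarrow> (\<Sum>k. ennreal (f k)) \<noteq> top"
  using ennreal_suminf_neq_top summable_suminf_not_top assms by metis

text \<open>Absolute convergence at all natural radii is a countable family of conditions on
  \<open>ennreal\<close> sums, which makes convergence everywhere a measurable event.\<close>

lemma entire_seq_iff:
  "entire_seq x \<longleftrightarrow> (\<forall>m::nat. (\<Sum>k. ennreal (cmod (coeff_seq x k) * real m ^ k)) \<noteq> top)"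
proof -
  have "entire_seq x \<longleftrightarrow> (\<forall>m::nat. summable (\<lambda>k. cmod (coeff_seq x k) * real m ^ k))"
  proof safe
    fix m assume "entire_seq x"
    then have "summable (\<lambda>k. norm (coeff_seq x k * (of_nat m) ^ k))"
      by (intro powser_insidea[of _ "of_nat (Suc m)"]) (auto simp: entire_seq_def simp del: of_nat_Suc)
    then show "summable (\<lambda>k. cmod (coeff_seq x k) * real m ^ k)"
      by (simp add: norm_mult norm_power)
  next
    assume *: "\<forall>m::nat. summable (\<lambda>k. cmod (coeff_seq x k) * real m ^ k)"
    show "entire_seq x"
      unfolding entire_seq_def
    proof
      fix z
      obtain m :: nat where m: "cmod z \<le> real m" using real_arch_simple by blast
      show "summable (\<lambda>k. coeff_seq x k * z ^ k)"
        by (rule summable_comparison_test'[OF *[rule_format, of m], of 0])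
          (simp add: norm_mult norm_power mult_left_mono power_mono m)
    qed
  qed
  also have "\<dots> \<longleftrightarrow> (\<forall>m::nat. (\<Sum>k. ennreal (cmod (coeff_seq x k) * real m ^ k)) \<noteq> top)"
    by (simp only: summable_iff_suminf_ennreal mult_nonneg_nonneg norm_ge_zero zero_le_power of_nat_0_le_iff)
  finally show ?thesis .
qed

lemma measurable_coeff_seq [measurable]: "(\<lambda>x. coeff_seq x k) \<in> borel_measurable seqs"
  unfolding coeff_seq_def by measurable

lemma measurable_entire_seq [measurable]: "Measurable.pred seqs entire_seq"
  unfolding entire_seq_iff by measurable

text \<open>Joint measurability is what Fubini over the probability space and the circle will
  require.\<close>

lemma measurable_gfun_pair [measurable]:
  "(\<lambda>p. gfun (fst p) (snd p)) \<in> borel_measurable (seqs \<Otimes>\<^sub>M borel)"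
proof -
  have "(\<lambda>p. coeff_seq (fst p) k) \<in> borel_measurable (seqs \<Otimes>\<^sub>M borel)" for k
    by (rule measurable_compose[OF measurable_fst measurable_coeff_seq])
  then show ?thesis
    unfolding gfun_def
    by (intro borel_measurable_suminf borel_measurable_times borel_measurable_power measurable_snd)
qed

lemma measurable_gfun [measurable]: "(\<lambda>x. gfun x z) \<in> borel_measurable seqs"
  unfolding gfun_def by measurable

lemma measurable_deriv_series [measurable]:
  "(\<lambda>x. \<Sum>k. diffs (coeff_seq x) k * z ^ k) \<in> borel_measurable seqs"
  unfolding diffs_def by measurable

text \<open>The uncountable search is reduced to a countable dense subset T of K: by compactness the
  modulus attains its minimum, so a zero exists exactly when values below every 1 / (n + 1) occur on
  T.\<close>

lemma measurable_ex_zero: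
  fixes \<phi> :: "'a \<Rightarrow> complex \<Rightarrow> real"
  assumes K: "compact K" and [measurable]: "Measurable.pred A P" "\<And>w. (\<lambda>x. \<phi> x w) \<in> borel_measurable A"
    and cont: "\<And>x. P x \<Longrightarrow> continuous_on K (\<phi> x)"
  shows "Measurable.pred A (\<lambda>x. P x \<and> (\<exists>w\<in>K. \<phi> x w = 0))"
proof -
  obtain T where T: "countable T" "T \<subseteq> K" "K \<subseteq> closure T" using separable by metis
  have "(P x \<and> (\<exists>w\<in>K. \<phi> x w = 0)) \<longleftrightarrow> (P x \<and> (\<forall>n. \<exists>w\<in>T. \<bar>\<phi> x w\<bar> < 1 / real (Suc n)))" for x
  proof (intro conj_cong refl iffI allI)
    fix n assume "P x" "\<exists>w\<in>K. \<phi> x w = 0"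
    then obtain w where w: "w \<in> K" "\<phi> x w = 0" by auto
    from cont[OF \<open>P x\<close>] w obtain d where d: "d > 0"
      "\<And>w'. w' \<in> K \<Longrightarrow> dist w' w < d \<Longrightarrow> dist (\<phi> x w') (\<phi> x w) < 1 / real (Suc n)"
      unfolding continuous_on_iff by (metis of_nat_0_less_iff zero_less_Suc zero_less_divide_1_iff)
    obtain w' where "w' \<in> T" "dist w' w < d"
      using T(3) w(1) d(1) closure_approachable by blast
    then show "\<exists>w\<in>T. \<bar>\<phi> x w\<bar> < 1 / real (Suc n)"
      using d(2)[of w'] w(2) T(2) by (auto simp: dist_real_def intro!: bexI[of _ w'])
  next
    assume "P x" and *: "\<forall>n. \<exists>w\<in>T. \<bar>\<phi> x w\<bar> < 1 / real (Suc n)"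
    have "K \<noteq> {}" using *[rule_format, of 0] T(2) by auto
    moreover have "continuous_on K (\<lambda>w. \<bar>\<phi> x w\<bar>)" by (intro continuous_intros cont \<open>P x\<close>)
    ultimately obtain w where w: "w \<in> K" "\<And>w'. w' \<in> K \<Longrightarrow> \<bar>\<phi> x w\<bar> \<le> \<bar>\<phi> x w'\<bar>"
      using continuous_attains_inf[OF K] by meson
    have "\<bar>\<phi> x w\<bar> \<le> 0"
    proof (rule LIMSEQ_le_const)
      show "(\<lambda>n. 1 / real (Suc n)) \<longlonglongrightarrow> 0" using LIMSEQ_inverse_real_of_nat by (simp add: inverse_eq_divide)
      show "\<exists>N. \<forall>n\<ge>N. \<bar>\<phi> x w\<bar> \<le> 1 / real (Suc n)"
        using * w(2) T(2) by (meson less_imp_le order_trans subsetD)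
    qed
    then show "\<exists>w\<in>K. \<phi> x w = 0" using w(1) by auto
  qed
  moreover have "Measurable.pred A (\<lambda>x. P x \<and> (\<forall>n. \<exists>w\<in>T. \<bar>\<phi> x w\<bar> < 1 / real (Suc n)))"
    using T(1) by measurable
  ultimately show ?thesis by simp
qed

text \<open>For the zero sequence \<open>gfun\<close> vanishes on the whole plane; excluding it
  makes the zero set locally finite.\<close>

definition nondeg_seq :: "(nat \<Rightarrow> complex) \<Rightarrow> bool" where
  "nondeg_seq x \<longleftrightarrow> entire_seq x \<and> (\<exists>k. x k \<noteq> 0)"

lemma measurable_nondeg_seq [measurable]: "Measurable.pred seqs nondeg_seq"
  unfolding nondeg_seq_def by measurable

lemma finite_zeros:
  assumes "nondeg_seq x" "compact K"
  shows "finite (zeros x \<inter> K)"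
proof (cases "gfun x constant_on UNIV")
  case True
  have ent: "entire_seq x" using assms by (simp add: nondeg_seq_def)
  have "x 0 \<noteq> 0"
    using True assms gfun_constant_iff[OF ent] by (metis less_one nondeg_seq_def not_le)
  then have "gfun x z \<noteq> 0" for z
    using True gfun_0[of x] by (auto simp: constant_on_def)
  then have "zeros x = {}" by (auto simp: zeros_def)
  then show ?thesis by simp
next
  case False
  have ent: "entire_seq x" using assms by (simp add: nondeg_seq_def)
  have "finite {z \<in> K. gfun x z = 0}"
    by (rule holomorphic_compact_finite_zeros[OF gfun_holomorphic[OF ent, of UNIV]])
      (use False assms(2) in auto)
  moreover have "zeros x \<inter> K = {z \<in> K. gfun x z = 0}" using ent by (auto simp: zeros_def)
  ultimately show ?thesis by simp
qed

text \<open>Counting by countable data: m distinct points are caught by m small balls with centres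
  in D that are too far apart to share a point; conversely, one point from each such ball gives m
  distinct points.\<close>

lemma le_card_iff_separated_balls:
  fixes Z :: "'a::metric_space set"
  assumes "finite Z" and dense: "\<And>a e. e > 0 \<Longrightarrow> \<exists>q\<in>D. dist q a < e"
  shows "m \<le> card Z \<longleftrightarrow> (\<exists>n. \<exists>Q\<in>{Q. finite Q \<and> Q \<subseteq> D}. card Q = m \<and>
    (\<forall>q\<in>Q. \<forall>q'\<in>Q. q \<noteq> q' \<longrightarrow> dist q q' > 2 / real (Suc n)) \<and>
    (\<forall>q\<in>Q. \<exists>w\<in>cball q (1 / real (Suc n)). w \<in> Z))" (is "_ \<longleftrightarrow> ?sep")
proof
  assume "m \<le> card Z"
  then obtain Z' where Z': "Z' \<subseteq> Z" "card Z' = m" "finite Z'"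
    using obtain_subset_with_card_n assms(1) by metis
  have "\<exists>d>0. \<forall>x\<in>Z'. x \<noteq> a \<longrightarrow> d \<le> dist a x" for a
    using finite_set_avoid[OF Z'(3)] by blast
  then obtain d where d: "\<And>a. d a > 0" "\<And>a x. x \<in> Z' \<Longrightarrow> x \<noteq> a \<Longrightarrow> d a \<le> dist a x"
    by metis
  define \<delta> where "\<delta> = Min (insert 1 (d ` Z'))"
  have \<delta>: "\<delta> > 0" "\<And>a x. a \<in> Z' \<Longrightarrow> x \<in> Z' \<Longrightarrow> x \<noteq> a \<Longrightarrow> \<delta> \<le> dist a x"
  proof -
    show "\<delta> > 0" using Z'(3) d(1) by (simp add: \<delta>_def)
    fix a x assume "a \<in> Z'" "x \<in> Z'" "x \<noteq> a"
    then have "\<delta> \<le> d a" using Z'(3) by (auto simp: \<delta>_def)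
    also have "\<dots> \<le> dist a x" using d(2) \<open>x \<in> Z'\<close> \<open>x \<noteq> a\<close> .
    finally show "\<delta> \<le> dist a x" .
  qed
  \<comment> \<open>The centres are more than \<open>\<delta>\<close> - 2 / (n + 1) apart, so the
    bound \<open>\<delta>\<close> / 4 leaves more than the required 2 / (n + 1).\<close>
  obtain n where n: "1 / real (Suc n) < \<delta> / 4"
    using \<delta>(1) reals_Archimedean[of "\<delta> / 4"] by (auto simp: inverse_eq_divide)
  obtain q where q: "\<And>a. q a \<in> D" "\<And>a. dist (q a) a < 1 / real (Suc n)"
    using dense[of "1 / real (Suc n)"] by (metis of_nat_0_less_iff zero_less_Suc zero_less_divide_1_iff)
  have sep: "dist (q a) (q b) > 2 / real (Suc n)" if "a \<in> Z'" "b \<in> Z'" "a \<noteq> b" for a b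
  proof -
    have "dist a b \<le> dist a (q a) + dist (q a) (q b) + dist (q b) b"
      using dist_triangle[of a b "q a"] dist_triangle[of "q a" b "q b"] by linarith
    then have "\<delta> < 2 * (1 / real (Suc n)) + dist (q a) (q b)"
      using \<delta>(2)[of a b] q(2)[of a] q(2)[of b] that by (simp add: dist_commute)
    then show ?thesis using n by simp
  qed
  have "inj_on q Z'"
  proof (rule inj_onI, rule ccontr)
    fix a b assume "a \<in> Z'" "b \<in> Z'" "q a = q b" "a \<noteq> b"
    then show False using sep[of a b] by (simp add: field_simps)
  qed
  then have "card (q ` Z') = m" using Z'(2) by (simp add: card_image)
  moreover have "\<exists>w\<in>cball (q a) (1 / real (Suc n)). w \<in> Z" if "a \<in> Z'" for a
    using that Z'(1) q(2)[of a] by (intro bexI[of _ a]) auto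
  ultimately show ?sep
    using sep q(1) Z'(3) by (intro exI[of _ n] bexI[of _ "q ` Z'"]) auto
next
  assume ?sep
  then obtain n Q where Q: "card Q = m"
    and sep: "\<forall>q\<in>Q. \<forall>q'\<in>Q. q \<noteq> q' \<longrightarrow> dist q q' > 2 / real (Suc n)"
    and ball: "\<forall>q\<in>Q. \<exists>w\<in>cball q (1 / real (Suc n)). w \<in> Z"
    by blast
  from ball have "\<forall>q\<in>Q. \<exists>w. dist q w \<le> 1 / real (Suc n) \<and> w \<in> Z"
    by (simp add: Bex_def)
  from bchoice[OF this] obtain p where p: "\<And>q. q \<in> Q \<Longrightarrow> dist q (p q) \<le> 1 / real (Suc n)" "\<And>q. q \<in> Q \<Longrightarrow> p q \<in> Z"
    by blast
  have "inj_on p Q"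
  proof (rule inj_onI, rule ccontr)
    fix q q' assume qq: "q \<in> Q" "q' \<in> Q" "p q = p q'" "q \<noteq> q'"
    have "dist q q' \<le> dist q (p q) + dist q' (p q)" by (rule dist_triangle2)
    then show False using sep[rule_format, OF qq(1,2,4)] p(1)[OF qq(1)] p(1)[OF qq(2)] qq(3) by simp
  qed
  then show "m \<le> card Z"
    using p(2) Q assms(1) card_inj_on_le[of p Q Z] by blast
qed

lemma pred_bex_countable:
  assumes "countable C" "\<And>Q. Q \<in> C \<Longrightarrow> Measurable.pred A (\<lambda>x. P x Q)"
  shows "Measurable.pred A (\<lambda>x. \<exists>Q\<in>C. P x Q)"
proof -
  have "{x \<in> space A. \<exists>Q\<in>C. P x Q} = (\<Union>Q\<in>C. {x \<in> space A. P x Q})" by auto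
  then show ?thesis
    using assms by (auto simp: pred_def intro!: sets.countable_UN'')
qed

lemma measurable_card_zeros_compact:
  assumes "compact K"
  shows "(\<lambda>x. if nondeg_seq x then real (card (zeros x \<inter> K)) else 0) \<in> borel_measurable seqs" (is "?f \<in> _")
proof -
  obtain D :: "complex set" where D: "countable D" "\<And>X. open X \<Longrightarrow> X \<noteq> {} \<Longrightarrow> \<exists>d \<in> D. d \<in> X"
    using countable_dense_setE by blast
  have dense: "\<exists>q\<in>D. dist q a < e" if "e > 0" for a e
    using D(2)[of "ball a e"] that by (auto simp: dist_commute)
  have le_card: "Measurable.pred seqs (\<lambda>x. nondeg_seq x \<and> m \<le> card (zeros x \<inter> K))" for m
  proof -
    have ball: "Measurable.pred seqs (\<lambda>x. nondeg_seq x \<and> (\<exists>w\<in>K \<inter> cball q r. cmod (gfun x w) = 0))" for q r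
    proof (rule measurable_ex_zero)
      fix x assume "nondeg_seq x"
      then have "continuous_on (K \<inter> cball q r) (gfun x)"
        by (intro holomorphic_on_imp_continuous_on gfun_holomorphic) (simp add: nondeg_seq_def)
      then show "continuous_on (K \<inter> cball q r) (\<lambda>w. cmod (gfun x w))" by (rule continuous_on_norm)
    qed (use assms in \<open>auto intro: compact_Int_closed\<close>)
    have eq: "(nondeg_seq x \<and> m \<le> card (zeros x \<inter> K)) \<longleftrightarrow> nondeg_seq x \<and>
      (\<exists>n. \<exists>Q\<in>{Q. finite Q \<and> Q \<subseteq> D}. card Q = m \<and>
        (\<forall>q\<in>Q. \<forall>q'\<in>Q. q \<noteq> q' \<longrightarrow> dist q q' > 2 / real (Suc n)) \<and>
        (\<forall>q\<in>Q. nondeg_seq x \<and> (\<exists>w\<in>K \<inter> cball q (1 / real (Suc n)). cmod (gfun x w) = 0)))" for x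
    proof (cases "nondeg_seq x")
      case True
      then have "(\<exists>w\<in>K \<inter> cball q r. cmod (gfun x w) = 0) \<longleftrightarrow> (\<exists>w\<in>cball q r. w \<in> zeros x \<inter> K)" for q r
        by (auto simp: zeros_def nondeg_seq_def)
      then show ?thesis
        using True le_card_iff_separated_balls[OF finite_zeros[OF True assms] dense, of m] by simp
    qed simp
    have fin: "countable {Q. finite Q \<and> Q \<subseteq> D}" using D(1) by (rule countable_Collect_finite_subset)
    have "Measurable.pred seqs (\<lambda>x. \<forall>q\<in>Q. nondeg_seq x \<and> (\<exists>w\<in>K \<inter> cball q r. cmod (gfun x w) = 0))"
      if "Q \<in> {Q. finite Q \<and> Q \<subseteq> D}" for Q r
      by (rule pred_intros_finite(3)[OF _ ball]) (use that in simp)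
    then show ?thesis
      unfolding eq
      by (rule pred_intros_logic(3)[OF measurable_nondeg_seq pred_intros_countable(2)[OF
            pred_bex_countable[OF fin pred_intros_conj1'[OF pred_intros_conj1']]]])
  qed
  show ?thesis
    unfolding borel_measurable_iff_ge
  proof
    fix a :: real
    have "{x \<in> space seqs. a \<le> ?f x} =
      (if a \<le> 0 then UNIV else {x \<in> space seqs. nondeg_seq x \<and> nat \<lceil>a\<rceil> \<le> card (zeros x \<inter> K)})"
      by (auto simp: nat_ceiling_le_eq intro: order_trans[of a 0])
    also have "\<dots> \<in> sets seqs"
      using le_card[of "nat \<lceil>a\<rceil>"] sets.top[of seqs] by (auto simp: pred_def)
    finally show "{x \<in> space seqs. a \<le> ?f x} \<in> sets seqs" .
  qed
qed

text \<open>Dynkin's argument from closed to Borel sets. The window \<open>cball 0 R\<close> makes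
  closed sets compact and keeps all counts finite, so that complements can be subtracted.\<close>

lemma measurable_card_zeros:
  assumes "B \<in> sets borel"
  shows "(\<lambda>x. if nondeg_seq x then real (card (zeros x \<inter> cball 0 R \<inter> B)) else 0) \<in> borel_measurable seqs"
    (is "?f B \<in> _")
proof -
  have borel: "sets (borel :: complex measure) = sigma_sets UNIV (Collect closed)"
    by (simp add: borel_eq_closed)
  have Int_stable: "Int_stable (Collect closed :: complex set set)"
    by (auto simp: Int_stable_def)
  have fin: "finite (zeros x \<inter> cball 0 R)" if "nondeg_seq x" for x
    using finite_zeros[OF that compact_cball] .
  have card_diff: "real (card (W - W \<inter> A)) = real (card W) - real (card (W \<inter> A))"
    if "finite W" for W A :: "complex set"
    using that card_mono[OF that, of "W \<inter> A"] by (simp add: card_Diff_subset of_nat_diff)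
  have Pow: "Collect closed \<subseteq> Pow (UNIV :: complex set)" by simp
  have "B \<in> sigma_sets UNIV (Collect closed)" using assms borel by simp
  from Int_stable Pow this show ?thesis
  proof (induction B rule: sigma_sets_induct_disjoint)
    case (basic A)
    then have "compact (cball 0 R \<inter> A)" by (intro compact_Int_closed) auto
    from measurable_card_zeros_compact[OF this] show ?case unfolding Int_assoc .
  next
    case empty
    have eq: "?f {} = (\<lambda>_. 0)" by (rule ext) simp
    show ?case by (subst eq) (rule borel_measurable_const)
  next
    case (compl A)
    have eq: "?f (UNIV - A) = (\<lambda>x. (if nondeg_seq x then real (card (zeros x \<inter> cball 0 R)) else 0) - ?f A x)"
    proof
      fix x
      have "zeros x \<inter> cball 0 R \<inter> (UNIV - A) = zeros x \<inter> cball 0 R - (zeros x \<inter> cball 0 R \<inter> A)" by auto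
      then show "?f (UNIV - A) x = (if nondeg_seq x then real (card (zeros x \<inter> cball 0 R)) else 0) - ?f A x"
        using card_diff[OF fin[of x]] by simp
    qed
    show ?case
      by (subst eq) (rule borel_measurable_diff[OF measurable_card_zeros_compact[OF compact_cball] compl.IH])
  next
    case (union A)
    have eq: "?f (\<Union>i. A i) = (\<lambda>x. \<Sum>i. ?f (A i) x)"
    proof
      fix x
      show "?f (\<Union>i. A i) x = (\<Sum>i. ?f (A i) x)"
      proof (cases "nondeg_seq x")
        case True
        define W where "W = zeros x \<inter> cball 0 R"
        have card_eq: "real (card (W \<inter> S)) = (\<Sum>z\<in>W. indicator S z)" for S
          using fin[OF True] by (simp add: W_def indicator_def sum.If_cases)
        have "(\<lambda>i. \<Sum>z\<in>W. indicator (A i) z :: real) sums (\<Sum>z\<in>W. indicator (\<Union>i. A i) z)"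
          using union.hyps(1) by (intro sums_sum indicator_sums) (auto simp: disjoint_family_on_def)
        then show ?thesis
          using True by (simp add: card_eq sums_iff flip: W_def)
      qed simp
    qed
    show ?case by (subst eq) (rule borel_measurable_suminf[OF union.IH])
  qed
qed

theorem measurable_zeros: "zeros \<in> measurable seqs configs"
  unfolding configs_def
proof (rule measurable_measure_of)
  fix y :: "complex set set"
  assume "y \<in> {{S. finite (S \<inter> B) \<and> card (S \<inter> B) = m} | B m. B \<in> sets borel \<and> bounded B}"
  then obtain B m where y: "y = {S. finite (S \<inter> B) \<and> card (S \<inter> B) = m}"
    and B: "B \<in> sets borel" "bounded (B :: complex set)" by auto
  from B(2) obtain R where "\<forall>z\<in>B. cmod z \<le> R" unfolding bounded_iff by blast
  then have R: "B \<subseteq> cball 0 R" by auto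
  let ?c = "\<lambda>x. if nondeg_seq x then real (card (zeros x \<inter> cball 0 R \<inter> B)) else 0"
  \<comment> \<open>Degenerate inputs: for the zero sequence the zero set is the plane and its trace
    on B is B itself; for a non-entire sequence the configuration is empty by convention, so only m
    = 0 occurs.\<close>
  let ?Q = "\<lambda>x. (nondeg_seq x \<and> ?c x = real m) \<or>
      (\<not> nondeg_seq x \<and> entire_seq x \<and> finite B \<and> card B = m) \<or> (\<not> entire_seq x \<and> m = 0)"
  have "Measurable.pred borel (\<lambda>r. r = real m)"
    by (rule Collect_closed_imp_pred_borel, rule closed_Collect_eq[OF continuous_on_id continuous_on_const])
  then have pred: "Measurable.pred seqs (\<lambda>x. ?c x = real m)"
    by (rule measurable_compose[OF measurable_card_zeros[OF B(1)]])
  have iff: "zeros x \<in> y \<longleftrightarrow> ?Q x" for x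
  proof (cases "nondeg_seq x")
    case True
    have eq: "zeros x \<inter> B = zeros x \<inter> cball 0 R \<inter> B" using R by blast
    have "finite (zeros x \<inter> B)"
      unfolding eq by (rule finite_Int) (simp add: finite_zeros[OF True compact_cball])
    moreover have "entire_seq x" using True by (simp add: nondeg_seq_def)
    ultimately show ?thesis using True by (simp add: y flip: eq)
  next
    case False
    then have "gfun x z = 0" if "entire_seq x" for z
      using that by (simp add: nondeg_seq_def gfun_def coeff_seq_def)
    then have "zeros x = (if entire_seq x then UNIV else {})" by (auto simp: zeros_def)
    then show ?thesis using False by (cases "m = 0") (simp_all add: y)
  qed
  have "zeros -` y \<inter> space seqs = {x \<in> space seqs. ?Q x}"
  proof (rule set_eqI)
    show "x \<in> zeros -` y \<inter> space seqs \<longleftrightarrow> x \<in> {x \<in> space seqs. ?Q x}" for x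
      unfolding vimage_eq Int_iff mem_Collect_eq iff by (rule conj_commute)
  qed
  moreover have "Measurable.pred seqs ?Q"
    by (intro pred_intros_logic(5) pred_intros_logic(3)[OF measurable_nondeg_seq pred]
        pred_intros_logic(3)[OF pred_intros_logic(2)[OF measurable_nondeg_seq] pred_intros_conj2']
        pred_intros_conj2'[OF pred_intros_logic(2)[OF measurable_entire_seq]] measurable_entire_seq)
  ultimately show "zeros -` y \<inter> space seqs \<in> sets seqs"
    unfolding pred_def by simp
qed auto

section \<open>The complex Gaussian measure\<close>

definition gauss :: "complex measure" where
  "gauss = density lborel (\<lambda>z. ennreal (exp (- (cmod z)\<^sup>2) / pi))"

lemma sets_gauss [measurable_cong, simp]: "sets gauss = sets borel"
  by (simp add: gauss_def)

lemma space_gauss [simp]: "space gauss = UNIV"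
  by (simp add: gauss_def)

lemma nn_integral_lborel_translate:
  assumes [measurable]: "f \<in> borel_measurable (borel :: 'a::euclidean_space measure)"
  shows "(\<integral>\<^sup>+x. f (x + c) \<partial>lborel) = (\<integral>\<^sup>+x. f x \<partial>lborel)"
proof -
  have "(\<integral>\<^sup>+x. f x \<partial>lborel) = (\<integral>\<^sup>+x. f x \<partial>distr lborel borel ((+) c))"
    by (simp add: lborel_distr_plus)
  then show ?thesis by (simp add: nn_integral_distr add.commute)
qed

text \<open>Translating by c after the multiplication is translating by c / u before it.\<close>

lemma nn_integral_lborel_rotate_translate:
  assumes [measurable]: "f \<in> borel_measurable borel" and "u \<noteq> 0"
  shows "(\<integral>\<^sup>+x. f (x + c) \<partial>distr lborel borel ((*) u)) = (\<integral>\<^sup>+x. f x \<partial>distr lborel borel ((*) (u::complex)))"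
proof -
  have "(\<integral>\<^sup>+x. f (x + c) \<partial>distr lborel borel ((*) u)) = (\<integral>\<^sup>+x. f (u * (x + c / u)) \<partial>lborel)"
    using assms(2) by (simp add: nn_integral_distr distrib_left)
  also have "\<dots> = (\<integral>\<^sup>+x. f (u * x) \<partial>lborel)"
    by (rule nn_integral_lborel_translate) measurable
  finally show ?thesis by (simp add: nn_integral_distr)
qed

text \<open>A translation-invariant measure is a multiple of Lebesgue measure (integrate
  \<open>indicator A x * indicator B (y - x)\<close> in both orders), and the unit ball, being invariant under
  rotations, fixes the factor.\<close>

lemma lborel_rotation:
  assumes u: "cmod u = 1"
  shows "distr lborel borel ((*) u) = (lborel :: complex measure)"
proof (rule measure_eqI)
  define \<nu> where "\<nu> = distr lborel borel ((*) u)"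
  have [simp, measurable_cong]: "sets \<nu> = sets borel" by (simp add: \<nu>_def)
  have u0: "u \<noteq> 0" using u by auto
  \<comment> \<open>Rotating back recovers \<open>lborel\<close>, so \<open>\<nu>\<close> is
    sigma-finite, as Fubini requires.\<close>
  have "distr \<nu> borel ((*) (inverse u)) = lborel"
    using u0 by (simp add: \<nu>_def distr_distr comp_def distr_id2 flip: mult.assoc)
  then interpret \<nu>: sigma_finite_measure \<nu>
    by (intro sigma_finite_measure_distr[of \<nu> borel "(*) (inverse u)"]) (simp_all add: sigma_finite_lborel)
  interpret P: pair_sigma_finite \<nu> lborel ..
  define B where "B = ball (0::complex) 1"
  have [measurable]: "B \<in> sets borel" by (simp add: B_def)
  have "(*) u -` B = B"
    using u by (auto simp: B_def norm_mult)
  then have \<nu>B: "emeasure \<nu> B = emeasure lborel B"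
    by (simp add: \<nu>_def emeasure_distr)
  have B_pos: "emeasure lborel B \<noteq> 0" "emeasure lborel B \<noteq> \<infinity>"
    by (auto simp: B_def emeasure_ball unit_ball_vol_2)
  fix A assume "A \<in> sets (distr lborel borel ((*) u))"
  then have [measurable]: "A \<in> sets borel" by simp
  have "emeasure \<nu> A * emeasure lborel B =
      (\<integral>\<^sup>+x. (\<integral>\<^sup>+y. indicator A x * indicator B y \<partial>lborel) \<partial>\<nu>)"
    by (simp add: nn_integral_cmult nn_integral_multc)
  also have "\<dots> = (\<integral>\<^sup>+x. (\<integral>\<^sup>+y. indicator A x * indicator B (y + - x) \<partial>lborel) \<partial>\<nu>)"
    by (intro nn_integral_cong nn_integral_lborel_translate[symmetric]) measurable
  also have "\<dots> = (\<integral>\<^sup>+y. (\<integral>\<^sup>+x. indicator A x * indicator B (y + - x) \<partial>\<nu>) \<partial>lborel)"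
    by (rule P.Fubini'[symmetric]) measurable
  also have "\<dots> = (\<integral>\<^sup>+y. (\<integral>\<^sup>+x. indicator A (x + y) * indicator B (y + - (x + y)) \<partial>\<nu>) \<partial>lborel)"
    unfolding \<nu>_def by (intro nn_integral_cong nn_integral_lborel_rotate_translate[symmetric] u0) measurable
  also have "\<dots> = (\<integral>\<^sup>+x. (\<integral>\<^sup>+y. indicator A (x + y) * indicator B (y + - (x + y)) \<partial>lborel) \<partial>\<nu>)"
    by (rule P.Fubini') measurable
  \<comment> \<open>The argument of the second indicator has become -x, and the ball B is
    symmetric.\<close>
  also have "\<dots> = (\<integral>\<^sup>+x. (\<integral>\<^sup>+y. indicator B x * indicator A (y + x) \<partial>lborel) \<partial>\<nu>)"
    by (intro nn_integral_cong) (auto simp: indicator_def B_def add.commute)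
  also have "\<dots> = (\<integral>\<^sup>+x. (\<integral>\<^sup>+y. indicator B x * indicator A y \<partial>lborel) \<partial>\<nu>)"
    by (intro nn_integral_cong nn_integral_lborel_translate) measurable
  also have "\<dots> = emeasure lborel A * emeasure lborel B"
    by (simp add: nn_integral_cmult nn_integral_multc \<nu>B mult.commute)
  finally have "emeasure \<nu> A * emeasure lborel B = emeasure lborel A * emeasure lborel B" .
  then show "emeasure (distr lborel borel ((*) u)) A = emeasure lborel A"
    using B_pos by (simp add: \<nu>_def ennreal_mult_cancel_left mult.commute[of _ "emeasure lborel B"])
qed simp

lemma gauss_rotation:
  assumes u: "cmod u = 1"
  shows "distr gauss borel ((*) u) = gauss"
proof -
  have "gauss = density (distr lborel borel ((*) u)) (\<lambda>z. ennreal (exp (- (cmod z)\<^sup>2) / pi))"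
    by (simp add: gauss_def lborel_rotation[OF u])
  also have "\<dots> = distr (density lborel (\<lambda>z. ennreal (exp (- (cmod (u * z))\<^sup>2) / pi))) borel ((*) u)"
    by (rule density_distr) auto
  finally show ?thesis
    by (simp add: gauss_def norm_mult u)
qed

text \<open>Dilation by sqrt (1 - s), with Jacobian 1 - s in the plane, reduces the integral to the
  total mass of \<open>gauss\<close>. That mass is a hypothesis because it is later read off from
  the law of \<open>\<xi> k\<close>, without evaluating a Gaussian integral.\<close>

lemma nn_integral_exp_gauss:
  assumes "emeasure gauss UNIV = 1" "s < 1"
  shows "(\<integral>\<^sup>+z. ennreal (exp (s * (cmod z)\<^sup>2)) \<partial>gauss) = ennreal (1 / (1 - s))"
proof -
  define c where "c = sqrt (1 - s)"
  have c: "c > 0" "c\<^sup>2 = 1 - s" using assms by (auto simp: c_def)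
  define f :: "complex \<Rightarrow> ennreal" where "f = (\<lambda>z. ennreal (exp (- (cmod z)\<^sup>2) / pi))"
  have [measurable]: "f \<in> borel_measurable borel" unfolding f_def by measurable
  have "1 = (\<integral>\<^sup>+z. f z \<partial>lborel)"
    using assms(1) by (simp add: gauss_def emeasure_density f_def)
  also have "\<dots> = (\<integral>\<^sup>+z. f z \<partial>density (distr lborel borel (\<lambda>x. 0 + c *\<^sub>R x)) (\<lambda>_. \<bar>c\<bar>^DIM(complex)))"
    by (subst lborel_affine[of c 0]) (use c in auto)
  also have "\<dots> = (\<integral>\<^sup>+z. ennreal (1 - s) * f (c *\<^sub>R z) \<partial>lborel)"
    using c by (simp add: nn_integral_density nn_integral_distr)
  also have "\<dots> = ennreal (1 - s) * (\<integral>\<^sup>+z. f (c *\<^sub>R z) \<partial>lborel)"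
    by (rule nn_integral_cmult) measurable
  also have "(\<integral>\<^sup>+z. f (c *\<^sub>R z) \<partial>lborel) = (\<integral>\<^sup>+z. ennreal (exp (- (cmod z)\<^sup>2) / pi) * ennreal (exp (s * (cmod z)\<^sup>2)) \<partial>lborel)"
  proof (rule nn_integral_cong)
    fix z
    have "exp (- (cmod (c *\<^sub>R z))\<^sup>2) = exp (- (cmod z)\<^sup>2) * exp (s * (cmod z)\<^sup>2)"
      unfolding norm_scaleR power_mult_distrib power2_abs c(2) by (simp add: algebra_simps flip: exp_add)
    then show "f (c *\<^sub>R z) = ennreal (exp (- (cmod z)\<^sup>2) / pi) * ennreal (exp (s * (cmod z)\<^sup>2))"
      by (simp add: f_def flip: ennreal_mult)
  qed
  also have "\<dots> = (\<integral>\<^sup>+z. ennreal (exp (s * (cmod z)\<^sup>2)) \<partial>gauss)"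
    by (simp add: gauss_def nn_integral_density)
  finally have *: "1 = ennreal (1 - s) * (\<integral>\<^sup>+z. ennreal (exp (s * (cmod z)\<^sup>2)) \<partial>gauss)" (is "_ = _ * ?I") .
  have "?I = ennreal (1 / (1 - s)) * (ennreal (1 - s) * ?I)"
    using assms(2) by (simp flip: mult.assoc ennreal_mult)
  then show ?thesis using * by simp
qed

lemma nn_integral_cmod_gauss:
  assumes "emeasure gauss UNIV = 1"
  shows "(\<integral>\<^sup>+z. ennreal (cmod z) \<partial>gauss) \<le> 2"
proof -
  have "(\<integral>\<^sup>+z. ennreal (cmod z) \<partial>gauss) \<le> (\<integral>\<^sup>+z. ennreal (exp (1/2 * (cmod z)\<^sup>2)) \<partial>gauss)"
  proof (intro nn_integral_mono ennreal_leI)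
    fix z
    have "0 \<le> (cmod z - 1)\<^sup>2" by simp
    then have "cmod z \<le> 1 + 1/2 * (cmod z)\<^sup>2" by (simp add: power2_eq_square algebra_simps)
    also have "\<dots> \<le> exp (1/2 * (cmod z)\<^sup>2)" by (rule exp_ge_add_one_self)
    finally show "cmod z \<le> exp (1/2 * (cmod z)\<^sup>2)" .
  qed
  also have "\<dots> = 2" using nn_integral_exp_gauss[OF assms, of "1/2"] by simp
  finally show ?thesis .
qed

text \<open>If |s| = exp (-t) with t >= 0, the discs with n <= t contain s, and there are at least t
  of them. The point s = 0 costs nothing because ln 0 = 0.\<close>

lemma neg_ln_cmod_le_suminf_indicator:
  "ennreal (max 0 (- ln (cmod s))) \<le> (\<Sum>n. indicator (cball 0 (exp (- real n))) (s::complex))"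
proof (cases "cmod s > 0")
  case False
  then show ?thesis by simp
next
  case True
  define t where "t = - ln (cmod s)"
  have s: "cmod s = exp (- t)" using True by (simp add: t_def)
  show ?thesis
  proof (cases "t \<ge> 0")
    case True
    have "ennreal (max 0 t) \<le> ennreal (real (nat \<lfloor>t\<rfloor> + 1))"
      using True by (intro ennreal_leI) linarith
    also have "\<dots> = (\<Sum>n<nat \<lfloor>t\<rfloor> + 1. 1)"
      by (simp only: sum_constant card_lessThan ennreal_of_nat_eq_real_of_nat mult_1_right)
    also have "\<dots> = (\<Sum>n<nat \<lfloor>t\<rfloor> + 1. indicator (cball 0 (exp (- real n))) s)"
    proof (rule sum.cong[OF refl])
      fix n assume "n \<in> {..<nat \<lfloor>t\<rfloor> + 1}"
      then have "real n \<le> t" using True by simp linarith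
      then show "(1::ennreal) = indicator (cball 0 (exp (- real n))) s"
        by (simp add: s)
    qed
    also have "\<dots> \<le> (\<Sum>n. indicator (cball 0 (exp (- real n))) s)"
      by (rule sum_le_suminf) auto
    finally show ?thesis by (simp add: t_def)
  next
    case False
    then have "max 0 t = 0" by simp
    then show ?thesis by (simp flip: t_def)
  qed
qed

text \<open>The sum over n of exp (-2 n), that is, of the areas of the discs of radius exp (-n)
  divided by pi.\<close>

definition log_const :: real where
  "log_const = 1 / (1 - exp (- 2))"

lemma log_const_nonneg: "log_const \<ge> 0"
  by (simp add: log_const_def)

text \<open>The bound is uniform in w: the density is at most 1 / pi, and Lebesgue measure does not
  see the shift.\<close>

lemma nn_integral_neg_ln_gauss:
  "(\<integral>\<^sup>+s. ennreal (max 0 (- ln (cmod (s + w)))) \<partial>gauss) \<le> ennreal log_const"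
proof -
  have [measurable]: "cball (0::complex) r \<in> sets borel" for r
    by (simp add: borel_closed)
  have "(\<integral>\<^sup>+s. ennreal (max 0 (- ln (cmod (s + w)))) \<partial>gauss) =
     (\<integral>\<^sup>+s. ennreal (exp (- (cmod s)\<^sup>2) / pi) * ennreal (max 0 (- ln (cmod (s + w)))) \<partial>lborel)"
    by (simp add: gauss_def nn_integral_density)
  also have "\<dots> \<le> (\<integral>\<^sup>+s. ennreal (1 / pi) * ennreal (max 0 (- ln (cmod (s + w)))) \<partial>lborel)"
    by (intro nn_integral_mono mult_right_mono ennreal_leI divide_right_mono) auto
  also have "\<dots> = (\<integral>\<^sup>+s. ennreal (1 / pi) * ennreal (max 0 (- ln (cmod s))) \<partial>lborel)"
    by (rule nn_integral_lborel_translate) measurable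
  also have "\<dots> \<le> (\<integral>\<^sup>+s. (\<Sum>n. ennreal (1 / pi) * indicator (cball 0 (exp (- real n))) (s::complex)) \<partial>lborel)"
    using neg_ln_cmod_le_suminf_indicator by (intro nn_integral_mono) (simp add: mult_left_mono)
  also have "\<dots> = (\<Sum>n. \<integral>\<^sup>+s. ennreal (1 / pi) * indicator (cball 0 (exp (- real n))) (s::complex) \<partial>lborel)"
    by (rule nn_integral_suminf) measurable
  also have "\<dots> = (\<Sum>n. ennreal (1 / pi) * emeasure lborel (cball (0::complex) (exp (- real n))))"
    by (simp add: nn_integral_cmult_indicator)
  also have "\<dots> = (\<Sum>n. ennreal (exp (-2) ^ n))"
    by (intro suminf_cong) (simp add: emeasure_cball unit_ball_vol_2 power2_eq_square flip: ennreal_mult exp_add exp_of_nat_mult)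
  also have "\<dots> = ennreal (\<Sum>n. exp (-2) ^ n)"
    by (rule suminf_ennreal2) (auto intro!: summable_geometric)
  also have "\<dots> = ennreal log_const"
    by (simp add: log_const_def suminf_geometric)
  finally show ?thesis .
qed

section \<open>Independence and null events\<close>

text \<open>Padding with zeros makes f_n another instance of \<open>gfun\<close>, so that the
  argument against double zeros also covers the polynomials.\<close>

definition trunc_seq :: "nat \<Rightarrow> (nat \<Rightarrow> complex) \<Rightarrow> nat \<Rightarrow> complex" where
  "trunc_seq n x k = (if k \<le> n then x k else 0)"

definition gfun_deriv :: "(nat \<Rightarrow> complex) \<Rightarrow> complex \<Rightarrow> complex" where
  "gfun_deriv x z = (\<Sum>k. diffs (coeff_seq x) k * z ^ k)"

lemma deriv_gfun: "entire_seq x \<Longrightarrow> deriv (gfun x) = gfun_deriv x"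
  by (rule ext) (simp add: gfun_deriv_def DERIV_imp_deriv[OF gfun_DERIV])

lemma gfun_deriv_holomorphic: "entire_seq x \<Longrightarrow> gfun_deriv x holomorphic_on UNIV"
  using holomorphic_deriv[OF gfun_holomorphic[of x UNIV] open_UNIV] deriv_gfun[of x] by metis

lemma measurable_gfun_deriv: "(\<lambda>x. gfun_deriv x z) \<in> borel_measurable seqs"
  unfolding gfun_deriv_def by (rule measurable_deriv_series)

definition double_zero :: "(nat \<Rightarrow> complex) \<Rightarrow> bool" where
  "double_zero x \<longleftrightarrow> entire_seq x \<and> (\<exists>w. gfun x w = 0 \<and> gfun_deriv x w = 0)"

text \<open>The sum |f| + |f'| turns a double zero into a zero of one continuous real function, to
  be searched on the compact discs of natural radius.\<close>

lemma measurable_double_zero: "Measurable.pred seqs double_zero"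
proof -
  let ?P = "\<lambda>m x. entire_seq x \<and>
      (\<exists>w\<in>cball 0 (real m). cmod (gfun x w) + cmod (gfun_deriv x w) = 0)"
  have "Measurable.pred seqs (?P m)" for m
  proof (rule measurable_ex_zero[OF compact_cball measurable_entire_seq])
    show "(\<lambda>x. cmod (gfun x w) + cmod (gfun_deriv x w)) \<in> borel_measurable seqs" for w
      by (rule borel_measurable_add[OF measurable_compose[OF measurable_gfun borel_measurable_norm]
            measurable_compose[OF measurable_gfun_deriv borel_measurable_norm]])
    show "continuous_on (cball 0 (real m)) (\<lambda>w. cmod (gfun x w) + cmod (gfun_deriv x w))"
      if "entire_seq x" for x
      using gfun_holomorphic[OF that] gfun_deriv_holomorphic[OF that]
      by (intro continuous_on_add continuous_on_norm holomorphic_on_imp_continuous_on)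
        (auto intro: holomorphic_on_subset)
  qed
  then have "Measurable.pred seqs (\<lambda>x. \<exists>m. ?P m x)"
    by (rule pred_intros_countable(2))
  moreover have "double_zero x \<longleftrightarrow> (\<exists>m. ?P m x)" for x
  proof
    assume "double_zero x"
    then obtain w where w: "entire_seq x" "gfun x w = 0" "gfun_deriv x w = 0"
      by (auto simp: double_zero_def)
    obtain m :: nat where "cmod w \<le> real m" using real_arch_simple by blast
    with w show "\<exists>m. ?P m x"
      by (intro exI[of _ m] conjI bexI[of _ w]) auto
  next
    assume "\<exists>m. ?P m x"
    then obtain w where "entire_seq x" "cmod (gfun x w) + cmod (gfun_deriv x w) = 0" by blast
    moreover from this have "cmod (gfun x w) = 0" "cmod (gfun_deriv x w) = 0"
      using norm_ge_zero[of "gfun x w"] norm_ge_zero[of "gfun_deriv x w"] by linarith+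
    ultimately show "double_zero x" by (auto simp: double_zero_def)
  qed
  ultimately show ?thesis by presburger
qed

definition circle_zero :: "real \<Rightarrow> (nat \<Rightarrow> complex) \<Rightarrow> bool" where
  "circle_zero R x \<longleftrightarrow> entire_seq x \<and> (\<exists>w\<in>sphere 0 R. cmod (gfun x w) = 0)"

lemma measurable_circle_zero: "Measurable.pred seqs (circle_zero R)"
  unfolding circle_zero_def
proof (rule measurable_ex_zero[OF compact_sphere measurable_entire_seq])
  show "(\<lambda>x. cmod (gfun x w)) \<in> borel_measurable seqs" for w
    by (rule measurable_compose[OF measurable_gfun borel_measurable_norm])
  show "continuous_on (sphere 0 R) (\<lambda>w. cmod (gfun x w))" if "entire_seq x" for x
    using gfun_holomorphic[OF that]
    by (intro continuous_on_norm holomorphic_on_imp_continuous_on)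
qed

section \<open>Changing a single coefficient\<close>

lemma coeff_seq_upd: "coeff_seq (x(i := s)) k = (if k = i then s / complex_of_real (sqrt (fact i)) else coeff_seq x k)"
  by (simp add: coeff_seq_def)

lemma coeff_seq_upd_sums:
  assumes "entire_seq x"
  shows "(\<lambda>k. coeff_seq (x(i := s)) k * z ^ k) sums
    (gfun x z + (s - x i) / complex_of_real (sqrt (fact i)) * z ^ i)"
proof -
  have "(\<lambda>k. coeff_seq x k * z ^ k + (if k = i then (s - x i) / complex_of_real (sqrt (fact i)) * z ^ k else 0)) sums
     (gfun x z + (s - x i) / complex_of_real (sqrt (fact i)) * z ^ i)"
    by (intro sums_add gfun_sums assms sums_single)
  moreover have "coeff_seq x k * z ^ k + (if k = i then (s - x i) / complex_of_real (sqrt (fact i)) * z ^ k else 0)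
      = coeff_seq (x(i := s)) k * z ^ k" for k
    unfolding coeff_seq_upd by (simp add: coeff_seq_def diff_divide_distrib left_diff_distrib)
  ultimately show ?thesis by (simp only:)
qed

lemma entire_seq_upd: "entire_seq (x(i := s)) \<longleftrightarrow> entire_seq x"
proof -
  have *: "entire_seq (x(i := s))" if "entire_seq x" for x s
    using sums_summable[OF coeff_seq_upd_sums[OF that]] by (simp add: entire_seq_def)
  then show ?thesis using *[of "x(i := s)" "x i"] by auto
qed

lemma gfun_upd:
  assumes "entire_seq x"
  shows "gfun (x(i := s)) z = gfun x z + (s - x i) / complex_of_real (sqrt (fact i)) * z ^ i"
  using coeff_seq_upd_sums[OF assms, of i s z] by (simp add: gfun_def sums_iff)

lemma gfun_deriv_upd: "gfun_deriv (x(0 := s)) = gfun_deriv x"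
  by (rule ext) (simp add: gfun_deriv_def diffs_def coeff_seq_upd)

text \<open>Varying the constant term leaves f' unchanged, so a double zero forces s = x 0 - f(w)
  with w a critical point of f: only countably many values.\<close>

lemma negligible_double_zero: "negligible {s. double_zero (x(0 := s))}"
proof (cases "entire_seq x")
  case False
  then show ?thesis by (simp add: double_zero_def entire_seq_upd)
next
  case True
  define N where "N = {w \<in> UNIV. gfun_deriv x w = 0}"
  have sub: "{s. double_zero (x(0 := s))} \<subseteq> (\<lambda>w. x 0 - gfun x w) ` N"
  proof
    fix s assume "s \<in> {s. double_zero (x(0 := s))}"
    then obtain w where "gfun x w + (s - x 0) = 0" "gfun_deriv x w = 0"
      by (auto simp: double_zero_def gfun_deriv_upd gfun_upd[OF True])
    then show "s \<in> (\<lambda>w. x 0 - gfun x w) ` N"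
      by (intro image_eqI[of _ _ w]) (simp_all add: N_def algebra_simps)
  qed
  have "countable ((\<lambda>w. x 0 - gfun x w) ` N)"
  proof (cases "gfun_deriv x constant_on UNIV")
    case False
    have "countable N"
      unfolding N_def
      by (rule holomorphic_countable_zeros) (use False gfun_deriv_holomorphic[OF True] in auto)
    then show ?thesis by (rule countable_image)
  next
    case const: True
    show ?thesis
    proof (cases "N = {}")
      case False
      \<comment> \<open>If f' vanishes identically, every point is critical, but f is constant and a
        single value of s remains.\<close>
      then have "gfun_deriv x w = 0" for w using const by (auto simp: N_def constant_on_def)
      then have "(gfun x has_field_derivative 0) (at w)" for w
        using gfun_DERIV[OF True, of w] by (simp add: gfun_deriv_def)
      then obtain c where "\<And>w. gfun x w = c"
        using has_field_derivative_zero_constant[of UNIV "gfun x"] by auto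
      then have "(\<lambda>w. x 0 - gfun x w) ` N \<subseteq> {x 0 - c}" by auto
      then show ?thesis by (rule countable_subset) simp
    qed simp
  qed
  then show ?thesis using countable_imp_null_set_lborel negligible_iff_null_sets negligible_subset[OF _ sub] null_sets_completionI by metis
qed

text \<open>A zero on the circle forces s into the image of the circle under a holomorphic map, and
  a differentiable image of a null set is null.\<close>

lemma negligible_circle_zero: "negligible {s. circle_zero R (x(0 := s))}"
proof (cases "entire_seq x")
  case False
  then show ?thesis by (simp add: circle_zero_def entire_seq_upd)
next
  case True
  have "{s. circle_zero R (x(0 := s))} \<subseteq> (\<lambda>w. x 0 - gfun x w) ` sphere 0 R"
  proof
    fix s assume "s \<in> {s. circle_zero R (x(0 := s))}"
    then obtain w where "w \<in> sphere 0 R" "gfun x w + (s - x 0) = 0"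
      by (auto simp: circle_zero_def gfun_upd[OF True])
    then show "s \<in> (\<lambda>w. x 0 - gfun x w) ` sphere 0 R"
      by (intro image_eqI[of _ _ w]) (simp_all add: algebra_simps)
  qed
  moreover have "negligible ((\<lambda>w. x 0 - gfun x w) ` sphere 0 R)"
  proof (rule negligible_differentiable_image_negligible[OF order_refl negligible_sphere])
    have "(\<lambda>w. x 0 - gfun x w) holomorphic_on UNIV"
      by (intro holomorphic_intros gfun_holomorphic True)
    then have "(\<lambda>w. x 0 - gfun x w) differentiable_on UNIV"
      by (simp add: holomorphic_on_def differentiable_on_def field_differentiable_imp_differentiable)
    then show "(\<lambda>w. x 0 - gfun x w) differentiable_on sphere 0 R"
      by (rule differentiable_on_subset) simp
  qed
  ultimately show ?thesis using negligible_subset by blast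
qed

lemma gauss_null:
  assumes "N \<in> sets borel" "negligible N"
  shows "emeasure gauss N = 0"
proof -
  have "N \<in> null_sets lebesgue" using assms(2) by (simp add: negligible_iff_null_sets)
  then have "emeasure lborel N = 0" using assms(1) by (auto simp: null_sets_def)
  moreover have "absolutely_continuous lborel gauss"
    unfolding gauss_def by (rule absolutely_continuousI_density) measurable
  ultimately show ?thesis using assms(1) by (intro absolutely_continuousD[of lborel gauss]) simp_all
qed

section \<open>The random coefficients and the resampling of one of them\<close>

locale gaussian_seq = prob_space M for M :: "'a measure" +
  fixes \<xi> :: "nat \<Rightarrow> 'a \<Rightarrow> complex"
  assumes indep: "indep_vars (\<lambda>_. borel) \<xi> UNIV"
    and law: "\<And>k. distr M borel (\<xi> k) = gauss"
begin

abbreviation X :: "'a \<Rightarrow> nat \<Rightarrow> complex" where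
  "X \<omega> \<equiv> (\<lambda>k. \<xi> k \<omega>)"

lemma measurable_xi [measurable]: "\<xi> k \<in> borel_measurable M"
  using indep by (simp add: indep_vars_def)

lemma measurable_X: "X \<in> measurable M seqs"
  by (rule measurable_PiM_single') (simp_all add: measurable_xi)

lemma prob_gauss: "prob_space gauss"
  using prob_space_distr[OF measurable_xi] law by simp

lemma gauss_UNIV: "emeasure gauss UNIV = 1"
  using prob_space.emeasure_space_1[OF prob_gauss] by simp

lemma nn_integral_xi:
  "f \<in> borel_measurable borel \<Longrightarrow> (\<integral>\<^sup>+\<omega>. f (\<xi> k \<omega>) \<partial>M) = (\<integral>\<^sup>+z. f z \<partial>gauss)"
  by (simp add: nn_integral_distr flip: law[of k])

text \<open>Split the sequence into coordinate i and the rest, which are independent, and integrate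
  coordinate i first. Null events and the lower bound on |f| thereby become questions about a single
  Gaussian variable.\<close>

lemma resample:
  assumes \<Phi>: "\<Phi> \<in> borel_measurable seqs"
  shows "(\<integral>\<^sup>+\<omega>. \<Phi> (X \<omega>) \<partial>M) = (\<integral>\<^sup>+\<omega>. (\<integral>\<^sup>+s. \<Phi> ((X \<omega>)(i := s)) \<partial>gauss) \<partial>M)"
proof -
  let ?B = "UNIV - {i}"
  let ?S = "PiM {i} (\<lambda>_. borel :: complex measure)" and ?T = "PiM ?B (\<lambda>_. borel :: complex measure)"
  let ?U = "\<lambda>\<omega>. restrict (X \<omega>) {i}" and ?V = "\<lambda>\<omega>. restrict (X \<omega>) ?B"
  have "indep_var ?S ?U ?T ?V"
    by (rule indep_var_restrict[OF indep]) auto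
  then have U: "?U \<in> measurable M ?S" and V: "?V \<in> measurable M ?T"
    and joint: "distr M ?S ?U \<Otimes>\<^sub>M distr M ?T ?V = distr M (?S \<Otimes>\<^sub>M ?T) (\<lambda>\<omega>. (?U \<omega>, ?V \<omega>))"
    by (simp_all add: indep_var_distribution_eq)
  interpret U: prob_space "distr M ?S ?U" by (rule prob_space_distr[OF U])
  interpret V: prob_space "distr M ?T ?V" by (rule prob_space_distr[OF V])
  interpret UV: pair_sigma_finite "distr M ?S ?U" "distr M ?T ?V" ..
  have "(\<lambda>p. (\<lambda>(f, y). f(i := y)) (snd p, fst p i)) \<in> measurable (?S \<Otimes>\<^sub>M ?T) (PiM (insert i ?B) (\<lambda>_. borel))"
    by (rule measurable_compose[OF _ measurable_add_dim])
      (intro measurable_Pair measurable_snd measurable_compose[OF measurable_fst] measurable_component_singleton, simp)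
  moreover have "insert i ?B = UNIV" by auto
  ultimately have upd: "(\<lambda>p. (snd p)(i := fst p i)) \<in> measurable (?S \<Otimes>\<^sub>M ?T) seqs" by simp
  have h: "(\<lambda>p. \<Phi> ((snd p)(i := fst p i))) \<in> borel_measurable (?S \<Otimes>\<^sub>M ?T)"
    by (rule measurable_compose[OF upd \<Phi>])
  \<comment> \<open>The restriction is \<open>undefined\<close> at i, but that value is
    overwritten.\<close>
  have V_eq: "(?V \<omega>)(i := s) = (X \<omega>)(i := s)" for \<omega> s by auto
  have V_upd: "(\<lambda>\<omega>. (X \<omega>)(i := s)) \<in> measurable M seqs" for s
    by (rule measurable_PiM_single') (auto simp: fun_upd_def)
  have "(\<integral>\<^sup>+\<omega>. \<Phi> (X \<omega>) \<partial>M) = (\<integral>\<^sup>+\<omega>. \<Phi> ((?V \<omega>)(i := ?U \<omega> i)) \<partial>M)"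
  proof (rule nn_integral_cong)
    fix \<omega>
    have "(?V \<omega>)(i := ?U \<omega> i) = X \<omega>" by auto
    then show "\<Phi> (X \<omega>) = \<Phi> ((?V \<omega>)(i := ?U \<omega> i))" by (simp only:)
  qed
  also have "\<dots> = (\<integral>\<^sup>+p. \<Phi> ((snd p)(i := fst p i)) \<partial>distr M (?S \<Otimes>\<^sub>M ?T) (\<lambda>\<omega>. (?U \<omega>, ?V \<omega>)))"
    by (subst nn_integral_distr[OF measurable_Pair[OF U V]])
      (simp_all only: measurable_distr_eq1 h fst_conv snd_conv)
  also have "\<dots> = (\<integral>\<^sup>+p. \<Phi> ((snd p)(i := fst p i)) \<partial>(distr M ?S ?U \<Otimes>\<^sub>M distr M ?T ?V))"
    by (simp only: joint)
  also have "\<dots> = (\<integral>\<^sup>+y. (\<integral>\<^sup>+x. \<Phi> ((snd (x, y))(i := fst (x, y) i)) \<partial>distr M ?S ?U) \<partial>distr M ?T ?V)"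
    by (rule UV.nn_integral_snd[symmetric]) (use h in \<open>simp cong: measurable_cong_sets\<close>)
  also have "\<dots> = (\<integral>\<^sup>+y. (\<integral>\<^sup>+s. \<Phi> (y(i := s)) \<partial>gauss) \<partial>distr M ?T ?V)"
  proof (rule nn_integral_cong)
    fix y assume "y \<in> space (distr M ?T ?V)"
    then have y: "y \<in> space ?T" by simp
    have "(\<lambda>x. (snd (x, y))(i := fst (x, y) i)) \<in> measurable ?S seqs"
      by (rule measurable_compose[OF measurable_Pair2'[OF y] upd])
    then have "(\<lambda>x. \<Phi> (y(i := x i))) \<in> borel_measurable ?S"
      using measurable_compose[OF _ \<Phi>] by simp
    then have "(\<integral>\<^sup>+x. \<Phi> (y(i := x i)) \<partial>distr M ?S ?U) = (\<integral>\<^sup>+\<omega>. \<Phi> (y(i := \<xi> i \<omega>)) \<partial>M)"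
      by (simp add: nn_integral_distr[OF U])
    also have "\<dots> = (\<integral>\<^sup>+s. \<Phi> (y(i := s)) \<partial>gauss)"
    proof (rule nn_integral_xi[of "\<lambda>s. \<Phi> (y(i := s))"])
      have "(\<lambda>s. y(i := s)) \<in> measurable borel seqs"
        by (rule measurable_PiM_single') (auto simp: fun_upd_def)
      then show "(\<lambda>s. \<Phi> (y(i := s))) \<in> borel_measurable borel"
        by (rule measurable_compose[OF _ \<Phi>])
    qed
    finally show "(\<integral>\<^sup>+x. \<Phi> ((snd (x, y))(i := fst (x, y) i)) \<partial>distr M ?S ?U) = (\<integral>\<^sup>+s. \<Phi> (y(i := s)) \<partial>gauss)"
      by simp
  qed
  also have "\<dots> = (\<integral>\<^sup>+\<omega>. (\<integral>\<^sup>+s. \<Phi> ((?V \<omega>)(i := s)) \<partial>gauss) \<partial>M)"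
  proof (rule nn_integral_distr[OF V], unfold measurable_distr_eq1)
    interpret G: prob_space gauss by (rule prob_gauss)
    have "(\<lambda>p. (\<lambda>(f, y). f(i := y)) p) \<in> measurable (?T \<Otimes>\<^sub>M borel) (PiM (insert i ?B) (\<lambda>_. borel))"
      by (rule measurable_add_dim)
    then have "(\<lambda>p. \<Phi> ((fst p)(i := snd p))) \<in> borel_measurable (?T \<Otimes>\<^sub>M borel)"
      using \<open>insert i ?B = UNIV\<close> measurable_compose[OF _ \<Phi>] by (simp add: case_prod_beta')
    then have "(\<lambda>p. \<Phi> ((fst p)(i := snd p))) \<in> borel_measurable (?T \<Otimes>\<^sub>M gauss)"
      by (simp cong: measurable_cong_sets sets_pair_measure_cong)
    from G.borel_measurable_nn_integral_fst[OF this]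
    show "(\<lambda>y. \<integral>\<^sup>+s. \<Phi> (y(i := s)) \<partial>gauss) \<in> borel_measurable ?T" by simp
  qed
  finally show ?thesis by (simp only: V_eq)
qed

text \<open>Resample coefficient 0 alone: for every fixed choice of the others its bad values are
  null for \<open>gauss\<close>.\<close>

lemma AE_not_of_negligible:
  assumes P: "Measurable.pred seqs P" and neg: "\<And>x. negligible {s. P (x(i := s))}"
  shows "AE \<omega> in M. \<not> P (X \<omega>)"
proof -
  have A: "{x. P x} \<in> sets seqs" using P by (simp add: pred_def)
  have "(\<integral>\<^sup>+\<omega>. indicator {x. P x} (X \<omega>) \<partial>M) =
      (\<integral>\<^sup>+\<omega>. (\<integral>\<^sup>+s. indicator {x. P x} ((X \<omega>)(i := s)) \<partial>gauss) \<partial>M)"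
    by (rule resample[OF borel_measurable_indicator[OF A]])
  also have "\<dots> = (\<integral>\<^sup>+\<omega>. 0 \<partial>M)"
  proof (rule nn_integral_cong)
    fix \<omega>
    have "(\<lambda>s. (X \<omega>)(i := s)) \<in> measurable borel seqs"
      by (rule measurable_PiM_single') (auto simp: fun_upd_def)
    from measurable_sets[OF this A] have N: "{s. P ((X \<omega>)(i := s))} \<in> sets borel"
      by (simp add: vimage_def)
    have "(\<integral>\<^sup>+s. indicator {x. P x} ((X \<omega>)(i := s)) \<partial>gauss) = (\<integral>\<^sup>+s. indicator {s. P ((X \<omega>)(i := s))} s \<partial>gauss)"
      by (intro nn_integral_cong) (simp add: indicator_def)
    also have "\<dots> = emeasure gauss {s. P ((X \<omega>)(i := s))}"
      using N by (intro nn_integral_indicator) simp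
    also have "\<dots> = 0" by (rule gauss_null[OF N neg])
    finally show "(\<integral>\<^sup>+s. indicator {x. P x} ((X \<omega>)(i := s)) \<partial>gauss) = 0" .
  qed
  finally have "(\<integral>\<^sup>+\<omega>. indicator {x. P x} (X \<omega>) \<partial>M) = 0" by simp
  moreover have "(\<lambda>\<omega>. indicator {x. P x} (X \<omega>) :: ennreal) \<in> borel_measurable M"
    by (rule measurable_compose[OF measurable_X borel_measurable_indicator[OF A]])
  ultimately have "AE \<omega> in M. (indicator {x. P x} (X \<omega>) :: ennreal) = 0"
    by (simp add: nn_integral_0_iff_AE)
  then show ?thesis by (rule AE_mp) (auto intro!: AE_I2 simp: indicator_def)
qed

lemma AE_X0_nonzero: "AE \<omega> in M. \<xi> 0 \<omega> \<noteq> 0"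
proof -
  have "Measurable.pred seqs (\<lambda>x. x 0 = (0::complex))"
  proof (rule measurable_compose[OF measurable_component_singleton, of 0])
    show "Measurable.pred borel (\<lambda>z. z = (0::complex))"
      by (rule Collect_closed_imp_pred_borel, rule closed_Collect_eq[OF continuous_on_id continuous_on_const])
  qed simp
  from AE_not_of_negligible[OF this, of 0] show ?thesis by simp
qed

lemma AE_no_double_zero: "AE \<omega> in M. \<not> double_zero (X \<omega>)"
  by (rule AE_not_of_negligible[OF measurable_double_zero negligible_double_zero])

lemma AE_no_double_zero_trunc: "AE \<omega> in M. \<not> double_zero (trunc_seq n (X \<omega>))"
proof (rule AE_not_of_negligible)
  have "trunc_seq n \<in> measurable seqs seqs"
  proof (rule measurable_PiM_single')
    show "(\<lambda>x. trunc_seq n x k) \<in> borel_measurable seqs" for k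
      by (cases "k \<le> n") (simp_all add: trunc_seq_def)
  qed simp
  from measurable_compose[OF this measurable_double_zero]
  show "Measurable.pred seqs (\<lambda>x. double_zero (trunc_seq n x))" .
  have "trunc_seq n (x(0 := s)) = (trunc_seq n x)(0 := s)" for x s
    by (rule ext) (simp add: trunc_seq_def)
  then show "negligible {s. double_zero (trunc_seq n (x(0 := s)))}" for x
    using negligible_double_zero by simp
qed

lemma AE_no_circle_zero: "AE \<omega> in M. \<not> circle_zero R (X \<omega>)"
  by (rule AE_not_of_negligible[OF measurable_circle_zero negligible_circle_zero])

end

section \<open>Growth of the Gaussian analytic function\<close>

lemma entire_seq_of_bound:
  assumes bound: "\<And>k. cmod (x k) \<le> C * 2 ^ k"
  shows "entire_seq x"
  unfolding entire_seq_def
proof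
  fix z
  define r where "r = cmod z"
  have C: "C \<ge> 0" using order_trans[OF norm_ge_zero bound[of 0]] by simp
  have "summable (\<lambda>k. (16 * r\<^sup>2) ^ k / fact k)"
    using summable_exp[of "16 * r\<^sup>2"] by (simp only: divide_inverse mult.commute)
  moreover have "summable (\<lambda>k. (1 / 4 :: real) ^ k)" by (rule summable_geometric) simp
  ultimately have "summable (\<lambda>k. C * ((16 * r\<^sup>2) ^ k / fact k + (1 / 4) ^ k))"
    by (intro summable_mult summable_add)
  then show "summable (\<lambda>k. coeff_seq x k * z ^ k)"
  proof (rule summable_comparison_test'[where N = 0])
    fix k :: nat
    have f: "sqrt (fact k) > 0" "(sqrt (fact k))\<^sup>2 = fact k" by simp_all
    \<comment> \<open>The term (2 r)^k / sqrt (k!) is a times b, and a b <= a^2 + b^2 bounds it by a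
      term of an exponential series plus one of a geometric series.\<close>
    define a where "a = (4 * r) ^ k / sqrt (fact k)"
    define b where "b = (1 / 2 :: real) ^ k"
    have "0 \<le> a" "0 \<le> b" by (simp_all add: a_def b_def r_def)
    have "norm (coeff_seq x k * z ^ k) = cmod (x k) * (r ^ k / sqrt (fact k))"
      by (simp add: coeff_seq_def norm_mult norm_divide norm_power r_def)
    also have "\<dots> \<le> (C * 2 ^ k) * (r ^ k / sqrt (fact k))"
      by (intro mult_right_mono bound) (simp add: r_def)
    also have "\<dots> = C * (a * b)"
    proof -
      have "(4 * r) ^ k * (1 / 2) ^ k = ((4 * r) * (1 / 2)) ^ k" by (rule power_mult_distrib[symmetric])
      also have "\<dots> = (2 * r) ^ k" by simp
      finally have "a * b = 2 ^ k * r ^ k / sqrt (fact k)"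
        unfolding a_def b_def times_divide_eq_left by (simp only: power_mult_distrib)
      then show ?thesis by simp
    qed
    also have "\<dots> \<le> C * (a\<^sup>2 + b\<^sup>2)"
    proof (rule mult_left_mono[OF _ C])
      have "0 \<le> (a - b)\<^sup>2 + a * b" using \<open>0 \<le> a\<close> \<open>0 \<le> b\<close> by simp
      then have "a * b + a * b \<le> a\<^sup>2 + b\<^sup>2 + a * b"
        by (simp add: power2_eq_square algebra_simps)
      then show "a * b \<le> a\<^sup>2 + b\<^sup>2" by simp
    qed
    also have "a\<^sup>2 = (16 * r\<^sup>2) ^ k / fact k"
    proof -
      have "((4 * r) ^ k)\<^sup>2 = ((4 * r)\<^sup>2) ^ k" by (simp only: power_mult[symmetric] mult.commute)
      then show ?thesis unfolding a_def power_divide f(2) by (simp add: power_mult_distrib)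
    qed
    also have "b\<^sup>2 = (1 / 4) ^ k"
    proof -
      have "((1 / 2 :: real) ^ k)\<^sup>2 = ((1 / 2)\<^sup>2) ^ k" by (simp only: power_mult[symmetric] mult.commute)
      then show ?thesis unfolding b_def by (simp add: power2_eq_square)
    qed
    finally show "norm (coeff_seq x k * z ^ k) \<le> C * ((16 * r\<^sup>2) ^ k / fact k + (1 / 4) ^ k)" .
  qed
qed

section \<open>Law of large numbers and convergence of the series\<close>

context gaussian_seq
begin

definition sq_sum :: "nat \<Rightarrow> 'a \<Rightarrow> real" where
  "sq_sum n \<omega> = (\<Sum>j<n. (cmod (\<xi> j \<omega>))\<^sup>2)"

lemma measurable_sq_sum [measurable]: "sq_sum n \<in> borel_measurable M"
  unfolding sq_sum_def by measurable

lemma nn_integral_exp_sq_sum: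
  assumes "s < 1"
  shows "(\<integral>\<^sup>+\<omega>. ennreal (exp (s * sq_sum n \<omega>)) \<partial>M) = ennreal ((1 / (1 - s)) ^ n)"
proof -
  let ?e = "\<lambda>j \<omega>. ennreal (exp (s * (cmod (\<xi> j \<omega>))\<^sup>2))"
  have "indep_vars (\<lambda>_. borel) (\<lambda>j \<omega>. ?e j \<omega>) UNIV"
    by (rule indep_vars_compose2[OF indep]) measurable
  then have ind: "indep_vars (\<lambda>_. borel) (\<lambda>j \<omega>. ?e j \<omega>) {..<n}"
    by (rule indep_vars_subset) simp
  have "(\<integral>\<^sup>+\<omega>. ennreal (exp (s * sq_sum n \<omega>)) \<partial>M) =
      (\<integral>\<^sup>+\<omega>. (\<Prod>j<n. ?e j \<omega>) \<partial>M)"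
    by (simp add: prod_ennreal sq_sum_def sum_distrib_left exp_sum)
  also have "\<dots> = (\<Prod>j<n. \<integral>\<^sup>+\<omega>. ?e j \<omega> \<partial>M)"
    by (rule indep_vars_nn_integral[OF _ ind]) simp_all
  also have "\<dots> = (\<Prod>j<n. ennreal (1 / (1 - s)))"
  proof (rule prod.cong[OF refl])
    fix j
    have "(\<integral>\<^sup>+\<omega>. ?e j \<omega> \<partial>M) = (\<integral>\<^sup>+z. ennreal (exp (s * (cmod z)\<^sup>2)) \<partial>gauss)"
      by (rule nn_integral_xi[of "\<lambda>z. ennreal (exp (s * (cmod z)\<^sup>2))"]) measurable
    then show "(\<integral>\<^sup>+\<omega>. ?e j \<omega> \<partial>M) = ennreal (1 / (1 - s))"
      using nn_integral_exp_gauss[OF gauss_UNIV assms] by simp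
  qed
  also have "\<dots> = ennreal ((1 / (1 - s)) ^ n)"
    using assms by (simp add: ennreal_power)
  finally show ?thesis .
qed

text \<open>Chernoff bound with the optimal parameter \<open>s = 1 - 1 / a\<close>; it covers both tails, since the
  sign of \<open>s\<close> is that of \<open>a - 1\<close>.\<close>

lemma AE_sq_sum_chernoff:
  assumes "a > 0" "a \<noteq> 1"
  shows "AE \<omega> in M. eventually (\<lambda>n. (1 - 1 / a) * sq_sum n \<omega> < (1 - 1 / a) * (a * real n)) sequentially"
proof -
  define s where "s = 1 - 1 / a"
  have s: "s < 1" "1 / (1 - s) = a" "s * a = a - 1" using assms by (auto simp: s_def field_simps)
  \<comment> \<open>With s = 1 - 1 / a, Markov's bound exp (-s a n) a^n equals q^n; q < 1 because ln
    a < a - 1 for a other than 1.\<close>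
  define q where "q = a * exp (1 - a)"
  have q: "0 < q" "q < 1"
  proof -
    show "0 < q" using assms by (simp add: q_def)
    have "ln a < a - 1"
      using ln_le_minus_one[of a] ln_eq_minus_one[of a] assms by (cases "ln a = a - 1") auto
    then have "exp (ln a + (1 - a)) < exp 0" by (subst exp_less_cancel_iff) simp
    then show "q < 1" using assms by (simp add: q_def exp_add)
  qed
  define A where "A n = {\<omega> \<in> space M. s * sq_sum n \<omega> \<ge> s * (a * real n)}" for n
  have A_meas [measurable]: "A n \<in> sets M" for n unfolding A_def by measurable
  have A_bound: "emeasure M (A n) \<le> ennreal (q ^ n)" for n
  proof -
    have "emeasure M (A n) = (\<integral>\<^sup>+\<omega>. indicator (A n) \<omega> \<partial>M)" by simp
    also have "\<dots> \<le> (\<integral>\<^sup>+\<omega>. ennreal (exp (- (s * (a * real n)))) * ennreal (exp (s * sq_sum n \<omega>)) \<partial>M)"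
    proof (rule nn_integral_mono)
      fix \<omega>
      show "indicator (A n) \<omega> \<le> ennreal (exp (- (s * (a * real n)))) * ennreal (exp (s * sq_sum n \<omega>))"
      proof (cases "\<omega> \<in> A n")
        case True
        then have "1 \<le> exp (- (s * (a * real n)) + s * sq_sum n \<omega>)"
          unfolding one_le_exp_iff by (simp add: A_def)
        then have "ennreal 1 \<le> ennreal (exp (- (s * (a * real n)) + s * sq_sum n \<omega>))" by (rule ennreal_leI)
        also have "\<dots> = ennreal (exp (- (s * (a * real n)))) * ennreal (exp (s * sq_sum n \<omega>))"
          unfolding exp_add by (rule ennreal_mult) simp_all
        finally show ?thesis using True by simp
      qed simp
    qed
    also have "\<dots> = ennreal (exp (- (s * (a * real n)))) * ennreal (a ^ n)"
      using nn_integral_exp_sq_sum[OF s(1), of n] s(2) by (simp add: nn_integral_cmult)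
    also have "\<dots> = ennreal (q ^ n)"
    proof -
      have "- (s * (a * real n)) = real n * (1 - a)"
        by (simp only: mult.assoc[symmetric] s(3)) (simp add: algebra_simps)
      then have "exp (- (s * (a * real n))) = exp (1 - a) ^ n"
        by (simp only: exp_of_nat_mult)
      then show ?thesis using assms by (simp add: q_def power_mult_distrib mult.commute flip: ennreal_mult)
    qed
    finally show ?thesis .
  qed
  have "AE \<omega> in M. eventually (\<lambda>n. \<omega> \<in> space M - A n) sequentially"
  proof (rule borel_cantelli_AE1[OF A_meas])
    show "emeasure M (A n) < \<infinity>" for n by (simp add: emeasure_eq_measure)
    have "measure M (A n) \<le> q ^ n" for n
      using A_bound[of n] q by (simp add: emeasure_eq_measure)
    then show "summable (\<lambda>n. measure M (A n))"
      using q by (intro summable_comparison_test'[OF summable_geometric[of q], of 0]) auto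
  qed
  then show ?thesis
    by (rule AE_mp) (auto intro!: AE_I2 elim!: eventually_mono simp: A_def s_def not_le)
qed

lemma AE_strong_law: "AE \<omega> in M. (\<lambda>n. sq_sum n \<omega> / real n) \<longlonglongrightarrow> 1"
proof -
  let ?P = "\<lambda>a \<omega>. eventually (\<lambda>n. (1 - 1 / a) * sq_sum n \<omega> < (1 - 1 / a) * (a * real n)) sequentially"
  \<comment> \<open>The offset 2 keeps 1 - 1 / (m + 2) positive, as the Chernoff bound needs a >
    0.\<close>
  have "AE \<omega> in M. \<forall>m. ?P (1 + 1 / real (m + 2)) \<omega> \<and> ?P (1 - 1 / real (m + 2)) \<omega>"
    unfolding AE_all_countable
    by (intro allI AE_conjI AE_sq_sum_chernoff) (auto simp: field_simps)
  then show ?thesis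
  proof (rule AE_mp, intro AE_I2 impI)
    fix \<omega> assume *: "\<forall>m. ?P (1 + 1 / real (m + 2)) \<omega> \<and> ?P (1 - 1 / real (m + 2)) \<omega>"
    show "(\<lambda>n. sq_sum n \<omega> / real n) \<longlonglongrightarrow> 1"
    proof (rule tendstoI)
      fix e :: real assume "e > 0"
      obtain m where m: "1 / real (m + 2) < e"
      proof -
        obtain m where "inverse (real (Suc m)) < e" using reals_Archimedean[OF \<open>e > 0\<close>] by blast
        moreover have "1 / real (m + 2) \<le> inverse (real (Suc m))" by (simp add: field_simps)
        ultimately show ?thesis by (intro that[of m]) linarith
      qed
      define d where "d = 1 / real (m + 2)"
      have d: "0 < d" "d < 1" by (simp_all add: d_def)
      have "?P (1 + d) \<omega>" "?P (1 - d) \<omega>" using *[rule_format, of m] by (simp_all add: d_def)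
      moreover have "eventually (\<lambda>n. n > 0) sequentially" by (rule eventually_gt_at_top)
      ultimately show "eventually (\<lambda>n. dist (sq_sum n \<omega> / real n) 1 < e) sequentially"
      proof eventually_elim
        case (elim n)
        have "0 < 1 - 1 / (1 + d)" "1 - 1 / (1 - d) < 0" using d by (simp_all add: field_simps)
        with elim have "sq_sum n \<omega> < (1 + d) * real n" "(1 - d) * real n < sq_sum n \<omega>"
          by (simp_all add: mult_less_cancel_left)
        then have "sq_sum n \<omega> / real n < 1 + d" "1 - d < sq_sum n \<omega> / real n"
          using \<open>n > 0\<close> by (simp_all add: field_simps)
        then show ?case using m by (simp add: dist_real_def d_def abs_less_iff)
      qed
    qed
  qed
qed

text \<open>The law of large numbers bounds |xi_k|^2 by K (k + 1), well within the growth C 2^k that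
  the series tolerates.\<close>

lemma AE_entire: "AE \<omega> in M. entire_seq (X \<omega>)"
  using AE_strong_law
proof (rule AE_mp, intro AE_I2 impI)
  fix \<omega> assume "(\<lambda>n. sq_sum n \<omega> / real n) \<longlonglongrightarrow> 1"
  then have "Bseq (\<lambda>n. sq_sum n \<omega> / real n)" by (rule convergent_imp_Bseq[OF convergentI])
  then obtain K where K: "K > 0" "\<And>n. norm (sq_sum n \<omega> / real n) \<le> K" by (auto elim: BseqE)
  have le: "cmod (\<xi> k \<omega>) \<le> (K + 1) * 2 ^ k" for k
  proof -
    have "(cmod (\<xi> k \<omega>))\<^sup>2 \<le> sq_sum (Suc k) \<omega>"
      by (simp add: sq_sum_def sum_nonneg)
    also have "\<dots> \<le> K * real (Suc k)"
    proof -
      have "sq_sum (Suc k) \<omega> / real (Suc k) \<le> K" using K(2)[of "Suc k"] by (simp only: real_norm_def abs_le_iff)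
      then show ?thesis by (simp add: pos_divide_le_eq)
    qed
    also have "\<dots> \<le> K * 2 ^ k"
    proof -
      have "Suc k \<le> 2 ^ k" by (induction k) auto
      then have "real (Suc k) \<le> real (2 ^ k)" by (simp only: of_nat_le_iff)
      then have "real (Suc k) \<le> 2 ^ k" by simp
      then show ?thesis using K(1) by simp
    qed
    also have "\<dots> \<le> ((K + 1) * 2 ^ k)\<^sup>2"
    proof -
      have "K * 1 \<le> (K + 1) * (K + 1)" using K(1) by (intro mult_mono) auto
      moreover have "(1::real) * 2 ^ k \<le> 2 ^ k * 2 ^ k" by (intro mult_right_mono) auto
      ultimately have "K * 1 * (1 * 2 ^ k) \<le> (K + 1) * (K + 1) * (2 ^ k * 2 ^ k)"
        using K(1) by (intro mult_mono) auto
      then show ?thesis by (simp add: power2_eq_square mult_ac)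
    qed
    finally show ?thesis by (rule power2_le_imp_le) (use K(1) in simp)
  qed
  show "entire_seq (X \<omega>)" by (rule entire_seq_of_bound[of _ "K + 1"]) (rule le)
qed

end

section \<open>Size of the terms of the exponential series\<close>

lemma suminf_le_geometric_tail:
  fixes b :: "nat \<Rightarrow> real"
  assumes nonneg: "\<And>k. 0 \<le> b k" and head: "\<And>k. k \<le> K \<Longrightarrow> b k \<le> B"
    and tail: "\<And>k. k \<ge> K \<Longrightarrow> b (Suc k) \<le> b k / 2"
  shows "summable b" "suminf b \<le> (real K + 2) * B"
proof -
  have geo: "b (j + K) \<le> B * (1 / 2) ^ j" for j
  proof (induction j)
    case 0
    then show ?case using head[of K] by simp
  next
    case (Suc j)
    have "b (Suc j + K) \<le> b (j + K) / 2" using tail[of "j + K"] by simp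
    also have "\<dots> \<le> B * (1 / 2) ^ j / 2" using Suc by simp
    finally show ?case by simp
  qed
  have sg: "summable (\<lambda>j. B * (1 / 2 :: real) ^ j)" by (intro summable_mult summable_geometric) simp
  have st: "summable (\<lambda>j. b (j + K))"
    by (rule summable_comparison_test'[OF sg, of 0]) (use geo nonneg in auto)
  then show sb: "summable b" by (simp only: summable_iff_shift)
  have "suminf b = (\<Sum>j. b (j + K)) + (\<Sum>k<K. b k)" by (rule suminf_split_initial_segment[OF sb])
  also have "(\<Sum>j. b (j + K)) \<le> (\<Sum>j. B * (1 / 2) ^ j)" by (rule suminf_le[OF geo st sg])
  also have "(\<Sum>j. B * (1 / 2) ^ j) = B * 2"
    by (subst suminf_mult) (simp_all add: suminf_geometric summable_geometric)
  also have "(\<Sum>k<K. b k) \<le> (\<Sum>k<K. B)" by (intro sum_mono head) simp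
  finally show "suminf b \<le> (real K + 2) * B" by (simp add: algebra_simps)
qed

text \<open>From k >= 4 r on the terms drop by a factor 4 and their square roots by a factor 2, so
  the sum is at most 4 r + 3 times the largest term. For r = |z|^2 the terms are the squared weights
  of the coefficients in f(z): the second claim feeds the upper bound on |f(z)|, the third picks a
  dominant coefficient.\<close>

lemma exp_series_terms:
  fixes r :: real
  assumes "r \<ge> 0"
  shows "summable (\<lambda>k. sqrt (r ^ k / fact k))"
    and "(\<Sum>k. sqrt (r ^ k / fact k)) \<le> (4 * r + 3) * exp (r / 2)"
    and "\<exists>k. r ^ k / fact k \<ge> exp r / (4 * r + 3)"
proof -
  define T where "T k = r ^ k / fact k" for k
  define K where "K = nat \<lceil>4 * r\<rceil>"
  have K: "real K \<le> 4 * r + 1" using assms unfolding K_def by linarith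
  have T_nonneg: "0 \<le> T k" for k using assms by (simp add: T_def)
  have T_tail: "T (Suc k) \<le> T k / 4" if "k \<ge> K" for k
  proof -
    have "4 * r \<le> real k" using that assms unfolding K_def by linarith
    then have "r / real (Suc k) \<le> 1 / 4" by (simp add: field_simps)
    then have "T k * (r / real (Suc k)) \<le> T k * (1 / 4)" by (intro mult_left_mono T_nonneg)
    moreover have "T (Suc k) = T k * (r / real (Suc k))" by (simp add: T_def field_simps)
    ultimately show ?thesis by simp
  qed
  obtain k0 where k0: "k0 \<le> K" "\<And>k. k \<le> K \<Longrightarrow> T k \<le> T k0"
  proof -
    have "finite (T ` {..K})" "T ` {..K} \<noteq> {}" by auto
    from Max_in[OF this] obtain k0 where k0: "Max (T ` {..K}) = T k0" "k0 \<in> {..K}" by (rule imageE)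
    have "T k \<le> Max (T ` {..K})" if "k \<le> K" for k using that by (intro Max_ge) auto
    then show ?thesis using that[of k0] k0 by simp
  qed
  have T_exp: "T sums exp r"
  proof -
    have "T = (\<lambda>k. r ^ k /\<^sub>R fact k)" by (rule ext) (simp add: T_def divide_inverse mult.commute)
    then show ?thesis using exp_converges[of r] by simp
  qed
  have "T (Suc k) \<le> T k / 2" if "k \<ge> K" for k using T_tail[OF that] T_nonneg[of k] by simp
  from suminf_le_geometric_tail(2)[of T K "T k0", OF T_nonneg k0(2) this]
  have "exp r \<le> (real K + 2) * T k0" using T_exp by (simp add: sums_iff)
  also have "\<dots> \<le> (4 * r + 3) * T k0" using K T_nonneg[of k0] by (intro mult_right_mono) auto
  finally have "exp r / (4 * r + 3) \<le> T k0" using assms by (simp add: pos_divide_le_eq mult.commute)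
  then show "\<exists>k. r ^ k / fact k \<ge> exp r / (4 * r + 3)" by (auto simp: T_def)
  have sqrt_tail: "sqrt (T (Suc k)) \<le> sqrt (T k) / 2" if "k \<ge> K" for k
  proof -
    have "sqrt (T (Suc k)) \<le> sqrt (T k / 4)" using T_tail[OF that] by simp
    also have "\<dots> = sqrt (T k) / 2" by (simp add: real_sqrt_divide)
    finally show ?thesis .
  qed
  have "T k \<le> exp r" for k
    using T_exp T_nonneg sum_le_suminf[of T "{k}"] by (simp add: sums_iff)
  then have sqrt_le: "sqrt (T k) \<le> exp (r / 2)" for k
    by (intro real_le_lsqrt) (simp_all add: T_nonneg flip: exp_double)
  note g = suminf_le_geometric_tail[of "\<lambda>k. sqrt (T k)" K "exp (r / 2)", OF _ sqrt_le sqrt_tail]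
  show "summable (\<lambda>k. sqrt (r ^ k / fact k))" using g(1) T_nonneg by (simp add: T_def)
  have "(\<Sum>k. sqrt (T k)) \<le> (real K + 2) * exp (r / 2)" using g(2) T_nonneg by simp
  also have "\<dots> \<le> (4 * r + 3) * exp (r / 2)" using K by (intro mult_right_mono) auto
  finally show "(\<Sum>k. sqrt (r ^ k / fact k)) \<le> (4 * r + 3) * exp (r / 2)" by (simp add: T_def)
qed

lemma cmod_coeff_power: "cmod (z ^ k / complex_of_real (sqrt (fact k))) = sqrt (((cmod z)\<^sup>2) ^ k / fact k)"
  by (simp add: norm_divide norm_power real_sqrt_divide real_sqrt_power)

text \<open>At a zero of \<open>f\<close> the value is \<open>0\<close>, since \<open>ln 0 = 0\<close>.\<close>

definition log_dev :: "(nat \<Rightarrow> complex) \<Rightarrow> complex \<Rightarrow> real" where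
  "log_dev x z = \<bar>ln (cmod (gfun x z) * exp (- (cmod z)\<^sup>2 / 2))\<bar>"

lemma measurable_log_dev: "(\<lambda>p. log_dev (fst p) (snd p)) \<in> borel_measurable (seqs \<Otimes>\<^sub>M borel)"
proof -
  have "(\<lambda>p. cmod (gfun (fst p) (snd p))) \<in> borel_measurable (seqs \<Otimes>\<^sub>M borel)"
    by (rule measurable_compose[OF measurable_gfun_pair borel_measurable_norm])
  moreover have "(\<lambda>p. exp (- (cmod (snd p))\<^sup>2 / 2)) \<in> borel_measurable (seqs \<Otimes>\<^sub>M borel)"
    by (rule measurable_compose[OF measurable_snd]) measurable
  ultimately have "(\<lambda>p. cmod (gfun (fst p) (snd p)) * exp (- (cmod (snd p))\<^sup>2 / 2)) \<in> borel_measurable (seqs \<Otimes>\<^sub>M borel)"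
    by (rule borel_measurable_times)
  then show ?thesis
    unfolding log_dev_def by (rule measurable_compose[of _ _ _ "\<lambda>y. \<bar>ln y\<bar>"]) measurable
qed

section \<open>First moment of the deviation of log |f| and its mean over circles\<close>

context gaussian_seq
begin

text \<open>Triangle inequality term by term: each |xi_k| has mean at most 2, and
  \<open>exp_series_terms\<close> bounds the sum of the weights.\<close>

lemma nn_integral_cmod_gfun:
  "(\<integral>\<^sup>+\<omega>. ennreal (cmod (gfun (X \<omega>) z)) \<partial>M) \<le> ennreal (2 * (4 * (cmod z)\<^sup>2 + 3) * exp ((cmod z)\<^sup>2 / 2))"
proof -
  define b where "b = (\<lambda>k. sqrt (((cmod z)\<^sup>2) ^ k / fact k))"
  let ?t = "\<lambda>k \<omega>. ennreal (b k) * ennreal (cmod (\<xi> k \<omega>))"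
  have b: "summable b" "(\<Sum>k. b k) \<le> (4 * (cmod z)\<^sup>2 + 3) * exp ((cmod z)\<^sup>2 / 2)" "\<And>k. 0 \<le> b k"
    unfolding b_def by (rule exp_series_terms(1), simp) (rule exp_series_terms(2), simp, simp)
  have norm_term: "cmod (coeff_seq x k * z ^ k) = b k * cmod (x k)" for x k
  proof -
    have "cmod (coeff_seq x k * z ^ k) = cmod (x k) * cmod (z ^ k / complex_of_real (sqrt (fact k)))"
      by (simp add: coeff_seq_def norm_mult norm_divide)
    then show ?thesis unfolding cmod_coeff_power by (simp only: b_def mult.commute)
  qed
  have "(\<integral>\<^sup>+\<omega>. ennreal (cmod (gfun (X \<omega>) z)) \<partial>M) \<le> (\<integral>\<^sup>+\<omega>. (\<Sum>k. ?t k \<omega>) \<partial>M)"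
  proof (rule nn_integral_mono_AE)
    show "AE \<omega> in M. ennreal (cmod (gfun (X \<omega>) z)) \<le> (\<Sum>k. ?t k \<omega>)"
      using AE_entire
    proof (rule AE_mp, intro AE_I2 impI)
      fix \<omega> assume ent: "entire_seq (X \<omega>)"
      have "summable (\<lambda>k. coeff_seq (X \<omega>) k * of_real (cmod z + 1) ^ k)"
        using ent unfolding entire_seq_def by blast
      then have s: "summable (\<lambda>k. cmod (coeff_seq (X \<omega>) k * z ^ k))"
        by (rule powser_insidea) (simp add: norm_of_real[of "cmod z + 1", where ?'a = complex] del: of_real_add)
      have "cmod (gfun (X \<omega>) z) \<le> (\<Sum>k. cmod (coeff_seq (X \<omega>) k * z ^ k))"
        unfolding gfun_def by (rule summable_norm[OF s])
      then have "ennreal (cmod (gfun (X \<omega>) z)) \<le> ennreal (\<Sum>k. cmod (coeff_seq (X \<omega>) k * z ^ k))"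
        by (rule ennreal_leI)
      also have "\<dots> = (\<Sum>k. ennreal (cmod (coeff_seq (X \<omega>) k * z ^ k)))"
        by (rule suminf_ennreal2[OF _ s, symmetric]) simp
      also have "\<dots> = (\<Sum>k. ?t k \<omega>)"
        unfolding norm_term using b(3) by (intro suminf_cong ennreal_mult) simp_all
      finally show "ennreal (cmod (gfun (X \<omega>) z)) \<le> (\<Sum>k. ?t k \<omega>)" .
    qed
  qed
  also have "\<dots> = (\<Sum>k. \<integral>\<^sup>+\<omega>. ?t k \<omega> \<partial>M)"
    by (rule nn_integral_suminf) measurable
  also have "\<dots> \<le> (\<Sum>k. ennreal (b k * 2))"
  proof (intro suminf_le summableI)
    fix k
    have "(\<integral>\<^sup>+\<omega>. ennreal (cmod (\<xi> k \<omega>)) \<partial>M) = (\<integral>\<^sup>+z. ennreal (cmod z) \<partial>gauss)"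
      by (rule nn_integral_xi) measurable
    then have "(\<integral>\<^sup>+\<omega>. ?t k \<omega> \<partial>M) = ennreal (b k) * (\<integral>\<^sup>+z. ennreal (cmod z) \<partial>gauss)"
      by (subst nn_integral_cmult) simp_all
    also have "\<dots> \<le> ennreal (b k) * 2" by (intro mult_left_mono nn_integral_cmod_gauss gauss_UNIV) simp
    also have "\<dots> = ennreal (b k * 2)" using b(3)[of k] by (simp add: ennreal_mult)
    finally show "(\<integral>\<^sup>+\<omega>. ?t k \<omega> \<partial>M) \<le> ennreal (b k * 2)" .
  qed
  also have "\<dots> = ennreal (\<Sum>k. b k * 2)"
    using b by (intro suminf_ennreal2 summable_mult2) simp_all
  also have "(\<Sum>k. b k * 2) = (\<Sum>k. b k) * 2" by (rule suminf_mult2[OF b(1), symmetric])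
  also have "ennreal ((\<Sum>k. b k) * 2) \<le> ennreal (2 * (4 * (cmod z)\<^sup>2 + 3) * exp ((cmod z)\<^sup>2 / 2))"
  proof (rule ennreal_leI)
    have "(\<Sum>k. b k) * 2 \<le> (4 * (cmod z)\<^sup>2 + 3) * exp ((cmod z)\<^sup>2 / 2) * 2"
      by (rule mult_right_mono[OF b(2)]) simp
    then show "(\<Sum>k. b k) * 2 \<le> 2 * (4 * (cmod z)\<^sup>2 + 3) * exp ((cmod z)\<^sup>2 / 2)"
      by (simp only: mult_ac)
  qed
  finally show ?thesis .
qed

text \<open>Positive and negative parts are bounded separately. From above, concavity of ln and the
  first moment of |f(z)| suffice. From below, all coefficients but a dominant one are frozen, and a
  Gaussian variable is rarely close to any given point.\<close>

lemma nn_integral_log_dev: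
  "(\<integral>\<^sup>+\<omega>. ennreal (log_dev (X \<omega>) z) \<partial>M) \<le> ennreal (2 * ln (4 * (cmod z)\<^sup>2 + 3) + 2 + log_const)"
proof -
  define L where "L = 4 * (cmod z)\<^sup>2 + 3"
  define E where "E = exp (- (cmod z)\<^sup>2 / 2)"
  have L: "L \<ge> 1" "ln L \<ge> 0" by (simp_all add: L_def)
  have E: "E > 0" by (simp add: E_def)
  have E_exp: "E * exp ((cmod z)\<^sup>2 / 2) = 1" by (simp add: E_def flip: exp_add)
  have m_gfun: "(\<lambda>\<omega>. gfun (X \<omega>) z) \<in> borel_measurable M"
    by (rule measurable_compose[OF measurable_X measurable_gfun])
  let ?y = "\<lambda>x. cmod (gfun x z) * E"
  let ?p = "\<lambda>\<omega>. ennreal (max 0 (ln (?y (X \<omega>))))" and ?n = "\<lambda>\<omega>. ennreal (max 0 (- ln (?y (X \<omega>))))"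
  let ?g = "\<lambda>\<omega>. cmod (gfun (X \<omega>) z)"
  have m_y: "(\<lambda>x. ?y x) \<in> borel_measurable seqs"
    by (rule borel_measurable_times[OF measurable_compose[OF measurable_gfun borel_measurable_norm] borel_measurable_const])
  have m_yX: "(\<lambda>\<omega>. ?y (X \<omega>)) \<in> borel_measurable M"
    by (rule measurable_compose[OF measurable_X m_y])
  have upper: "(\<integral>\<^sup>+\<omega>. ?p \<omega> \<partial>M) \<le> ennreal (ln L + 2)"
  proof -
    have "(\<integral>\<^sup>+\<omega>. ?p \<omega> \<partial>M) \<le> (\<integral>\<^sup>+\<omega>. ennreal (ln L) + ennreal (E / L) * ennreal (?g \<omega>) \<partial>M)"
    proof (rule nn_integral_mono)
      fix \<omega>
      have "max 0 (ln (?y (X \<omega>))) \<le> ln L + E / L * ?g \<omega>"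
      proof (cases "?y (X \<omega>) > 0")
        case True
        \<comment> \<open>Tangent line of ln at L: the normalised modulus has mean at most 2 L,
          which leads to ln L + 2.\<close>
        have "ln (?y (X \<omega>) / L) \<le> ?y (X \<omega>) / L - 1"
          by (rule ln_le_minus_one) (use True L in simp)
        then have "ln (?y (X \<omega>)) \<le> ln L + ?y (X \<omega>) / L"
          using ln_divide_pos[OF True, of L] L by simp
        moreover have "0 \<le> ln L + ?y (X \<omega>) / L" using True L by simp
        ultimately show ?thesis by (simp add: mult.commute)
      next
        case False
        then have "?y (X \<omega>) = 0" using E by (simp add: mult_le_0_iff zero_less_mult_iff)
        then show ?thesis using L E by simp
      qed
      then have "?p \<omega> \<le> ennreal (ln L + E / L * ?g \<omega>)"
        by (rule ennreal_leI)
      also have "\<dots> = ennreal (ln L) + ennreal (E / L) * ennreal (?g \<omega>)"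
        using L E by (subst ennreal_plus) (simp_all del: times_divide_eq_left add: ennreal_mult[of "E / L"])
      finally show "?p \<omega> \<le> ennreal (ln L) + ennreal (E / L) * ennreal (?g \<omega>)" .
    qed
    also have "\<dots> = ennreal (ln L) + ennreal (E / L) * (\<integral>\<^sup>+\<omega>. ennreal (?g \<omega>) \<partial>M)"
      using m_gfun by (subst nn_integral_add) (auto simp: nn_integral_cmult emeasure_space_1)
    also have "\<dots> \<le> ennreal (ln L) + ennreal (E / L) * ennreal (2 * L * exp ((cmod z)\<^sup>2 / 2))"
      unfolding L_def by (intro add_left_mono mult_left_mono nn_integral_cmod_gfun) simp
    also have "\<dots> = ennreal (ln L + E / L * (2 * L * exp ((cmod z)\<^sup>2 / 2)))"
      using L E by (subst ennreal_plus) (simp_all del: times_divide_eq_left times_divide_eq_right add: ennreal_mult[of "E / L"])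
    also have "E / L * (2 * L * exp ((cmod z)\<^sup>2 / 2)) = 2 * (E * exp ((cmod z)\<^sup>2 / 2))"
      using L by (simp add: field_simps)
    finally show ?thesis by (simp only: E_exp mult_1_right)
  qed
  obtain i where i: "((cmod z)\<^sup>2) ^ i / fact i \<ge> exp ((cmod z)\<^sup>2) / L"
    using exp_series_terms(3)[of "(cmod z)\<^sup>2"] by (auto simp: L_def)
  define c where "c = z ^ i / complex_of_real (sqrt (fact i))"
  \<comment> \<open>At the chosen index the squared weight times exp (-|z|^2) is at least 1 / L, and
    sqrt (1 / L) >= 1 / L since L >= 1.\<close>
  have c: "cmod c * E \<ge> 1 / L"
  proof -
    have "1 / L \<le> sqrt (1 / L)"
      using L by (intro real_le_rsqrt) (simp add: power2_eq_square field_simps)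
    also have "\<dots> = sqrt (exp ((cmod z)\<^sup>2) / L) * E"
    proof -
      have "exp ((cmod z)\<^sup>2) = (exp ((cmod z)\<^sup>2 / 2))\<^sup>2" by (simp flip: exp_double)
      then have "sqrt (exp ((cmod z)\<^sup>2)) = exp ((cmod z)\<^sup>2 / 2)" by simp
      then show ?thesis using E_exp by (simp add: real_sqrt_divide mult.commute)
    qed
    also have "\<dots> \<le> sqrt (((cmod z)\<^sup>2) ^ i / fact i) * E"
      using i E by (intro mult_right_mono) simp_all
    finally show ?thesis by (simp only: c_def cmod_coeff_power)
  qed
  have c0: "c \<noteq> 0" using c L by auto
  have lower: "(\<integral>\<^sup>+\<omega>. ?n \<omega> \<partial>M) \<le> ennreal (ln L + log_const)"
  proof -
    let ?\<Phi> = "\<lambda>x. ennreal (max 0 (- ln (?y x)))"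
    have "(\<lambda>y::real. ennreal (max 0 (- ln y))) \<in> borel_measurable borel" by measurable
    then have "?\<Phi> \<in> borel_measurable seqs" by (rule measurable_compose[OF m_y])
    then have "(\<integral>\<^sup>+\<omega>. ?\<Phi> (X \<omega>) \<partial>M) = (\<integral>\<^sup>+\<omega>. (\<integral>\<^sup>+s. ?\<Phi> ((X \<omega>)(i := s)) \<partial>gauss) \<partial>M)"
      by (rule resample)
    also have "\<dots> \<le> (\<integral>\<^sup>+\<omega>. ennreal (ln L + log_const) \<partial>M)"
    proof (rule nn_integral_mono_AE)
      show "AE \<omega> in M. (\<integral>\<^sup>+s. ?\<Phi> ((X \<omega>)(i := s)) \<partial>gauss) \<le> ennreal (ln L + log_const)"
        using AE_entire
      proof (rule AE_mp, intro AE_I2 impI)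
        fix \<omega> assume ent: "entire_seq (X \<omega>)"
        define w where "w = gfun (X \<omega>) z / c - \<xi> i \<omega>"
        have gfun_eq: "gfun ((X \<omega>)(i := s)) z = c * (s + w)" for s
        proof -
          have "gfun ((X \<omega>)(i := s)) z = gfun (X \<omega>) z + (s - \<xi> i \<omega>) * c"
            using gfun_upd[OF ent, of i s z] by (simp add: c_def)
          moreover have "c * w = gfun (X \<omega>) z - c * \<xi> i \<omega>"
            using c0 by (simp add: w_def right_diff_distrib)
          ultimately show ?thesis by (simp add: distrib_left right_diff_distrib mult.commute[of _ c])
        qed
        have "(\<integral>\<^sup>+s. ?\<Phi> ((X \<omega>)(i := s)) \<partial>gauss) \<le> (\<integral>\<^sup>+s. ennreal (ln L) + ennreal (max 0 (- ln (cmod (s + w)))) \<partial>gauss)"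
        proof (rule nn_integral_mono)
          fix s
          have "max 0 (- ln (?y ((X \<omega>)(i := s)))) \<le> ln L + max 0 (- ln (cmod (s + w)))"
          proof (cases "s + w = 0")
            case True
            then show ?thesis using L unfolding gfun_eq by simp
          next
            case False
            have pos: "cmod c * E > 0" "cmod (s + w) > 0" using c0 E False by simp_all
            have "?y ((X \<omega>)(i := s)) = (cmod c * E) * cmod (s + w)"
              unfolding gfun_eq norm_mult by (simp only: mult_ac)
            then have "ln (?y ((X \<omega>)(i := s))) = ln (cmod c * E) + ln (cmod (s + w))"
              using ln_mult_pos[OF pos] by (simp only:)
            moreover have "ln (1 / L) \<le> ln (cmod c * E)" using c L by (intro ln_mono) auto
            ultimately show ?thesis using L by (simp add: ln_div max_def)
          qed
          then have "?\<Phi> ((X \<omega>)(i := s)) \<le> ennreal (ln L + max 0 (- ln (cmod (s + w))))" by (rule ennreal_leI)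
          also have "\<dots> = ennreal (ln L) + ennreal (max 0 (- ln (cmod (s + w))))"
            using L by (intro ennreal_plus) simp_all
          finally show "?\<Phi> ((X \<omega>)(i := s)) \<le> ennreal (ln L) + ennreal (max 0 (- ln (cmod (s + w))))" .
        qed
        also have "\<dots> = ennreal (ln L) + (\<integral>\<^sup>+s. ennreal (max 0 (- ln (cmod (s + w)))) \<partial>gauss)"
          using gauss_UNIV by (subst nn_integral_add) simp_all
        also have "\<dots> \<le> ennreal (ln L) + ennreal log_const"
          by (intro add_left_mono nn_integral_neg_ln_gauss)
        also have "\<dots> = ennreal (ln L + log_const)"
          using L log_const_nonneg by (intro ennreal_plus[symmetric]) simp_all
        finally show "(\<integral>\<^sup>+s. ?\<Phi> ((X \<omega>)(i := s)) \<partial>gauss) \<le> ennreal (ln L + log_const)" .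
      qed
    qed
    also have "\<dots> = ennreal (ln L + log_const)" by (simp add: emeasure_space_1)
    finally show ?thesis .
  qed
  have "(\<integral>\<^sup>+\<omega>. ennreal (log_dev (X \<omega>) z) \<partial>M) =
      (\<integral>\<^sup>+\<omega>. ?p \<omega> + ?n \<omega> \<partial>M)"
  proof (rule nn_integral_cong)
    fix \<omega>
    have "\<bar>t\<bar> = max 0 t + max 0 (- t)" for t :: real by simp
    then have "log_dev (X \<omega>) z = max 0 (ln (?y (X \<omega>))) + max 0 (- ln (?y (X \<omega>)))"
      unfolding log_dev_def E_def by blast
    then show "ennreal (log_dev (X \<omega>) z) = ?p \<omega> + ?n \<omega>"
      by (simp only: ennreal_plus max.cobounded1)
  qed
  also have "\<dots> = (\<integral>\<^sup>+\<omega>. ?p \<omega> \<partial>M) + (\<integral>\<^sup>+\<omega>. ?n \<omega> \<partial>M)"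
  proof (rule nn_integral_add)
    show "?p \<in> borel_measurable M"
      by (rule measurable_compose[OF m_yX]) measurable
    show "?n \<in> borel_measurable M"
      by (rule measurable_compose[OF m_yX]) measurable
  qed
  also have "\<dots> \<le> ennreal (ln L + 2) + ennreal (ln L + log_const)"
    by (rule add_mono[OF upper lower])
  also have "\<dots> = ennreal (2 * ln L + 2 + log_const)"
    using L log_const_nonneg by (subst ennreal_plus[symmetric]) simp_all
  finally show ?thesis by (simp only: L_def)
qed

text \<open>\<open>circlepath 0 R\<close> runs round the circle once over [0, 1], so this is already
  the mean. It is \<open>ennreal\<close>-valued because finiteness is established only almost
  surely.\<close>

definition circle_dev :: "real \<Rightarrow> 'a \<Rightarrow> ennreal" where
  "circle_dev R \<omega> = (\<integral>\<^sup>+t. ennreal (log_dev (X \<omega>) (circlepath 0 R t)) * indicator {0..1} t \<partial>lborel)"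

lemma measurable_log_dev_circle:
  "(\<lambda>p. ennreal (log_dev (X (fst p)) (circlepath 0 R (snd p))) * indicator {0..1} (snd p))
    \<in> borel_measurable (M \<Otimes>\<^sub>M lborel)"
proof -
  have "(\<lambda>t. circlepath 0 R t) \<in> borel_measurable borel"
    unfolding circlepath by (intro borel_measurable_continuous_onI continuous_intros)
  then have "(\<lambda>p. circlepath 0 R (snd p)) \<in> borel_measurable (M \<Otimes>\<^sub>M lborel)"
    by (intro measurable_compose[OF measurable_snd]) simp
  then have "(\<lambda>p. (X (fst p), circlepath 0 R (snd p))) \<in> measurable (M \<Otimes>\<^sub>M lborel) (seqs \<Otimes>\<^sub>M borel)"
    by (rule measurable_Pair[OF measurable_compose[OF measurable_fst measurable_X]])
  from measurable_compose[OF this measurable_log_dev]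
  have "(\<lambda>p. log_dev (X (fst p)) (circlepath 0 R (snd p))) \<in> borel_measurable (M \<Otimes>\<^sub>M lborel)"
    by (simp only: fst_conv snd_conv)
  from measurable_compose[OF this measurable_ennreal]
  have m: "(\<lambda>p. ennreal (log_dev (X (fst p)) (circlepath 0 R (snd p)))) \<in> borel_measurable (M \<Otimes>\<^sub>M lborel)" .
  have "(\<lambda>p. indicator {0..1} (snd p) :: ennreal) \<in> borel_measurable (M \<Otimes>\<^sub>M (lborel :: real measure))"
    by (rule measurable_compose[OF measurable_snd borel_measurable_indicator]) simp
  with m show ?thesis by (rule borel_measurable_times_ennreal)
qed

lemma measurable_circle_dev: "circle_dev R \<in> borel_measurable M"
  unfolding circle_dev_def
  using lborel.borel_measurable_nn_integral_fst[OF measurable_log_dev_circle[of R]] by simp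

lemma nn_integral_circle_dev:
  assumes "R \<ge> 0"
  shows "(\<integral>\<^sup>+\<omega>. circle_dev R \<omega> \<partial>M) \<le> ennreal (2 * ln (4 * R\<^sup>2 + 3) + 2 + log_const)"
proof -
  interpret PL: pair_sigma_finite M lborel ..
  let ?C = "ennreal (2 * ln (4 * R\<^sup>2 + 3) + 2 + log_const)"
  let ?f = "\<lambda>\<omega> t. ennreal (log_dev (X \<omega>) (circlepath 0 R t)) * indicator {0..1} t"
  have "(\<integral>\<^sup>+\<omega>. circle_dev R \<omega> \<partial>M) = (\<integral>\<^sup>+t. (\<integral>\<^sup>+\<omega>. ?f \<omega> t \<partial>M) \<partial>lborel)"
    unfolding circle_dev_def
    by (rule PL.Fubini'[symmetric]) (use measurable_log_dev_circle[of R] in \<open>simp add: case_prod_beta'\<close>)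
  also have "\<dots> \<le> (\<integral>\<^sup>+t. ?C * indicator {0..1::real} t \<partial>lborel)"
  proof (rule nn_integral_mono)
    fix t :: real
    have norm_c: "cmod (circlepath 0 R t) = R" using assms by (simp add: circlepath norm_mult)
    have m: "(\<lambda>\<omega>. ennreal (log_dev (X \<omega>) (circlepath 0 R t))) \<in> borel_measurable M"
    proof -
      have "(\<lambda>\<omega>. (X \<omega>, circlepath 0 R t)) \<in> measurable M (seqs \<Otimes>\<^sub>M borel)"
        by (intro measurable_Pair measurable_X measurable_const) simp
      from measurable_compose[OF measurable_compose[OF this measurable_log_dev] measurable_ennreal]
      show ?thesis by (simp only: fst_conv snd_conv)
    qed
    have "(\<integral>\<^sup>+\<omega>. ?f \<omega> t \<partial>M) = (\<integral>\<^sup>+\<omega>. ennreal (log_dev (X \<omega>) (circlepath 0 R t)) \<partial>M) * indicator {0..1} t"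
      by (rule nn_integral_multc[OF m])
    also have "\<dots> \<le> ?C * indicator {0..1} t"
      using nn_integral_log_dev[of "circlepath 0 R t"] by (intro mult_right_mono) (simp_all add: norm_c)
    finally show "(\<integral>\<^sup>+\<omega>. ?f \<omega> t \<partial>M) \<le> ?C * indicator {0..1} t" .
  qed
  also have "\<dots> = ?C" by (subst nn_integral_cmult_indicator) simp_all
  finally show ?thesis .
qed

text \<open>The expectation is O(log R), so the expected sum over n of the deviations divided by 2^n
  is finite. The sum is then finite almost surely, and its terms are finite and tend to 0. Dividing
  by R alone serves all orders k >= 1.\<close>

lemma AE_circle_dev:
  "AE \<omega> in M. (\<forall>n. circle_dev (2 ^ n) \<omega> \<noteq> top) \<and> (\<lambda>n. enn2real (circle_dev (2 ^ n) \<omega>) / 2 ^ n) \<longlonglongrightarrow> 0"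
proof -
  let ?g = "\<lambda>n \<omega>. circle_dev (2 ^ n) \<omega> * ennreal (1 / 2 ^ n)"
  have m: "?g n \<in> borel_measurable M" for n
    by (intro borel_measurable_times_ennreal measurable_circle_dev borel_measurable_const)
  \<comment> \<open>The constants come from ln (4 R^2 + 3) <= ln 7 + n ln 4 <= 7 + 4 n at R = 2^n,
    rounded up generously.\<close>
  define B where "B n = (30 + 8 * real n + log_const) / 2 ^ n" for n
  have B_nonneg: "0 \<le> B n" for n using log_const_nonneg by (simp add: B_def)
  have B: "(\<integral>\<^sup>+\<omega>. ?g n \<omega> \<partial>M) \<le> ennreal (B n)" for n
  proof -
    have "ln (4 * (2 ^ n)\<^sup>2 + 3) \<le> 7 + real n * 4"
    proof -
      have "(4::real) * (2 ^ n)\<^sup>2 + 3 \<le> 7 * 4 ^ n"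
        by (simp add: power2_eq_square flip: power_mult_distrib)
      then have "ln (4 * (2 ^ n)\<^sup>2 + 3) \<le> ln (7 * 4 ^ n :: real)"
        by (intro ln_mono) (auto intro: add_nonneg_pos)
      also have "\<dots> = ln 7 + real n * ln 4" by (subst ln_mult) (simp_all add: ln_realpow)
      also have "\<dots> \<le> 7 + real n * 4"
        using ln_le_minus_one[of 7] ln_le_minus_one[of "4::real"] by (intro add_mono mult_left_mono) auto
      finally show ?thesis .
    qed
    then have le: "2 * ln (4 * (2 ^ n)\<^sup>2 + 3) + 2 + log_const \<le> 30 + 8 * real n + log_const" by simp
    have "(\<integral>\<^sup>+\<omega>. ?g n \<omega> \<partial>M) = (\<integral>\<^sup>+\<omega>. circle_dev (2 ^ n) \<omega> \<partial>M) * ennreal (1 / 2 ^ n)"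
      by (rule nn_integral_multc[OF measurable_circle_dev])
    also have "\<dots> \<le> ennreal (30 + 8 * real n + log_const) * ennreal (1 / 2 ^ n)"
      by (rule mult_right_mono[OF order_trans[OF nn_integral_circle_dev ennreal_leI[OF le]]]) simp_all
    also have "\<dots> = ennreal (B n)"
      using log_const_nonneg by (subst ennreal_mult[symmetric]) (simp_all add: B_def)
    finally show ?thesis .
  qed
  have "summable B"
  proof -
    have "summable (\<lambda>n. (30 + log_const) * (1 / 2) ^ n + 8 * (real n * (1 / 2) ^ n))"
    proof (intro summable_add summable_mult summable_geometric)
      have "summable (\<lambda>n. of_nat (Suc n) * (1 / 2 :: real) ^ n)"
        by (rule sums_summable[OF geometric_deriv_sums]) simp
      then show "summable (\<lambda>n. real n * (1 / 2) ^ n)"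
        by (rule summable_comparison_test'[where N = 0]) simp
    qed simp
    moreover have "B = (\<lambda>n. (30 + log_const) * (1 / 2) ^ n + 8 * (real n * (1 / 2) ^ n))"
      by (rule ext) (simp add: B_def power_divide add_divide_distrib distrib_right)
    ultimately show ?thesis by (simp only:)
  qed
  have "(\<integral>\<^sup>+\<omega>. (\<Sum>n. ?g n \<omega>) \<partial>M) = (\<Sum>n. \<integral>\<^sup>+\<omega>. ?g n \<omega> \<partial>M)"
    using m by (rule nn_integral_suminf[of "\<lambda>n \<omega>. ?g n \<omega>" M])
  also have "\<dots> \<le> (\<Sum>n. ennreal (B n))" by (rule suminf_le[OF B summableI summableI])
  also have "\<dots> = ennreal (suminf B)" by (rule suminf_ennreal2[OF B_nonneg \<open>summable B\<close>])
  finally have "(\<integral>\<^sup>+\<omega>. (\<Sum>n. ?g n \<omega>) \<partial>M) \<noteq> \<infinity>"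
    unfolding infinity_ennreal_def by (rule neq_top_trans[OF ennreal_neq_top])
  moreover have "(\<lambda>\<omega>. \<Sum>n. ?g n \<omega>) \<in> borel_measurable M" by (rule borel_measurable_suminf_order[OF m])
  ultimately have "AE \<omega> in M. (\<Sum>n. ?g n \<omega>) \<noteq> \<infinity>" by (intro nn_integral_PInf_AE)
  then show ?thesis
  proof (rule AE_mp, intro AE_I2 impI)
    fix \<omega> assume fin: "(\<Sum>n. ?g n \<omega>) \<noteq> \<infinity>"
    have "?g n \<omega> \<le> (\<Sum>n. ?g n \<omega>)" for n
      using sum_le_suminf[of "\<lambda>n. ?g n \<omega>" "{n}"] by simp
    then have g_fin: "?g n \<omega> \<noteq> top" for n
      using neq_top_trans[OF fin[unfolded infinity_ennreal_def]] by blast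
    have nt: "circle_dev (2 ^ n) \<omega> \<noteq> top" for n
    proof
      assume "circle_dev (2 ^ n) \<omega> = top"
      then have "?g n \<omega> = top" by (simp add: ennreal_top_mult)
      with g_fin[of n] show False by blast
    qed
    let ?d = "\<lambda>n. enn2real (circle_dev (2 ^ n) \<omega>)"
    have eq: "?g n \<omega> = ennreal (?d n / 2 ^ n)" for n
    proof -
      have "?g n \<omega> = ennreal (?d n) * ennreal (1 / 2 ^ n)"
        using nt[of n] by (simp add: less_top)
      also have "\<dots> = ennreal (?d n * (1 / 2 ^ n))"
        by (rule ennreal_mult[symmetric]) simp_all
      finally show ?thesis by simp
    qed
    have "summable (\<lambda>n. ?d n / 2 ^ n)"
    proof (rule summable_suminf_not_top)
      show "(\<Sum>n. ennreal (?d n / 2 ^ n)) \<noteq> top"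
        using fin unfolding eq infinity_ennreal_def .
    qed simp
    then show "(\<forall>n. circle_dev (2 ^ n) \<omega> \<noteq> top) \<and> (\<lambda>n. enn2real (circle_dev (2 ^ n) \<omega>) / 2 ^ n) \<longlonglongrightarrow> 0"
      using nt summable_LIMSEQ_zero by blast
  qed
qed

end

section \<open>Invariance under rotations\<close>

lemma cis_add_2pi: "cis (t + 2 * pi) = cis t"
  by (simp add: cis_mult[symmetric])

lemma nn_integral_shift_interval:
  assumes [measurable]: "f \<in> borel_measurable (borel :: real measure)"
  shows "(\<integral>\<^sup>+t. f (t + c) * indicator {a..<b} t \<partial>lborel) = (\<integral>\<^sup>+t. f t * indicator {a + c..<b + c} t \<partial>lborel)"
proof -
  have "(\<integral>\<^sup>+t. f t * indicator {a + c..<b + c} t \<partial>lborel) =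
      (\<integral>\<^sup>+t. f (t + c) * indicator {a + c..<b + c} (t + c) \<partial>lborel)"
    by (rule nn_integral_lborel_translate[of "\<lambda>t. f t * indicator {a + c..<b + c} t" c, symmetric]) measurable
  also have "\<dots> = (\<integral>\<^sup>+t. f (t + c) * indicator {a..<b} t \<partial>lborel)"
    by (intro nn_integral_cong) (auto simp: indicator_def)
  finally show ?thesis by simp
qed

text \<open>Cut the shifted interval at p and move the overhang back by one period.\<close>

lemma nn_integral_periodic_shift:
  assumes [measurable]: "f \<in> borel_measurable (borel :: real measure)"
    and periodic: "\<And>t. f (t + p) = f t" and c: "0 \<le> c" "c \<le> p"
  shows "(\<integral>\<^sup>+t. f (t + c) * indicator {0..<p} t \<partial>lborel) = (\<integral>\<^sup>+t. f t * indicator {0..<p} t \<partial>lborel)"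
proof -
  have "(\<integral>\<^sup>+t. f (t + c) * indicator {0..<p} t \<partial>lborel) = (\<integral>\<^sup>+t. f t * indicator {c..<p + c} t \<partial>lborel)"
    using nn_integral_shift_interval[of f c 0 p] by simp
  also have "\<dots> = (\<integral>\<^sup>+t. f t * indicator {c..<p} t + f t * indicator {p..<p + c} t \<partial>lborel)"
    using c by (intro nn_integral_cong) (auto simp: indicator_def)
  also have "\<dots> = (\<integral>\<^sup>+t. f t * indicator {c..<p} t \<partial>lborel) + (\<integral>\<^sup>+t. f t * indicator {p..<p + c} t \<partial>lborel)"
    by (rule nn_integral_add) measurable
  also have "(\<integral>\<^sup>+t. f t * indicator {p..<p + c} t \<partial>lborel) = (\<integral>\<^sup>+t. f (t + p) * indicator {0..<c} t \<partial>lborel)"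
    using nn_integral_shift_interval[of f p 0 c] by (simp add: add.commute)
  also have "\<dots> = (\<integral>\<^sup>+t. f t * indicator {0..<c} t \<partial>lborel)" by (simp only: periodic)
  also have "(\<integral>\<^sup>+t. f t * indicator {c..<p} t \<partial>lborel) + (\<integral>\<^sup>+t. f t * indicator {0..<c} t \<partial>lborel) =
      (\<integral>\<^sup>+t. f t * indicator {c..<p} t + f t * indicator {0..<c} t \<partial>lborel)"
    by (rule nn_integral_add[symmetric]) measurable
  also have "\<dots> = (\<integral>\<^sup>+t. f t * indicator {0..<p} t \<partial>lborel)"
    using c by (intro nn_integral_cong) (auto simp: indicator_def)
  finally show ?thesis .
qed

lemma measurable_cis: "cis \<in> borel_measurable borel"
  by (intro borel_measurable_continuous_onI continuous_intros)

text \<open>Dropping the endpoint 2 pi, a null set, leaves a half-open period to which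
  \<open>nn_integral_periodic_shift\<close> applies.\<close>

lemma emeasure_uniform_circle:
  assumes A: "A \<in> sets borel"
  shows "emeasure uniform_circle A =
    (\<integral>\<^sup>+t. indicator A (cis t) * indicator {0..<2 * pi} t \<partial>lborel) / ennreal (2 * pi)"
proof -
  have pre: "cis -` A \<in> sets borel"
    using measurable_sets[OF measurable_cis A] by simp
  have "emeasure uniform_circle A = emeasure (uniform_measure lborel {0..2 * pi}) (cis -` A)"
    unfolding uniform_circle_def using measurable_cis A
    by (subst emeasure_distr) (simp_all add: uniform_measure_def)
  also have "\<dots> = emeasure lborel ({0..2 * pi} \<inter> cis -` A) / emeasure lborel {0..2 * pi}"
    by (rule emeasure_uniform_measure) (use pre in simp_all)
  also have "emeasure lborel {0..2 * pi} = ennreal (2 * pi)" by simp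
  also have "emeasure lborel ({0..2 * pi} \<inter> cis -` A) = (\<integral>\<^sup>+t. indicator ({0..2 * pi} \<inter> cis -` A) t \<partial>lborel)"
    using pre by (intro nn_integral_indicator[symmetric]) simp
  also have "\<dots> = (\<integral>\<^sup>+t. indicator A (cis t) * indicator {0..<2 * pi} t \<partial>lborel)"
  proof (rule nn_integral_cong_AE)
    have "AE t in lborel. t \<noteq> 2 * pi" by (rule AE_lborel_singleton)
    then show "AE t in lborel. indicator ({0..2 * pi} \<inter> cis -` A) t = (indicator A (cis t) * indicator {0..<2 * pi} t :: ennreal)"
      by (rule AE_mp) (auto intro!: AE_I2 simp: indicator_def)
  qed
  finally show ?thesis .
qed

lemma uniform_circle_rotate:
  assumes A: "A \<in> sets borel" and v: "cmod v = 1"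
  shows "(\<integral>\<^sup>+t. indicator A (cis t * v) * indicator {0..<2 * pi} t \<partial>lborel) / ennreal (2 * pi) =
    emeasure uniform_circle A"
proof -
  obtain c where c: "0 \<le> c" "c < 2 * pi" "v = cis c"
  proof -
    have v': "v = cis (Arg2pi v)" using Arg2pi_eq[of v] v by (simp add: cis_conv_exp mult.commute)
    show ?thesis by (rule that[OF _ _ v']) (simp_all add: Arg2pi_ge_0 Arg2pi_lt_2pi)
  qed
  let ?f = "\<lambda>t. indicator A (cis t) :: ennreal"
  have m: "?f \<in> borel_measurable borel"
    by (rule measurable_compose[OF measurable_cis borel_measurable_indicator[OF A]])
  have "(\<integral>\<^sup>+t. ?f (t + c) * indicator {0..<2 * pi} t \<partial>lborel) = (\<integral>\<^sup>+t. ?f t * indicator {0..<2 * pi} t \<partial>lborel)"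
    by (rule nn_integral_periodic_shift[OF m]) (use c in \<open>simp_all add: cis_add_2pi\<close>)
  then show ?thesis by (simp only: emeasure_uniform_circle[OF A] c(3) cis_mult)
qed

lemma coeff_seq_scale: "coeff_seq (\<lambda>k. u * x k) k = u * coeff_seq x k"
  by (simp add: coeff_seq_def)

lemma entire_seq_scale:
  assumes "u \<noteq> 0"
  shows "entire_seq (\<lambda>k. u * x k) \<longleftrightarrow> entire_seq x"
proof -
  have "summable (\<lambda>k. coeff_seq (\<lambda>k. u * x k) k * z ^ k) \<longleftrightarrow> summable (\<lambda>k. coeff_seq x k * z ^ k)" for z
    unfolding coeff_seq_scale mult.assoc using assms by (simp add: summable_cmult_iff)
  then show ?thesis by (simp only: entire_seq_def)
qed

lemma gfun_scale:
  assumes "entire_seq x"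
  shows "gfun (\<lambda>k. u * x k) z = u * gfun x z"
  unfolding gfun_def coeff_seq_scale mult.assoc
  using assms by (intro suminf_mult) (simp add: entire_seq_def)

lemma zeros_scale:
  assumes "u \<noteq> 0"
  shows "zeros (\<lambda>k. u * x k) = zeros x"
  using assms entire_seq_scale[OF assms, of x] gfun_scale[of x u] by (simp add: zeros_def)

section \<open>Independence of the phase and the zeros\<close>

context gaussian_seq
begin

text \<open>By independence the joint law is the product of the laws of the coefficients, and each
  of them is invariant by \<open>gauss_rotation\<close>.\<close>

lemma law_rotation:
  assumes u: "cmod u = 1"
  shows "distr M seqs (\<lambda>\<omega> k. u * \<xi> k \<omega>) = distr M seqs X"
proof -
  have rv: "(\<lambda>\<omega>. u * \<xi> k \<omega>) \<in> borel_measurable M" for k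
    by (intro borel_measurable_times borel_measurable_const measurable_xi)
  have mult: "(*) u \<in> borel_measurable borel"
    by (intro borel_measurable_times borel_measurable_const measurable_ident_sets) simp
  have "indep_vars (\<lambda>_. borel) (\<lambda>k \<omega>. (*) u (\<xi> k \<omega>)) UNIV"
    by (rule indep_vars_compose2[OF indep]) (rule mult)
  then have "distr M seqs (\<lambda>\<omega>. \<lambda>k\<in>UNIV. u * \<xi> k \<omega>) = PiM UNIV (\<lambda>k. distr M borel (\<lambda>\<omega>. u * \<xi> k \<omega>))"
    using indep_vars_iff_distr_eq_PiM'[of UNIV "\<lambda>k \<omega>. u * \<xi> k \<omega>" "\<lambda>_. borel"] rv by simp
  moreover have "distr M seqs (\<lambda>\<omega>. \<lambda>k\<in>UNIV. \<xi> k \<omega>) = PiM UNIV (\<lambda>k. distr M borel (\<xi> k))"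
    using indep_vars_iff_distr_eq_PiM'[of UNIV \<xi> "\<lambda>_. borel"] indep measurable_xi by simp
  moreover have "distr M borel (\<lambda>\<omega>. u * \<xi> k \<omega>) = distr M borel (\<xi> k)" for k
  proof -
    have "distr M borel (\<lambda>\<omega>. u * \<xi> k \<omega>) = distr (distr M borel (\<xi> k)) borel ((*) u)"
      by (subst distr_distr[OF mult measurable_xi]) (simp add: comp_def)
    then show ?thesis by (simp only: law gauss_rotation[OF u])
  qed
  ultimately show ?thesis by (simp add: restrict_def)
qed

text \<open>This is the variable zeta of the theorem. It takes the value 0 where
  \<open>\<xi> 0\<close> vanishes, which is a null event.\<close>

definition phase :: "'a \<Rightarrow> complex" where
  "phase \<omega> = \<xi> 0 \<omega> / complex_of_real (cmod (\<xi> 0 \<omega>))"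

lemma measurable_unit_vector: "(\<lambda>z. z / complex_of_real (cmod z)) \<in> borel_measurable borel"
  by measurable

lemma measurable_phase: "phase \<in> borel_measurable M"
  unfolding phase_def by (rule measurable_compose[OF measurable_xi measurable_unit_vector])

text \<open>Multiplying all coefficients by \<open>cis t\<close> preserves the law and moves only
  the phase. Average over t and exchange the integrals: the inner integral gives the uniform measure
  of A for every phase of modulus 1. Taking E to be everything yields the uniform law, general E the
  independence.\<close>

lemma emeasure_phase_zeros:
  assumes A: "A \<in> sets borel" and E: "E \<in> sets configs"
  shows "emeasure M {\<omega> \<in> space M. phase \<omega> \<in> A \<and> zeros (X \<omega>) \<in> E} =
    emeasure uniform_circle A * emeasure M {\<omega> \<in> space M. zeros (X \<omega>) \<in> E}"
proof -
  let ?A = "\<lambda>t \<omega>. indicator A (cis t * phase \<omega>) :: ennreal"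
  let ?T = "\<lambda>t. indicator {0..<2 * pi} t :: ennreal"
  let ?Z = "\<lambda>\<omega>. indicator E (zeros (X \<omega>)) :: ennreal"
  let ?P = "M \<Otimes>\<^sub>M (lborel :: real measure)"
  define ph :: "(nat \<Rightarrow> complex) \<Rightarrow> complex" where "ph x = x 0 / complex_of_real (cmod (x 0))" for x
  have m_ph: "ph \<in> borel_measurable seqs"
  proof -
    have "(\<lambda>x. x 0) \<in> borel_measurable seqs" by (rule measurable_component_singleton[OF UNIV_I])
    from measurable_compose[OF this measurable_unit_vector] show ?thesis by (simp only: ph_def[abs_def])
  qed
  let ?D = "\<lambda>x. indicator A (ph x) * indicator E (zeros x) :: ennreal"
  have m_zeros: "(\<lambda>x. indicator E (zeros x)) \<in> borel_measurable seqs"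
    by (rule measurable_compose[OF measurable_zeros borel_measurable_indicator[OF E]])
  have m_D: "?D \<in> borel_measurable seqs"
    by (rule borel_measurable_times_ennreal[OF measurable_compose[OF m_ph borel_measurable_indicator[OF A]] m_zeros])
  have m_uX: "(\<lambda>\<omega> k. u * \<xi> k \<omega>) \<in> measurable M seqs" for u
    by (rule measurable_PiM_single')
      (auto intro!: borel_measurable_times borel_measurable_const measurable_xi)
  have m_EX: "(\<lambda>\<omega>. ?Z \<omega>) \<in> borel_measurable M"
    by (rule measurable_compose[OF measurable_X m_zeros])
  have rot: "(\<integral>\<^sup>+\<omega>. ?D (X \<omega>) \<partial>M) = (\<integral>\<^sup>+\<omega>. indicator A (u * phase \<omega>) * ?Z \<omega> \<partial>M)"
    if u: "cmod u = 1" for u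
  proof -
    have "(\<integral>\<^sup>+\<omega>. ?D (X \<omega>) \<partial>M) = (\<integral>\<^sup>+x. ?D x \<partial>distr M seqs X)"
      by (rule nn_integral_distr[symmetric, OF measurable_X]) (simp only: measurable_distr_eq1 m_D)
    also have "\<dots> = (\<integral>\<^sup>+x. ?D x \<partial>distr M seqs (\<lambda>\<omega> k. u * \<xi> k \<omega>))"
      by (simp only: law_rotation[OF u])
    also have "\<dots> = (\<integral>\<^sup>+\<omega>. ?D (\<lambda>k. u * \<xi> k \<omega>) \<partial>M)"
      by (rule nn_integral_distr[OF m_uX]) (simp only: measurable_distr_eq1 m_D)
    also have "\<dots> = (\<integral>\<^sup>+\<omega>. indicator A (u * phase \<omega>) * ?Z \<omega> \<partial>M)"
    proof (rule nn_integral_cong)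
      fix \<omega>
      have "u \<noteq> 0" using u by auto
      then have "zeros (\<lambda>k. u * \<xi> k \<omega>) = zeros (X \<omega>)" by (rule zeros_scale)
      moreover have "ph (\<lambda>k. u * \<xi> k \<omega>) = u * phase \<omega>"
        by (simp add: ph_def phase_def norm_mult u)
      ultimately show "?D (\<lambda>k. u * \<xi> k \<omega>) = indicator A (u * phase \<omega>) * ?Z \<omega>"
        by (simp only:)
    qed
    finally show ?thesis .
  qed
  let ?I = "\<integral>\<^sup>+\<omega>. ?D (X \<omega>) \<partial>M"
  let ?J = "\<integral>\<^sup>+\<omega>. ?Z \<omega> \<partial>M" and ?u = "emeasure uniform_circle A"
  let ?SA = "{\<omega> \<in> space M. phase \<omega> \<in> A}" and ?SE = "{\<omega> \<in> space M. zeros (X \<omega>) \<in> E}"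
  interpret PL: pair_sigma_finite M lborel ..
  have m_pair: "(\<lambda>p. (?A (snd p) (fst p) * ?T (snd p)) * ?Z (fst p) :: ennreal)
      \<in> borel_measurable ?P"
  proof (intro borel_measurable_times_ennreal)
    have "(\<lambda>p. cis (snd p) * phase (fst p)) \<in> borel_measurable ?P"
      by (intro borel_measurable_times measurable_compose[OF measurable_fst measurable_phase]
          measurable_compose[OF measurable_snd]) (simp add: measurable_cis)
    then show "(\<lambda>p. ?A (snd p) (fst p)) \<in> borel_measurable ?P"
      by (rule measurable_compose[OF _ borel_measurable_indicator[OF A]])
    show "(\<lambda>p. ?T (snd p)) \<in> borel_measurable ?P"
      by (rule measurable_compose[OF measurable_snd borel_measurable_indicator]) simp
    show "(\<lambda>p. ?Z (fst p)) \<in> borel_measurable ?P"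
      by (rule measurable_compose[OF measurable_fst m_EX])
  qed
  have "?I * ennreal (2 * pi) = (\<integral>\<^sup>+t. ?I * ?T t \<partial>lborel)"
    by (subst nn_integral_cmult_indicator) simp_all
  also have "\<dots> = (\<integral>\<^sup>+t. (\<integral>\<^sup>+\<omega>. (?A t \<omega> * ?T t) * ?Z \<omega> \<partial>M) \<partial>lborel)"
  proof (rule nn_integral_cong)
    fix t :: real
    have m: "(\<lambda>\<omega>. ?A t \<omega> * ?Z \<omega>) \<in> borel_measurable M"
    proof (rule borel_measurable_times_ennreal[OF _ m_EX])
      have "(\<lambda>\<omega>. cis t * phase \<omega>) \<in> borel_measurable M"
        by (intro borel_measurable_times borel_measurable_const measurable_phase)
      then show "(\<lambda>\<omega>. ?A t \<omega>) \<in> borel_measurable M"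
        by (rule measurable_compose[OF _ borel_measurable_indicator[OF A]])
    qed
    have "?I * ?T t = (\<integral>\<^sup>+\<omega>. (?A t \<omega> * ?Z \<omega>) * ?T t \<partial>M)"
      using rot[of "cis t"] nn_integral_multc[OF m, of "?T t"] by simp
    then show "?I * ?T t = (\<integral>\<^sup>+\<omega>. (?A t \<omega> * ?T t) * ?Z \<omega> \<partial>M)"
      by (simp only: mult_ac)
  qed
  also have "\<dots> = (\<integral>\<^sup>+\<omega>. (\<integral>\<^sup>+t. (?A t \<omega> * ?T t) * ?Z \<omega> \<partial>lborel) \<partial>M)"
    by (rule PL.Fubini') (use m_pair in \<open>simp only: case_prod_beta'\<close>)
  also have "\<dots> = (\<integral>\<^sup>+\<omega>. (?u * ennreal (2 * pi)) * ?Z \<omega> \<partial>M)"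
  proof (rule nn_integral_cong_AE, rule AE_mp[OF AE_X0_nonzero], intro AE_I2 impI)
    fix \<omega> assume "\<xi> 0 \<omega> \<noteq> 0"
    then have ph1: "cmod (phase \<omega>) = 1" by (simp add: phase_def norm_divide)
    have m: "(\<lambda>t. ?A t \<omega> * ?T t) \<in> borel_measurable lborel"
    proof (intro borel_measurable_times_ennreal borel_measurable_indicator)
      have "(\<lambda>t. cis t * phase \<omega>) \<in> borel_measurable lborel"
        by (intro borel_measurable_times borel_measurable_const) (simp add: measurable_cis)
      then show "(\<lambda>t. ?A t \<omega>) \<in> borel_measurable lborel"
        by (rule measurable_compose[OF _ borel_measurable_indicator[OF A]])
    qed simp
    have "(\<integral>\<^sup>+t. ?A t \<omega> * ?T t \<partial>lborel) =
        ((\<integral>\<^sup>+t. ?A t \<omega> * ?T t \<partial>lborel) / ennreal (2 * pi)) * ennreal (2 * pi)"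
      by (simp add: ennreal_divide_times)
    also have "\<dots> = ?u * ennreal (2 * pi)"
      by (simp only: uniform_circle_rotate[OF A ph1])
    finally show "(\<integral>\<^sup>+t. (?A t \<omega> * ?T t) * ?Z \<omega> \<partial>lborel) =
        (?u * ennreal (2 * pi)) * ?Z \<omega>"
      by (simp only: nn_integral_multc[OF m])
  qed
  also have "\<dots> = (?u * ennreal (2 * pi)) * ?J"
    by (rule nn_integral_cmult[OF m_EX])
  finally have "?I * ennreal (2 * pi) = (?u * ?J) * ennreal (2 * pi)"
    by (simp only: mult_ac)
  then have I_eq: "?I = ?u * ?J"
    by (simp add: ennreal_mult_cancel_left mult.commute[of _ "ennreal (2 * pi)"])
  have setE: "?SE \<in> sets M"
    using measurable_sets[OF measurable_compose[OF measurable_X measurable_zeros] E]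
    by (simp add: vimage_def Int_def conj_commute)
  have setA: "?SA \<in> sets M"
    using measurable_sets[OF measurable_phase A] by (simp add: vimage_def Int_def conj_commute)
  have "?J = (\<integral>\<^sup>+\<omega>. indicator ?SE \<omega> \<partial>M)"
    by (intro nn_integral_cong) (simp add: indicator_def)
  also have "\<dots> = emeasure M ?SE" using setE by (rule nn_integral_indicator)
  finally have 1: "?J = emeasure M ?SE" .
  have "?I = (\<integral>\<^sup>+\<omega>. indicator (?SA \<inter> ?SE) \<omega> \<partial>M)"
    by (intro nn_integral_cong) (simp add: indicator_def ph_def phase_def)
  also have "\<dots> = emeasure M (?SA \<inter> ?SE)"
    by (rule nn_integral_indicator[OF sets.Int[OF setA setE]])
  also have "?SA \<inter> ?SE = {\<omega> \<in> space M. phase \<omega> \<in> A \<and> zeros (X \<omega>) \<in> E}"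
    by blast
  finally show ?thesis using I_eq 1 by simp
qed

lemma space_configs: "space configs = UNIV"
  by (simp add: configs_def)

lemma distr_phase: "distr M borel phase = uniform_circle"
proof (rule measure_eqI)
  show "sets (distr M borel phase) = sets uniform_circle" by (simp add: uniform_circle_def)
  fix A assume "A \<in> sets (distr M borel phase)"
  then have A: "A \<in> sets borel" by simp
  have "emeasure (distr M borel phase) A = emeasure M {\<omega> \<in> space M. phase \<omega> \<in> A}"
    by (subst emeasure_distr[OF measurable_phase A]) (simp add: vimage_def Int_def conj_commute)
  also have "\<dots> = emeasure uniform_circle A"
    using emeasure_phase_zeros[OF A, of UNIV] sets.top[of configs] by (simp add: space_configs emeasure_space_1)
  finally show "emeasure (distr M borel phase) A = emeasure uniform_circle A" .
qed

lemma indep_phase_zero_process: "indep_rv M borel phase configs (zero_process \<xi>)"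
proof -
  let ?VZ = "vimage_algebra (space M) (zero_process \<xi>) configs"
  let ?VP = "vimage_algebra (space M) phase borel"
  have m_zp: "zero_process \<xi> \<in> measurable M configs"
    using measurable_compose[OF measurable_X measurable_zeros]
    by (simp add: zero_process_eq_zeros[abs_def])
  have s1: "sets (?VP) = {phase -` A \<inter> space M | A. A \<in> sets borel}"
    by (rule sets_vimage_algebra2) simp
  have s2: "sets (?VZ) =
      {zero_process \<xi> -` E \<inter> space M | E. E \<in> sets configs}"
    by (rule sets_vimage_algebra2) (simp add: space_configs)
  have sub1: "sets (?VP) \<subseteq> events"
    unfolding s1 using measurable_sets[OF measurable_phase] by blast
  have sub2: "sets (?VZ) \<subseteq> events"
    unfolding s2 using measurable_sets[OF m_zp] by blast
  have "prob (a \<inter> b) = prob a * prob b"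
    if a: "a \<in> sets (?VP)"
      and b: "b \<in> sets (?VZ)" for a b
  proof -
    obtain A where A: "A \<in> sets borel" "a = phase -` A \<inter> space M"
      using a unfolding s1 by blast
    obtain E where E: "E \<in> sets configs" "b = zero_process \<xi> -` E \<inter> space M"
      using b unfolding s2 by blast
    have "a \<inter> b = {\<omega> \<in> space M. phase \<omega> \<in> A \<and> zeros (X \<omega>) \<in> E}"
      unfolding A(2) E(2) zero_process_eq_zeros[abs_def] by blast
    moreover have "b = {\<omega> \<in> space M. zeros (X \<omega>) \<in> E}"
      unfolding E(2) zero_process_eq_zeros[abs_def] by blast
    moreover have "emeasure uniform_circle A = emeasure M a"
      unfolding distr_phase[symmetric] A(2) by (rule emeasure_distr[OF measurable_phase A(1)])
    ultimately have "emeasure M (a \<inter> b) = emeasure M a * emeasure M b"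
      using emeasure_phase_zeros[OF A(1) E(1)] by simp
    then show ?thesis by (simp add: emeasure_eq_measure flip: ennreal_mult)
  qed
  then have "indep_set (sets (?VP))
      (sets (?VZ))"
    by (intro indep_setI sub1 sub2)
  then show ?thesis using measurable_phase m_zp by (simp add: indep_rv_def)
qed

end

section \<open>The main theorem\<close>

definition trunc_poly :: "nat \<Rightarrow> (nat \<Rightarrow> complex) \<Rightarrow> complex poly" where
  "trunc_poly n x = (\<Sum>j\<le>n. monom (coeff_seq x j) j)"

lemma coeff_seq_trunc: "coeff_seq (trunc_seq n x) j = (if j \<le> n then coeff_seq x j else 0)"
  by (simp add: coeff_seq_def trunc_seq_def)

lemma entire_seq_trunc: "entire_seq (trunc_seq n x)"
  by (rule entire_seq_finite_support[of n]) (simp add: trunc_seq_def)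

lemma poly_trunc_poly: "poly (trunc_poly n x) z = (\<Sum>j\<le>n. coeff_seq x j * z ^ j)"
  by (simp add: trunc_poly_def poly_sum poly_monom)

lemma gfun_trunc: "gfun (trunc_seq n x) = poly (trunc_poly n x)"
proof
  fix z
  have "gfun (trunc_seq n x) z = (\<Sum>j\<le>n. coeff_seq (trunc_seq n x) j * z ^ j)"
    unfolding gfun_def by (rule suminf_finite) (simp_all add: coeff_seq_trunc)
  also have "\<dots> = (\<Sum>j\<le>n. coeff_seq x j * z ^ j)"
    by (intro sum.cong refl) (simp add: coeff_seq_trunc)
  finally show "gfun (trunc_seq n x) z = poly (trunc_poly n x) z"
    by (simp only: poly_trunc_poly)
qed

lemma fps_of_trunc_poly: "fps_of_poly (trunc_poly n x) = gfps (trunc_seq n x)"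
proof (rule fps_ext)
  fix k
  have "coeff (trunc_poly n x) k = (\<Sum>j\<le>n. if j = k then coeff_seq x j else 0)"
    by (simp add: trunc_poly_def coeff_sum)
  then show "fps_nth (fps_of_poly (trunc_poly n x)) k = fps_nth (gfps (trunc_seq n x)) k"
    by (simp add: gfps_def coeff_seq_trunc)
qed

lemma gfps_nth_0: "fps_nth (gfps x) 0 = x 0"
  by (simp add: gfps_def coeff_seq_def)

lemma log_deriv_const_mult:
  assumes "c \<noteq> 0" "fps_nth F 0 \<noteq> 0"
  shows "log_deriv (fps_const c * F) = log_deriv F"
proof -
  have "log_deriv (fps_const c) = 0"
    by (rule log_deriv_unique) (use assms in simp_all)
  then show ?thesis using assms by (simp add: log_deriv_mult)
qed

text \<open>\<open>alpha_n\<close> sums over the set of roots, without multiplicity; squarefreeness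
  is what makes this agree with the logarithmic derivative.\<close>

lemma psum_squarefree_poly:
  fixes p :: "complex poly"
  assumes "rsquarefree p" "poly p 0 \<noteq> 0" "1 \<le> k"
  shows "psum (fps_of_poly p) k = (\<Sum>z | poly p z = 0. 1 / z ^ k)"
proof -
  have p0: "p \<noteq> 0" using assms(2) by auto
  define S where "S = {z. poly p z = 0}"
  have finS: "finite S" unfolding S_def by (rule poly_roots_finite[OF p0])
  have S0: "a \<noteq> 0" if "a \<in> S" for a using that assms(2) by (auto simp: S_def)
  have "fps_of_poly [:- a, 1:] = fps_X - fps_const a" for a :: complex
    by (simp add: fps_of_poly_pCons flip: fps_const_neg)
  then have "fps_of_poly p = fps_const (lead_coeff p) * (\<Prod>a\<in>S. fps_X - fps_const a)"
    using complex_poly_decompose_rsquarefree[OF assms(1)]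
    by (metis (no_types, lifting) S_def fps_of_poly_prod fps_of_poly_smult prod.cong)
  moreover have "lead_coeff p \<noteq> 0" using p0 by simp
  moreover note log_deriv_prod[OF finS, of "\<lambda>a. fps_X - fps_const a"]
  ultimately have "log_deriv (fps_of_poly p) = (\<Sum>a\<in>S. log_deriv (fps_X - fps_const a))"
    using S0 by (simp add: log_deriv_const_mult)
  also have "\<dots> = (\<Sum>a\<in>S. - shift_fps (\<lambda>i. (1 / a) ^ i))"
    by (intro sum.cong refl log_deriv_X_minus S0)
  finally show ?thesis
    using assms(3) unfolding psum_def
    by (simp add: fps_sum_nth shift_fps_def sum_negf power_divide S_def del: power_Suc)
qed

section \<open>Measurability of power sums, of modifications on null events, and of sums over random
  sets\<close>

lemma measurable_fps_inverse:
  fixes F :: "'a \<Rightarrow> complex fps"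
  assumes "\<And>n. (\<lambda>\<omega>. fps_nth (F \<omega>) n) \<in> borel_measurable A"
  shows "(\<lambda>\<omega>. fps_nth (inverse (F \<omega>)) n) \<in> borel_measurable A"
proof (induction n rule: less_induct)
  case (less n)
  show ?case
  proof (cases "n = 0")
    case True
    have "(\<lambda>z::complex. inverse z) \<in> borel_measurable borel" by measurable
    from measurable_compose[OF assms[of 0] this] show ?thesis using True by simp
  next
    case False
    have "fps_nth (inverse (F \<omega>)) n =
        - inverse (fps_nth (F \<omega>) 0) * (\<Sum>i=1..n. fps_nth (F \<omega>) i * fps_nth (inverse (F \<omega>)) (n - i))" for \<omega>
      using False by (cases n) (simp_all add: fps_inverse_def)
    moreover have "(\<lambda>\<omega>. - inverse (fps_nth (F \<omega>) 0) *
        (\<Sum>i=1..n. fps_nth (F \<omega>) i * fps_nth (inverse (F \<omega>)) (n - i))) \<in> borel_measurable A"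
    proof (rule borel_measurable_times)
      have "(\<lambda>z::complex. - inverse z) \<in> borel_measurable borel" by measurable
      from measurable_compose[OF assms[of 0] this]
      show "(\<lambda>\<omega>. - inverse (fps_nth (F \<omega>) 0)) \<in> borel_measurable A" .
      show "(\<lambda>\<omega>. \<Sum>i=1..n. fps_nth (F \<omega>) i * fps_nth (inverse (F \<omega>)) (n - i)) \<in> borel_measurable A"
        by (intro borel_measurable_sum borel_measurable_times assms less) (use False in auto)
    qed
    ultimately show ?thesis by (simp only:)
  qed
qed

lemma measurable_psum:
  fixes F :: "'a \<Rightarrow> complex fps"
  assumes "\<And>n. (\<lambda>\<omega>. fps_nth (F \<omega>) n) \<in> borel_measurable A"
  shows "(\<lambda>\<omega>. psum (F \<omega>) k) \<in> borel_measurable A"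
proof -
  have "(\<lambda>\<omega>. - (\<Sum>i=0..k - 1. (of_nat (i + 1) * fps_nth (F \<omega>) (i + 1)) * fps_nth (inverse (F \<omega>)) (k - 1 - i)))
      \<in> borel_measurable A"
    by (intro borel_measurable_uminus borel_measurable_sum borel_measurable_times
        borel_measurable_const assms measurable_fps_inverse)
  then show ?thesis by (simp only: psum_def log_deriv_def fps_mult_nth fps_deriv_nth)
qed

text \<open>Off a null set N the preimages under f are those under h, so only their traces on N need
  care. These are measurable by completeness when A is \<open>completion M\<close>, and by
  measurability of f when A is \<open>zero_sigma_algebra\<close>.\<close>

lemma measurable_AE_modify:
  assumes h: "h \<in> measurable A B" and space: "space A = space M"
    and ae: "AE x in M. f x = h x"
    and f: "\<And>x. x \<in> space M \<Longrightarrow> f x \<in> space B"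
    and null: "\<And>N D. N \<in> null_sets M \<Longrightarrow> D \<in> sets B \<Longrightarrow> f -` D \<inter> N \<in> sets A"
    and null': "\<And>N. N \<in> null_sets M \<Longrightarrow> N \<in> sets A"
  shows "f \<in> measurable A B"
proof (rule measurableI)
  fix D assume D: "D \<in> sets B"
  obtain N where N: "{x \<in> space M. f x \<noteq> h x} \<subseteq> N" "emeasure M N = 0" "N \<in> sets M"
    using ae by (rule AE_E)
  then have NN: "N \<in> null_sets M" by auto
  have "f -` D \<inter> space A = ((h -` D \<inter> space A) - N) \<union> (f -` D \<inter> N)"
    using N(1) sets.sets_into_space[OF N(3)] by (auto simp: space)
  also have "\<dots> \<in> sets A"
    using measurable_sets[OF h D] null[OF NN D] null'[OF NN] by (intro sets.Un sets.Diff)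
  finally show "f -` D \<inter> space A \<in> sets A" .
qed (use f space in simp)

lemma borel_measurable_completion_AE:
  fixes f h :: "'a \<Rightarrow> 'b::topological_space"
  assumes "h \<in> borel_measurable M" "AE x in M. f x = h x"
  shows "f \<in> borel_measurable (completion M)"
proof (rule measurable_AE_modify[OF _ _ assms(2)])
  show "h \<in> borel_measurable (completion M)"
    by (rule measurable_completion[OF assms(1)])
  show "f -` D \<inter> N \<in> sets (completion M)" if "N \<in> null_sets M" for N D
    using null_sets_completion_subset[of "f -` D \<inter> N" N M] null_sets_completionI[OF that] by auto
  show "N \<in> sets (completion M)" if "N \<in> null_sets M" for N
    using null_sets_completionI[OF that] by auto
qed simp_all

lemma zero_sigma_gen:
  "sets (vimage_algebra (space M) (zero_process \<xi>) configs) \<union> null_sets M \<subseteq> Pow (space M)"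
  using sets.sets_into_space[of _ M] sets.sets_into_space[of _ "vimage_algebra (space M) (zero_process \<xi>) configs"]
  by (auto simp: null_sets_def)

lemma space_zero_sigma_algebra: "space (zero_sigma_algebra M \<xi>) = space M"
  unfolding zero_sigma_algebra_def by (rule space_measure_of[OF zero_sigma_gen])

lemma sets_zero_sigma_algebra_null: "N \<in> null_sets M \<Longrightarrow> N \<in> sets (zero_sigma_algebra M \<xi>)"
  unfolding zero_sigma_algebra_def sets_measure_of[OF zero_sigma_gen] by (rule sigma_sets.Basic) simp

lemma sets_zero_sigma_algebra_vimage:
  assumes "E \<in> sets configs"
  shows "zero_process \<xi> -` E \<inter> space M \<in> sets (zero_sigma_algebra M \<xi>)"
  unfolding zero_sigma_algebra_def sets_measure_of[OF zero_sigma_gen]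
  by (rule sigma_sets.Basic, rule UnI1, rule in_vimage_algebra[OF assms])

text \<open>\<open>zero_sigma_algebra\<close> adjoins the null sets of M, not arbitrary subsets of
  them; hence f is required to be measurable for M.\<close>

lemma borel_measurable_zero_sigma_AE:
  fixes f h :: "'a \<Rightarrow> 'b::topological_space"
  assumes f: "f \<in> borel_measurable M" and h: "h \<in> borel_measurable (zero_sigma_algebra M \<xi>)"
    and ae: "AE x in M. f x = h x"
  shows "f \<in> borel_measurable (zero_sigma_algebra M \<xi>)"
proof (rule measurable_AE_modify[OF h space_zero_sigma_algebra ae])
  show "f -` D \<inter> N \<in> sets (zero_sigma_algebra M \<xi>)" if "N \<in> null_sets M" "D \<in> sets borel" for N D
  proof (rule sets_zero_sigma_algebra_null)
    have "f -` D \<inter> N = (f -` D \<inter> space M) \<inter> N"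
      using sets.sets_into_space[of N M] that(1) by (auto simp: null_sets_def)
    also have "\<dots> \<in> null_sets M"
      by (rule null_set_Int1[OF that(1) measurable_sets[OF f that(2)]])
    finally show "f -` D \<inter> N \<in> null_sets M" .
  qed
  show "N \<in> sets (zero_sigma_algebra M \<xi>)" if "N \<in> null_sets M" for N
    by (rule sets_zero_sigma_algebra_null[OF that])
qed simp

lemma sets_configs_count:
  assumes "B \<in> sets borel" "bounded B"
  shows "{S. finite (S \<inter> B) \<and> card (S \<inter> B) = m} \<in> sets configs"
  unfolding configs_def using assms by (subst sets_measure_of) (auto intro: sigma_sets.Basic)

text \<open>For a simple function the sum is a finite combination of counts, and a general
  \<open>\<phi>\<close> is a pointwise limit of such functions. This leads from the counting events
  generating \<open>configs\<close> to linear statistics of the zeros.\<close>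

lemma borel_measurable_sum_random_set:
  fixes \<phi> :: "'b::topological_space \<Rightarrow> 'c::{real_normed_vector, second_countable_topology}"
  assumes fin: "\<And>\<omega>. \<omega> \<in> space A \<Longrightarrow> finite (W \<omega>)"
    and count: "\<And>B. B \<in> sets borel \<Longrightarrow> (\<lambda>\<omega>. real (card (W \<omega> \<inter> B))) \<in> borel_measurable A"
    and \<phi>: "\<phi> \<in> borel_measurable borel"
  shows "(\<lambda>\<omega>. \<Sum>z\<in>W \<omega>. \<phi> z) \<in> borel_measurable A"
proof -
  obtain s where s: "\<And>i. simple_function borel (s i)" "\<And>z. (\<lambda>i. s i z) \<longlonglongrightarrow> \<phi> z"
    using borel_measurable_implies_sequence_metric[OF \<phi>, of 0] by auto
  show ?thesis
  proof (rule borel_measurable_LIMSEQ_metric)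
    show "(\<lambda>i. \<Sum>z\<in>W \<omega>. s i z) \<longlonglongrightarrow> (\<Sum>z\<in>W \<omega>. \<phi> z)" for \<omega>
      by (intro tendsto_sum s(2))
    fix i
    have range: "finite (range (s i))" using simple_functionD(1)[OF s(1)[of i]] by simp
    have B: "s i -` {y} \<in> sets borel" for y
      using simple_functionD(2)[OF s(1)[of i], of "{y}"] by simp
    have "(\<lambda>\<omega>. \<Sum>y\<in>range (s i). real (card (W \<omega> \<inter> s i -` {y})) *\<^sub>R y) \<in> borel_measurable A"
      by (intro borel_measurable_sum borel_measurable_scaleR count B borel_measurable_const)
    moreover have "(\<Sum>z\<in>W \<omega>. s i z) = (\<Sum>y\<in>range (s i). real (card (W \<omega> \<inter> s i -` {y})) *\<^sub>R y)"
      if "\<omega> \<in> space A" for \<omega>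
    proof -
      have "(\<Sum>z\<in>W \<omega>. s i z) = (\<Sum>y\<in>range (s i). \<Sum>z\<in>{z \<in> W \<omega>. s i z = y}. s i z)"
        by (rule sum.group[symmetric]) (use fin[OF that] range in auto)
      also have "\<dots> = (\<Sum>y\<in>range (s i). real (card (W \<omega> \<inter> s i -` {y})) *\<^sub>R y)"
      proof (rule sum.cong[OF refl])
        fix y
        have "{z \<in> W \<omega>. s i z = y} = W \<omega> \<inter> s i -` {y}" by auto
        moreover have "(\<Sum>z\<in>W \<omega> \<inter> s i -` {y}. s i z) = (\<Sum>z\<in>W \<omega> \<inter> s i -` {y}. y)"
          by (intro sum.cong) auto
        ultimately show "(\<Sum>z\<in>{z \<in> W \<omega>. s i z = y}. s i z) = real (card (W \<omega> \<inter> s i -` {y})) *\<^sub>R y"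
          by (simp add: sum_constant_scaleR)
      qed
      finally show ?thesis .
    qed
    ultimately show "(\<lambda>\<omega>. \<Sum>z\<in>W \<omega>. s i z) \<in> borel_measurable A"
      by (subst measurable_cong) auto
  qed
qed

lemma measurable_poly_funs:
  assumes "P \<in> poly_funs k" "\<And>i. 1 \<le> i \<Longrightarrow> i \<le> k \<Longrightarrow> b i \<in> borel_measurable A"
  shows "(\<lambda>\<omega>. P (\<lambda>i. b i \<omega>)) \<in> borel_measurable A"
  using assms
proof (induction P rule: poly_funs.induct)
  case (const c)
  show ?case by (rule borel_measurable_const)
next
  case (coord i)
  then show ?case by simp
next
  case (add P Q)
  show ?case by (rule borel_measurable_add[OF add.IH(1)[OF add.prems] add.IH(2)[OF add.prems]])
next
  case (mult P Q)
  show ?case by (rule borel_measurable_times[OF mult.IH(1)[OF mult.prems] mult.IH(2)[OF mult.prems]])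
qed

text \<open>The integral in \<open>jensen_power_sum\<close> only sees the deviation of \<open>log \<bar>f\<bar>\<close> from a constant,
  since constants have vanishing Fourier coefficients of order \<open>k \<ge> 1\<close>.\<close>

lemma norm_psum_diff_le:
  assumes ent: "entire_seq x" and x0: "x 0 \<noteq> 0" and "0 < R" "1 \<le> k"
    and simple: "\<not> double_zero x" and circle: "\<not> circle_zero R x"
    and I: "(\<integral>\<^sup>+t. ennreal (log_dev x (circlepath 0 R t)) * indicator {0..1} t \<partial>lborel) = ennreal I" "0 \<le> I"
  shows "cmod ((\<Sum>z | gfun x z = 0 \<and> cmod z < R. 1 / z ^ k - cnj z ^ k / R ^ (2 * k)) - psum (gfps x) k)
    \<le> 2 * real k * I / R ^ k" (is "cmod ?S \<le> _")
proof -
  let ?c = "circlepath 0 R"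
  let ?f = "gfun x"
  let ?l = "\<lambda>t. ln (cmod (?f (?c t)))"
  let ?h = "\<lambda>t. complex_of_real (?l t) / ?c t ^ k - of_real (R\<^sup>2 / 2) / ?c t ^ k"
  let ?d = "\<lambda>t. log_dev x (?c t)"
  define J where "J = ?S / (2 * of_nat k)"
  have norm_c: "cmod (?c t) = R" for t using \<open>0 < R\<close> by (simp add: circlepath norm_mult)
  have circle': "?f z \<noteq> 0" if "cmod z = R" for z
    using circle ent that by (auto simp: circle_zero_def)
  have simple': "deriv ?f z \<noteq> 0" if "?f z = 0" for z
    using simple ent that deriv_gfun[OF ent] by (auto simp: double_zero_def)
  have 1: "((\<lambda>t. of_real (?l t) / ?c t ^ k) has_integral J) {0..1}"
    unfolding J_def
    by (rule jensen_power_sum(2)[OF gfun_holomorphic[OF ent] gfun_has_fps_expansion[OF ent]])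
      (use x0 assms(3,4) simple' circle' in \<open>simp_all add: gfun_0\<close>)
  have "((\<lambda>t. of_real (Re (of_real (R\<^sup>2 / 2))) / ?c t ^ k) has_integral
      ((deriv ^^ k) (\<lambda>z. complex_of_real (R\<^sup>2 / 2)) 0 / fact k) / 2) {0..1}"
    by (rule circle_coeff_integral[of _ "R + 1"]) (use assms(3,4) in simp_all)
  moreover have "(deriv ^^ k) (\<lambda>z. complex_of_real (R\<^sup>2 / 2)) 0 = 0"
    using \<open>1 \<le> k\<close> by (simp add: higher_deriv_const)
  ultimately have 2: "((\<lambda>t. of_real (R\<^sup>2 / 2) / ?c t ^ k) has_integral 0) {0..1}" by simp
  from has_integral_diff[OF 1 2]
  have 3: "(?h has_integral J) {0..1}"
    by simp
  \<comment> \<open>Without zeros on the circle the logarithm of the product splits; it also makes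
    the deviation continuous in t, so that its \<open>ennreal\<close> integral is an ordinary
    one.\<close>
  have dev: "?d t = \<bar>?l t - R\<^sup>2 / 2\<bar>" for t
  proof -
    have "cmod (?f (?c t)) > 0" using circle'[OF norm_c] by simp
    then show ?thesis unfolding log_dev_def norm_c by (simp add: ln_mult_pos)
  qed
  have "continuous_on {0..1} (\<lambda>t. ?f (?c t))"
    by (rule continuous_on_compose2[OF holomorphic_on_imp_continuous_on[OF gfun_holomorphic[OF ent, of UNIV]]])
      (auto simp: circlepath intro!: continuous_intros)
  then have cont: "continuous_on {0..1} ?d"
    unfolding dev using circle'[OF norm_c] by (intro continuous_intros) auto
  then have int: "?d integrable_on {0..1}"
    by (rule integrable_continuous_interval)
  then have hi: "(?d has_integral (integral {0..1} ?d)) {0..1}"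
    by (rule integrable_integral)
  have "ennreal I = ennreal (integral {0..1} ?d)"
    using nn_integral_has_integral_lebesgue'[OF _ hi] I(1) by (simp add: log_dev_def)
  moreover have "0 \<le> integral {0..1} ?d"
    by (rule integral_nonneg[OF int]) (simp add: log_dev_def)
  ultimately have I_eq: "I = integral {0..1} ?d"
    using I(2) by simp
  have "norm (integral {0..1} ?h)
    \<le> integral {0..1} (\<lambda>t. ?d t * (1 / R ^ k))"
  proof (rule integral_norm_bound_integral)
    show "?h integrable_on {0..1}"
      using 3 by (rule has_integral_integrable)
    show "(\<lambda>t. ?d t * (1 / R ^ k)) integrable_on {0..1}"
      using has_integral_mult_left[OF hi, of "1 / R ^ k"] by (rule has_integral_integrable)
    fix t :: real
    have "?h t =
        of_real (?l t - R\<^sup>2 / 2) / ?c t ^ k"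
      by (simp add: diff_divide_distrib)
    then have "norm (?h t) =
        \<bar>?l t - R\<^sup>2 / 2\<bar> / R ^ k"
      by (simp only: norm_divide norm_of_real norm_power norm_c)
    then show "norm (?h t)
        \<le> ?d t * (1 / R ^ k)"
      by (simp add: dev)
  qed
  also have "integral {0..1} ?h = J"
    using 3 by (rule integral_unique)
  also have "integral {0..1} (\<lambda>t. ?d t * (1 / R ^ k)) = I * (1 / R ^ k)"
    using has_integral_mult_left[OF hi, of "1 / R ^ k"] unfolding I_eq by (rule integral_unique)
  finally have "norm J \<le> I / R ^ k" by simp
  then have "2 * real k * norm J \<le> 2 * real k * (I / R ^ k)" by (rule mult_left_mono) simp
  moreover have "cmod ?S = 2 * real k * norm J"
    using \<open>1 \<le> k\<close> by (simp add: J_def norm_divide norm_mult)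
  ultimately show ?thesis by simp
qed

section \<open>The limits alpha_k and their recovery from the zeros\<close>

context gaussian_seq
begin

abbreviation L :: "nat \<Rightarrow> 'a \<Rightarrow> complex" where
  "L k \<omega> \<equiv> psum (gfps (X \<omega>)) k"

lemma measurable_L: "L k \<in> borel_measurable M"
proof (rule measurable_psum)
  show "(\<lambda>\<omega>. fps_nth (gfps (X \<omega>)) n) \<in> borel_measurable M" for n
    using measurable_compose[OF measurable_X measurable_coeff_seq[of n]] by (simp add: gfps_def)
qed

lemma measurable_psum_trunc: "(\<lambda>\<omega>. psum (gfps (trunc_seq n (X \<omega>))) k) \<in> borel_measurable M"
proof (rule measurable_psum)
  show "(\<lambda>\<omega>. fps_nth (gfps (trunc_seq n (X \<omega>))) j) \<in> borel_measurable M" for j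
    using measurable_compose[OF measurable_X measurable_coeff_seq[of j]]
    by (cases "j \<le> n") (simp_all add: gfps_def coeff_seq_trunc)
qed

lemma AE_alpha_n:
  assumes "1 \<le> k"
  shows "AE \<omega> in M. alpha_n \<xi> k n \<omega> = psum (gfps (trunc_seq n (X \<omega>))) k"
proof (rule AE_mp[OF AE_X0_nonzero], rule AE_mp[OF AE_no_double_zero_trunc[of n]], intro AE_I2 impI)
  fix \<omega> assume simple: "\<not> double_zero (trunc_seq n (X \<omega>))" and x0: "\<xi> 0 \<omega> \<noteq> 0"
  let ?p = "trunc_poly n (X \<omega>)"
  have gfun_eq: "gfun (trunc_seq n (X \<omega>)) = poly ?p" by (rule gfun_trunc)
  have "gfun_deriv (trunc_seq n (X \<omega>)) = poly (pderiv ?p)"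
  proof
    fix z
    show "gfun_deriv (trunc_seq n (X \<omega>)) z = poly (pderiv ?p) z"
      using deriv_gfun[OF entire_seq_trunc, of n "X \<omega>"] DERIV_imp_deriv[OF poly_DERIV, of ?p z]
      by (simp add: gfun_eq)
  qed
  then have "rsquarefree ?p"
    using simple entire_seq_trunc[of n "X \<omega>"] unfolding rsquarefree_roots double_zero_def gfun_eq by auto
  moreover have "poly ?p 0 \<noteq> 0"
    using x0 gfun_0[of "trunc_seq n (X \<omega>)"] by (simp add: gfun_eq trunc_seq_def)
  ultimately have "psum (fps_of_poly ?p) k = (\<Sum>z | poly ?p z = 0. 1 / z ^ k)"
    by (rule psum_squarefree_poly) (rule assms)
  moreover have "gaf_poly \<xi> n \<omega> z = poly ?p z" for z
    by (simp add: gaf_poly_def poly_trunc_poly coeff_seq_def)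
  ultimately show "alpha_n \<xi> k n \<omega> = psum (gfps (trunc_seq n (X \<omega>))) k"
    by (simp add: alpha_n_def fps_of_trunc_poly)
qed

lemma AE_alpha_n_eq_L:
  assumes "1 \<le> k" "k \<le> n"
  shows "AE \<omega> in M. alpha_n \<xi> k n \<omega> = L k \<omega>"
proof (rule AE_mp[OF AE_X0_nonzero], rule AE_mp[OF AE_alpha_n[OF assms(1), of n]], intro AE_I2 impI)
  fix \<omega> assume "alpha_n \<xi> k n \<omega> = psum (gfps (trunc_seq n (X \<omega>))) k" "\<xi> 0 \<omega> \<noteq> 0"
  moreover have "psum (gfps (X \<omega>)) k = psum (gfps (trunc_seq n (X \<omega>))) k"
    by (rule psum_cong) (use assms \<open>\<xi> 0 \<omega> \<noteq> 0\<close> in \<open>simp_all add: gfps_nth_0, simp_all add: gfps_def coeff_seq_trunc\<close>)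
  ultimately show "alpha_n \<xi> k n \<omega> = L k \<omega>" by simp
qed

text \<open>\<open>alpha_n\<close> is identified with a measurable function only off a null event,
  whence the completion.\<close>

lemma measurable_alpha_n: "1 \<le> k \<Longrightarrow> alpha_n \<xi> k n \<in> borel_measurable (completion M)"
  by (rule borel_measurable_completion_AE[OF measurable_psum_trunc AE_alpha_n])

text \<open>From n = k on the exceptional events are already null.\<close>

lemma tendsto_alpha_n:
  assumes "1 \<le> k"
  shows "tendsto_in_prob M (alpha_n \<xi> k) (L k)"
  unfolding tendsto_in_prob_def
proof (intro conjI allI impI)
  fix e :: real assume "e > 0"
  let ?A = "\<lambda>n. measure (completion M) {\<omega> \<in> space M. dist (alpha_n \<xi> k n \<omega>) (L k \<omega>) > e}"
  have "?A n = 0" if "n \<ge> k" for n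
  proof -
    have "AE \<omega> in completion M. \<not> dist (alpha_n \<xi> k n \<omega>) (L k \<omega>) > e"
      using AE_completion[OF AE_alpha_n_eq_L[OF assms that]]
      by (rule AE_mp) (use \<open>e > 0\<close> in \<open>auto intro!: AE_I2\<close>)
    from emeasure_eq_0_AE[OF this] show ?thesis by (simp add: measure_def)
  qed
  then have "eventually (\<lambda>n. ?A n = 0) sequentially"
    by (auto simp: eventually_sequentially)
  then show "?A \<longlonglongrightarrow> 0"
    by (rule tendsto_eventually)
qed (use assms in \<open>simp_all add: measurable_alpha_n measurable_L\<close>)

text \<open>From n = k on the probabilities in the definition do not depend on n: they equal that of
  \<open>dist (L k \<omega>) (Y \<omega>) > e\<close>, which therefore is 0.\<close>

lemma tendsto_in_prob_unique:
  assumes "1 \<le> k" "tendsto_in_prob M (alpha_n \<xi> k) Y"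
  shows "AE \<omega> in M. Y \<omega> = L k \<omega>"
proof -
  have Y: "Y \<in> borel_measurable M" and lim: "\<And>e. e > 0 \<Longrightarrow>
      (\<lambda>n. measure (completion M) {\<omega> \<in> space M. dist (alpha_n \<xi> k n \<omega>) (Y \<omega>) > e}) \<longlonglongrightarrow> 0"
    using assms(2) by (simp_all add: tendsto_in_prob_def)
  have le: "AE \<omega> in M. dist (L k \<omega>) (Y \<omega>) \<le> e" if e: "e > 0" for e
  proof -
    have meas: "{\<omega> \<in> space M. dist (f \<omega>) (Y \<omega>) > e} \<in> sets (completion M)"
      if "f \<in> borel_measurable (completion M)" for f :: "'a \<Rightarrow> complex"
    proof -
      have "(\<lambda>\<omega>. dist (f \<omega>) (Y \<omega>)) \<in> borel_measurable (completion M)"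
        by (rule borel_measurable_dist[OF that measurable_completion[OF Y]])
      then have "{\<omega> \<in> space (completion M). e < dist (f \<omega>) (Y \<omega>)} \<in> sets (completion M)"
        by (simp only: borel_measurable_iff_greater)
      then show ?thesis by simp
    qed
    let ?m = "measure (completion M)"
    let ?A = "\<lambda>n. {\<omega> \<in> space M. dist (alpha_n \<xi> k n \<omega>) (Y \<omega>) > e}"
    let ?S = "{\<omega> \<in> space M. dist (L k \<omega>) (Y \<omega>) > e}"
    have "?m (?A n) = ?m ?S"
      if "n \<ge> k" for n
    proof (rule measure_eq_AE)
      show "AE \<omega> in completion M. \<omega> \<in> ?A n \<longleftrightarrow> \<omega> \<in> ?S"
        using AE_completion[OF AE_alpha_n_eq_L[OF assms(1) that]]
        by (rule AE_mp) (auto intro!: AE_I2)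
    qed (intro meas measurable_alpha_n[OF assms(1)] measurable_completion measurable_L)+
    then have "eventually (\<lambda>n. ?m (?A n) = ?m ?S) sequentially"
      by (auto simp: eventually_sequentially)
    from tendsto_eventually[OF this] lim[OF e] have "?m ?S = 0"
      by (rule LIMSEQ_unique)
    moreover have S: "?S \<in> sets M"
    proof -
      have "(\<lambda>\<omega>. dist (L k \<omega>) (Y \<omega>)) \<in> borel_measurable M"
        by (rule borel_measurable_dist[OF measurable_L Y])
      then show ?thesis by (simp only: borel_measurable_iff_greater)
    qed
    ultimately have "prob ?S = 0" by simp
    then have "emeasure M ?S = 0" by (simp add: emeasure_eq_measure)
    with S have "?S \<in> null_sets M" by auto
    then have "AE \<omega> in M. \<omega> \<notin> ?S" by (rule AE_not_in)
    then show ?thesis by (rule AE_mp) (auto intro!: AE_I2)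
  qed
  have "AE \<omega> in M. \<forall>m. dist (L k \<omega>) (Y \<omega>) \<le> inverse (real (Suc m))"
    unfolding AE_all_countable by (intro allI le) simp
  then show ?thesis
  proof (rule AE_mp, intro AE_I2 impI)
    fix \<omega> assume *: "\<forall>m. dist (L k \<omega>) (Y \<omega>) \<le> inverse (real (Suc m))"
    have "dist (L k \<omega>) (Y \<omega>) \<le> 0"
      by (rule LIMSEQ_le_const[OF LIMSEQ_inverse_real_of_nat]) (use * in auto)
    then show "Y \<omega> = L k \<omega>" by simp
  qed
qed

lemma alpha_tendsto: "1 \<le> k \<Longrightarrow> tendsto_in_prob M (alpha_n \<xi> k) (alpha M \<xi> k)"
  unfolding alpha_def by (rule someI[of "tendsto_in_prob M (alpha_n \<xi> k)", OF tendsto_alpha_n])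

lemma measurable_alpha: "1 \<le> k \<Longrightarrow> alpha M \<xi> k \<in> borel_measurable M"
  using alpha_tendsto[of k] by (simp add: tendsto_in_prob_def)

lemma AE_alpha: "1 \<le> k \<Longrightarrow> AE \<omega> in M. alpha M \<xi> k \<omega> = L k \<omega>"
  by (rule tendsto_in_prob_unique[OF _ alpha_tendsto])

text \<open>Outcomes for which Jensen's formula applies on every circle of radius 2^n with errors
  tending to 0, so that the zeros determine each alpha_k pathwise.\<close>

definition good :: "'a \<Rightarrow> bool" where
  "good \<omega> \<longleftrightarrow> entire_seq (X \<omega>) \<and> \<xi> 0 \<omega> \<noteq> 0 \<and> \<not> double_zero (X \<omega>) \<and>
    (\<forall>n. \<not> circle_zero (2 ^ n) (X \<omega>)) \<and> (\<forall>n. circle_dev (2 ^ n) \<omega> \<noteq> top) \<and>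
    (\<lambda>n. enn2real (circle_dev (2 ^ n) \<omega>) / 2 ^ n) \<longlonglongrightarrow> 0"

lemma AE_good: "AE \<omega> in M. good \<omega>"
proof -
  have "AE \<omega> in M. \<forall>n. \<not> circle_zero (2 ^ n) (X \<omega>)"
    unfolding AE_all_countable by (intro allI AE_no_circle_zero)
  with AE_entire AE_X0_nonzero AE_no_double_zero AE_circle_dev show ?thesis
    unfolding good_def by eventually_elim blast
qed

lemma good_tendsto_L:
  assumes good: "good \<omega>" and "1 \<le> k"
  shows "(\<lambda>n. \<Sum>z\<in>zero_process \<xi> \<omega> \<inter> ball 0 (2 ^ n). 1 / z ^ k - cnj z ^ k / (2 ^ n) ^ (2 * k)) \<longlonglongrightarrow> L k \<omega>"
proof -
  have ent: "entire_seq (X \<omega>)" using good by (simp add: good_def)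
  let ?S = "\<lambda>n. \<Sum>z\<in>zero_process \<xi> \<omega> \<inter> ball 0 (2 ^ n). 1 / z ^ k - cnj z ^ k / (2 ^ n) ^ (2 * k)"
  let ?d = "\<lambda>n. enn2real (circle_dev (2 ^ n) \<omega>)"
  have le: "norm (?S n - L k \<omega>) \<le> 2 * real k * (?d n / 2 ^ n)" for n
  proof -
    have nt: "circle_dev (2 ^ n) \<omega> \<noteq> top" using good by (simp add: good_def)
    have set_eq: "zero_process \<xi> \<omega> \<inter> ball 0 (2 ^ n) = {z. gfun (X \<omega>) z = 0 \<and> cmod z < 2 ^ n}"
      using ent by (auto simp: zero_process_eq_zeros zeros_def)
    have "norm ((\<Sum>z | gfun (X \<omega>) z = 0 \<and> cmod z < 2 ^ n. 1 / z ^ k - cnj z ^ k / complex_of_real ((2 ^ n) ^ (2 * k))) - L k \<omega>)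
        \<le> 2 * real k * ?d n / (2 ^ n) ^ k"
    proof (rule norm_psum_diff_le[OF ent _ _ \<open>1 \<le> k\<close>, of "2 ^ n" "?d n"])
      show "(\<integral>\<^sup>+t. ennreal (log_dev (X \<omega>) (circlepath 0 (2 ^ n) t)) * indicator {0..1} t \<partial>lborel) = ennreal (?d n)"
        using nt by (simp add: circle_dev_def less_top)
    qed (use good in \<open>simp_all add: good_def\<close>)
    \<comment> \<open>R^k >= R for R = 2^n, which reduces all orders to the one sequence controlled
      by \<open>good\<close>.\<close>
    also have "\<dots> \<le> 2 * real k * ?d n / 2 ^ n"
    proof (rule divide_left_mono)
      have "((2::real) ^ n) ^ 1 \<le> (2 ^ n) ^ k" by (rule power_increasing) (use assms(2) in simp_all)
      then show "(2::real) ^ n \<le> (2 ^ n) ^ k" by simp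
    qed simp_all
    finally show ?thesis by (simp add: set_eq)
  qed
  have "(\<lambda>n. 2 * real k * (?d n / 2 ^ n)) \<longlonglongrightarrow> 2 * real k * 0"
    using good by (intro tendsto_mult tendsto_const) (simp add: good_def)
  then have "(\<lambda>n. 2 * real k * (?d n / 2 ^ n)) \<longlonglongrightarrow> 0" by simp
  then have "(\<lambda>n. ?S n - L k \<omega>) \<longlonglongrightarrow> 0"
    by (rule Lim_null_comparison[rotated]) (intro always_eventually allI le)
  then show ?thesis by (simp only: LIM_zero_iff)
qed

text \<open>The version of the limit picked by \<open>SOME\<close> agrees almost surely with the
  limit of corrected sums over the zeros in growing discs, and that limit is built from counts of
  zeros only.\<close>

lemma measurable_alpha_zeros:
  assumes k: "1 \<le> k"
  shows "alpha M \<xi> k \<in> borel_measurable (zero_sigma_algebra M \<xi>)" (is "_ \<in> borel_measurable ?Z")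
proof -
  obtain N where N: "{\<omega> \<in> space M. \<not> good \<omega>} \<subseteq> N" "emeasure M N = 0" "N \<in> sets M"
    using AE_good by (rule AE_E)
  then have NN: "N \<in> null_sets M" by auto
  \<comment> \<open>Emptying the configuration on the null set N keeps the sums finite for every
    outcome, and N itself belongs to \<open>zero_sigma_algebra\<close>.\<close>
  define W where "W n \<omega> = (if \<omega> \<in> N then {} else zero_process \<xi> \<omega> \<inter> ball 0 (2 ^ n))" for n \<omega>
  have finW: "finite (W n \<omega>)" if "\<omega> \<in> space ?Z" for n \<omega>
  proof (cases "\<omega> \<in> N")
    case False
    with N(1) that have g: "good \<omega>" by (auto simp: space_zero_sigma_algebra)
    then have "nondeg_seq (X \<omega>)" by (auto simp: good_def nondeg_seq_def)
    from finite_zeros[OF this compact_cball] have "finite (zeros (X \<omega>) \<inter> cball 0 (2 ^ n))" .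
    then have "finite (zero_process \<xi> \<omega> \<inter> ball 0 (2 ^ n))"
      unfolding zero_process_eq_zeros by (rule finite_subset[rotated]) auto
    then show ?thesis using False by (simp add: W_def)
  qed (simp add: W_def)
  have count: "(\<lambda>\<omega>. real (card (W n \<omega> \<inter> B))) \<in> borel_measurable ?Z" if B: "B \<in> sets borel" for n B
  proof -
    let ?B = "ball 0 (2 ^ n) \<inter> B"
    have "(\<lambda>\<omega>. card (W n \<omega> \<inter> B)) \<in> measurable ?Z (count_space UNIV)"
      unfolding measurable_count_space_eq2_countable
    proof (intro conjI ballI)
      fix m :: nat
      let ?E = "{S. finite (S \<inter> ?B) \<and> card (S \<inter> ?B) = m}"
      have E: "?E \<in> sets configs"
        by (rule sets_configs_count) (use B in \<open>auto intro: bounded_Int\<close>)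
      \<comment> \<open>On N the count is 0, so N joins the preimage exactly when m = 0.\<close>
      have eq: "(\<lambda>\<omega>. card (W n \<omega> \<inter> B)) -` {m} \<inter> space ?Z =
          ((zero_process \<xi> -` ?E \<inter> space M) - N) \<union> (if m = 0 then N else {})" (is "?l = ?r")
      proof (rule set_eqI)
        fix \<omega>
        show "\<omega> \<in> ?l \<longleftrightarrow> \<omega> \<in> ?r"
        proof (cases "\<omega> \<in> N")
          case True
          then have "\<omega> \<in> space M" using sets.sets_into_space[OF N(3)] by auto
          then show ?thesis using True by (auto simp: W_def space_zero_sigma_algebra)
        next
          case False
          have "zero_process \<xi> \<omega> \<inter> ?B = W n \<omega> \<inter> B" using False by (auto simp: W_def)
          moreover have "\<omega> \<in> space M \<Longrightarrow> finite (W n \<omega> \<inter> B)"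
            using finW[of \<omega> n] by (simp add: space_zero_sigma_algebra)
          ultimately show ?thesis using False by (auto simp: space_zero_sigma_algebra)
        qed
      qed
      show "(\<lambda>\<omega>. card (W n \<omega> \<inter> B)) -` {m} \<inter> space ?Z \<in> sets ?Z"
        unfolding eq using sets_zero_sigma_algebra_null[OF NN] sets_zero_sigma_algebra_vimage[OF E]
        by (intro sets.Un sets.Diff) auto
    qed simp
    then show ?thesis by (rule measurable_compose) simp
  qed
  let ?t = "\<lambda>n z. 1 / z ^ k - cnj z ^ k / (2 ^ n) ^ (2 * k)"
  have meas_sum: "(\<lambda>\<omega>. \<Sum>z\<in>W n \<omega>. ?t n z) \<in> borel_measurable ?Z" for n
  proof (rule borel_measurable_sum_random_set[OF finW count])
    have "cnj \<in> borel_measurable borel"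
      by (intro borel_measurable_continuous_onI continuous_intros)
    from measurable_compose[OF this, of "\<lambda>z. z ^ k / (2 ^ n) ^ (2 * k)" borel]
    have "(\<lambda>z. cnj z ^ k / (2 ^ n) ^ (2 * k)) \<in> borel_measurable borel" by measurable
    moreover have "(\<lambda>z::complex. 1 / z ^ k) \<in> borel_measurable borel" by measurable
    ultimately show "?t n \<in> borel_measurable borel"
      by (intro borel_measurable_diff)
  qed
  define H where "H \<omega> = lim (\<lambda>n. \<Sum>z\<in>W n \<omega>. ?t n z)" for \<omega>
  have H: "H \<in> borel_measurable ?Z"
    unfolding H_def by (rule borel_measurable_lim_metric[OF meas_sum])
  have "AE \<omega> in M. \<omega> \<notin> N" using NN by (rule AE_not_in)
  then have "AE \<omega> in M. alpha M \<xi> k \<omega> = H \<omega>"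
    using AE_alpha[OF k] AE_good
  proof eventually_elim
    case (elim \<omega>)
    have "(\<lambda>n. \<Sum>z\<in>W n \<omega>. ?t n z) \<longlonglongrightarrow> L k \<omega>"
      using good_tendsto_L[OF elim(3) k] elim(1) by (simp add: W_def)
    then have "H \<omega> = L k \<omega>" unfolding H_def by (rule limI)
    then show ?case using elim(2) by simp
  qed
  then show ?thesis by (rule borel_measurable_zero_sigma_AE[OF measurable_alpha[OF k] H])
qed

section \<open>The coefficients a_k, the normalisation chi, and the factorisation of f\<close>

lemma a_coeff_eq: "a_coeff M \<xi> k \<omega> = newton_coeff (\<lambda>i. alpha M \<xi> i \<omega>) k"
  by (simp add: a_coeff_def newton_poly_eq)

lemma measurable_a_coeff: "a_coeff M \<xi> k \<in> borel_measurable (zero_sigma_algebra M \<xi>)"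
proof -
  have "(\<lambda>\<omega>. newton_coeff (\<lambda>i. alpha M \<xi> i \<omega>) k) \<in> borel_measurable (zero_sigma_algebra M \<xi>)"
    by (rule measurable_poly_funs[OF newton_coeff_in_poly_funs[OF order_refl] measurable_alpha_zeros])
  then show ?thesis by (simp only: a_coeff_eq[abs_def])
qed

lemma measurable_chi: "chi M \<xi> \<in> borel_measurable (zero_sigma_algebra M \<xi>)"
proof -
  have "(\<lambda>\<omega>. \<Sum>j<k. fact j * (cmod (a_coeff M \<xi> j \<omega>))\<^sup>2) \<in> borel_measurable (zero_sigma_algebra M \<xi>)" for k
    by (intro borel_measurable_sum borel_measurable_times borel_measurable_const borel_measurable_power
        measurable_compose[OF measurable_a_coeff borel_measurable_norm])
  moreover have "(\<lambda>y. sqrt (real k) / sqrt y) \<in> borel_measurable borel" for k by measurable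
  ultimately have "(\<lambda>\<omega>. sqrt (real k) / sqrt (\<Sum>j<k. fact j * (cmod (a_coeff M \<xi> j \<omega>))\<^sup>2))
      \<in> borel_measurable (zero_sigma_algebra M \<xi>)" for k
    by (rule measurable_compose)
  then show ?thesis unfolding chi_def[abs_def] by (rule borel_measurable_lim_metric)
qed

lemma measurable_g_fun: "(\<lambda>\<omega>. g_fun M \<xi> \<omega> z) \<in> borel_measurable (zero_sigma_algebra M \<xi>)"
proof -
  have "(\<lambda>\<omega>. complex_of_real (chi M \<xi> \<omega>)) \<in> borel_measurable (zero_sigma_algebra M \<xi>)"
    by (rule measurable_compose[OF measurable_chi]) measurable
  then show ?thesis
    unfolding g_fun_def
    by (intro borel_measurable_suminf borel_measurable_times measurable_a_coeff borel_measurable_const)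
qed

lemma AE_a_coeff: "AE \<omega> in M. \<forall>k. a_coeff M \<xi> k \<omega> = coeff_seq (X \<omega>) k / \<xi> 0 \<omega>"
proof -
  \<comment> \<open>The limits are identified only for orders at least 1; order 0 is not among the
    coordinates of the polynomial functions.\<close>
  have "AE \<omega> in M. \<forall>k. alpha M \<xi> (Suc k) \<omega> = L (Suc k) \<omega>"
    unfolding AE_all_countable by (intro allI AE_alpha) simp
  with AE_X0_nonzero show ?thesis
  proof eventually_elim
    case (elim \<omega>)
    show ?case
    proof
      fix k
      have "newton_coeff (\<lambda>i. alpha M \<xi> i \<omega>) k = newton_coeff (psum (gfps (X \<omega>))) k"
      proof (rule poly_funs_cong[OF newton_coeff_in_poly_funs[OF order_refl]])
        fix i :: nat assume "1 \<le> i"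
        then show "alpha M \<xi> i \<omega> = L i \<omega>" using elim(2)[rule_format, of "i - 1"] by simp
      qed
      also have "\<dots> = fps_nth (gfps (X \<omega>)) k / fps_nth (gfps (X \<omega>)) 0"
        by (rule newton_coeff_psum) (use elim(1) in \<open>simp add: gfps_nth_0\<close>)
      finally show "a_coeff M \<xi> k \<omega> = coeff_seq (X \<omega>) k / \<xi> 0 \<omega>"
        unfolding a_coeff_eq gfps_nth_0 by (simp add: gfps_def)
    qed
  qed
qed

lemma AE_chi: "AE \<omega> in M. chi M \<xi> \<omega> = cmod (\<xi> 0 \<omega>)"
  using AE_X0_nonzero AE_a_coeff AE_strong_law
proof eventually_elim
  case (elim \<omega>)
  let ?s = "\<lambda>k. \<Sum>j<k. fact j * (cmod (a_coeff M \<xi> j \<omega>))\<^sup>2"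
  let ?r = "cmod (\<xi> 0 \<omega>)"
  have r: "?r > 0" using elim(1) by simp
  \<comment> \<open>The factor j! cancels the square of 1 / sqrt (j!) in the coefficients, leaving
    |xi_j|^2 / |xi_0|^2.\<close>
  have sum_eq: "(?s k) = sq_sum k \<omega> / ?r\<^sup>2" for k
  proof -
    have "fact j * (cmod (a_coeff M \<xi> j \<omega>))\<^sup>2 = (cmod (\<xi> j \<omega>))\<^sup>2 / ?r\<^sup>2" for j
      using elim(2) by (simp add: coeff_seq_def norm_divide norm_mult power_divide power_mult_distrib)
    then show ?thesis by (simp add: sq_sum_def sum_divide_distrib)
  qed
  have "(\<lambda>k. ?r / sqrt (sq_sum k \<omega> / real k)) \<longlonglongrightarrow> ?r / sqrt 1"
    by (intro tendsto_divide tendsto_const tendsto_real_sqrt elim(3)) simp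
  moreover have "sqrt (real k) / sqrt (?s k) = ?r / sqrt (sq_sum k \<omega> / real k)" for k
    unfolding sum_eq using r by (simp add: real_sqrt_divide)
  ultimately have "(\<lambda>k. sqrt (real k) / sqrt (?s k)) \<longlonglongrightarrow> ?r"
    by simp
  then show ?case unfolding chi_def by (rule limI)
qed

lemma AE_g_fun:
  "AE \<omega> in M. (\<forall>z. summable (\<lambda>k. complex_of_real (chi M \<xi> \<omega>) * a_coeff M \<xi> k \<omega> * z ^ k)) \<and>
    (\<forall>z. gaf \<xi> \<omega> z = phase \<omega> * g_fun M \<xi> \<omega> z)"
  using AE_X0_nonzero AE_a_coeff AE_chi AE_entire
proof eventually_elim
  case (elim \<omega>)
  let ?t = "\<lambda>z k. complex_of_real (chi M \<xi> \<omega>) * a_coeff M \<xi> k \<omega> * z ^ k"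
  \<comment> \<open>u is the inverse of the phase: |xi_0| is contributed by chi, 1 / xi_0 by every
    a_k.\<close>
  define u where "u = complex_of_real (cmod (\<xi> 0 \<omega>)) / \<xi> 0 \<omega>"
  have term_eq: "?t z k = u * (coeff_seq (X \<omega>) k * z ^ k)" for k z
    using elim(2,3) by (simp add: u_def)
  have "(\<lambda>k. u * (coeff_seq (X \<omega>) k * z ^ k)) sums (u * gfun (X \<omega>) z)" for z
    by (intro sums_mult gfun_sums elim(4))
  then have sums: "?t z sums (u * gfun (X \<omega>) z)" for z
    by (simp only: term_eq)
  have "phase \<omega> * u = 1" using elim(1) by (simp add: phase_def u_def)
  moreover have "g_fun M \<xi> \<omega> z = u * gfun (X \<omega>) z" for z
    unfolding g_fun_def using sums[of z] by (rule sums_unique[symmetric])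
  ultimately have "gaf \<xi> \<omega> z = phase \<omega> * g_fun M \<xi> \<omega> z" for z
    by (simp add: gaf_eq_gfun flip: mult.assoc)
  then show ?case using sums sums_summable by blast
qed

end

theorem theorem1p5:
  fixes M :: "'a measure" and \<xi> :: "nat \<Rightarrow> 'a \<Rightarrow> complex"
  assumes "prob_space M"
    and "iid_std_complex_gaussian M \<xi>"
  shows "(AE \<omega> in M. \<forall>z. summable (\<lambda>k. complex_of_real (chi M \<xi> \<omega>) * a_coeff M \<xi> k \<omega> * z ^ k))
    \<and> (\<forall>z. (\<lambda>\<omega>. g_fun M \<xi> \<omega> z) \<in> borel_measurable (zero_sigma_algebra M \<xi>))
    \<and> (\<exists>\<zeta>. indep_rv M borel \<zeta> configs (zero_process \<xi>)
         \<and> distr M borel \<zeta> = uniform_circle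
         \<and> (AE \<omega> in M. \<forall>z. gaf \<xi> \<omega> z = \<zeta> \<omega> * g_fun M \<xi> \<omega> z))"
proof -
  interpret prob_space M by fact
  interpret gaussian_seq M \<xi>
  proof
    show "indep_vars (\<lambda>_. borel) \<xi> UNIV"
      using assms(2) by (simp add: iid_std_complex_gaussian_def)
    fix k
    have "distributed M lborel (\<xi> k) (\<lambda>z. ennreal (exp (- (cmod z)\<^sup>2) / pi))"
      using assms(2) by (simp add: iid_std_complex_gaussian_def)
    then have "distr M lborel (\<xi> k) = gauss"
      unfolding gauss_def by (rule distributed_distr_eq_density)
    moreover have "distr M borel (\<xi> k) = distr M lborel (\<xi> k)"
      by (rule distr_cong) simp_all
    ultimately show "distr M borel (\<xi> k) = gauss" by simp
  qed
  have "AE \<omega> in M. \<forall>z. summable (\<lambda>k. complex_of_real (chi M \<xi> \<omega>) * a_coeff M \<xi> k \<omega> * z ^ k)"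
    "AE \<omega> in M. \<forall>z. gaf \<xi> \<omega> z = phase \<omega> * g_fun M \<xi> \<omega> z"
    using AE_g_fun by (auto elim: eventually_mono)
  then show ?thesis
    using measurable_g_fun indep_phase_zero_process distr_phase by blast
qed

end
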